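(* Let $R$ be a commutative noetherian ring with $\operatorname{char}(R) = p > 0$, where $p$ is a prime, let $I = (s_1,\dots,s_d)$ be an ideal in $R$, and let $\mathcal{L} = \mathcal{L}_{V(I)}$. Then: (1) Every $P_\bullet \in Ch^{[0,k]}_{\mathcal{L}}(\mathcal{P})$ with $k > \operatorname{pd}(R/I)$ has a reducer. (2) $\beta(\mathcal{L}_{V(I)}) \leq \operatorname{pd}(R/I)$.
   Context: $\mathcal{P}$ is the category of finitely generated projective $R$-modules, $\operatorname{pd}$ is projective dimension, and $\mathcal{L}_{V(I)}$ is the category of finitely generated $R$-modules $M$ with $\operatorname{Supp}(M)\subseteq V(I)$. $Ch^{[0,k]}_{\mathcal{L}}(\mathcal{P})$ is the category of chain complexes of modules in $\mathcal{P}$ concentrated in degrees $0,\dots,k$ with all homologies in $\mathcal{L}$. For $k \geq 1$ and $P_\bullet \in Ch^{[0,k]}_{\mathcal{L}}(\mathcal{P})$, a reducer of $P_\bullet$ is a pair $(Q_\bullet,u)$ where $Q_\bullet \in Ch^{[0,k-1]}_{\mathcal{L}}(\mathcal{P})$ and $u : Q_\bullet \to P_\bullet$ is a chain complex map such that $u_0 : Q_0 \to P_0$ is surjective. $\beta(\mathcal{L}) = \inf\{m \in \mathbb{N} \mid \text{for all } k > m, \text{ every } P_\bullet \in Ch^{[0,k]}_{\mathcal{L}}(\mathcal{P}) \text{ has a reducer}\}$.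
   Formalization: The case pd(R/I) = 0 with I ≠ 0 is excluded: there I = eR with e a nonzero idempotent, and the acyclic complex id: I → I in degrees 1, 0 has no reducer, so both (1) and (2) fail as stated. *)

theory Defs
  imports "HOL-Computational_Algebra.Primes" "HOL-Library.Extended_Nat"
    "HOL-Algebra.Module" "HOL-Algebra.Ring_Divisibility" "HOL-Algebra.Multiplicative_Group"
begin

section \<open>Modules\<close>

definition mod_hom ::
    "('a, 'm) ring_scheme \<Rightarrow> ('a, 'b) module \<Rightarrow> ('a, 'c) module \<Rightarrow> ('b \<Rightarrow> 'c) set" where
  "mod_hom R M N = {f. f \<in> carrier M \<rightarrow> carrier N \<and>
     (\<forall>x\<in>carrier M. \<forall>y\<in>carrier M. f (x \<oplus>\<^bsub>M\<^esub> y) = f x \<oplus>\<^bsub>N\<^esub> f y) \<and>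
     (\<forall>a\<in>carrier R. \<forall>x\<in>carrier M. f (a \<odot>\<^bsub>M\<^esub> x) = a \<odot>\<^bsub>N\<^esub> f x)}"

definition regular_module :: "('a, 'm) ring_scheme \<Rightarrow> ('a, 'a) module" where
  "regular_module R = \<lparr>carrier = carrier R, mult = mult R, one = \<one>\<^bsub>R\<^esub>, zero = \<zero>\<^bsub>R\<^esub>,
     add = add R, smult = mult R\<rparr>"

text \<open>The ring fields \<open>mult\<close> and \<open>one\<close> inherited by the record type of modules play no
  role for modules and are left unspecified below.\<close>

definition quotient_module ::
    "('a, 'm) ring_scheme \<Rightarrow> ('a, 'b) module \<Rightarrow> 'b set \<Rightarrow> ('a, 'b set) module" where
  "quotient_module R M N = \<lparr>carrier = a_rcosets\<^bsub>M\<^esub> N, mult = undefined, one = undefined,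
     zero = N, add = set_add M, smult = (\<lambda>a X. \<Union>x\<in>X. N +>\<^bsub>M\<^esub> (a \<odot>\<^bsub>M\<^esub> x))\<rparr>"

definition fin_gen_module :: "('a, 'm) ring_scheme \<Rightarrow> ('a, 'b) module \<Rightarrow> bool" where
  "fin_gen_module R M \<longleftrightarrow> module R M \<and>
     (\<exists>A. finite A \<and> A \<subseteq> carrier M \<and> (\<forall>N. submodule N R M \<and> A \<subseteq> N \<longrightarrow> N = carrier M))"

text \<open>Lifting property. A definition cannot quantify over types, so the test modules are taken in
  types that contain a free module mapping onto \<open>P\<close>, and \<open>P\<close> itself; by
  \<open>projective_module_lift\<close> below, lifting then holds for modules of arbitrary types.\<close>

definition projective_module :: "('a, 'm) ring_scheme \<Rightarrow> ('a, 'b) module \<Rightarrow> bool" where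
  "projective_module R P \<longleftrightarrow> module R P \<and>
     (\<forall>(M :: ('a, 'b \<Rightarrow> 'a) module) (N :: ('a, 'b) module) g f.
        module R M \<and> module R N \<and> g \<in> mod_hom R M N \<and> g ` carrier M = carrier N \<and>
        f \<in> mod_hom R P N \<longrightarrow>
        (\<exists>h \<in> mod_hom R P M. \<forall>x\<in>carrier P. g (h x) = f x))"


section \<open>Localization and support\<close>

definition loc_rel ::
    "('a, 'm) ring_scheme \<Rightarrow> 'a set \<Rightarrow> ('a, 'b) module \<Rightarrow> (('b \<times> 'a) \<times> ('b \<times> 'a)) set" where
  "loc_rel R S M = {((x, s), (y, t)) | x s y t. x \<in> carrier M \<and> s \<in> S \<and> y \<in> carrier M \<and> t \<in> S \<and>
     (\<exists>u\<in>S. u \<odot>\<^bsub>M\<^esub> (t \<odot>\<^bsub>M\<^esub> x) = u \<odot>\<^bsub>M\<^esub> (s \<odot>\<^bsub>M\<^esub> y))}"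

text \<open>\<open>S\<^sup>-\<^sup>1M\<close> as an \<open>R\<close>-module; the class of \<open>(x, s)\<close> is the fraction \<open>x/s\<close>.\<close>

definition localization ::
    "('a, 'm) ring_scheme \<Rightarrow> 'a set \<Rightarrow> ('a, 'b) module \<Rightarrow> ('a, ('b \<times> 'a) set) module" where
  "localization R S M = \<lparr>carrier = (carrier M \<times> S) // loc_rel R S M,
     mult = undefined, one = undefined,
     zero = loc_rel R S M `` {(\<zero>\<^bsub>M\<^esub>, \<one>\<^bsub>R\<^esub>)},
     add = (\<lambda>X Y. \<Union>(x, s)\<in>X. \<Union>(y, t)\<in>Y.
              loc_rel R S M `` {(t \<odot>\<^bsub>M\<^esub> x \<oplus>\<^bsub>M\<^esub> s \<odot>\<^bsub>M\<^esub> y, s \<otimes>\<^bsub>R\<^esub> t)}),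
     smult = (\<lambda>a X. \<Union>(x, s)\<in>X. loc_rel R S M `` {(a \<odot>\<^bsub>M\<^esub> x, s)})\<rparr>"

definition support :: "('a, 'm) ring_scheme \<Rightarrow> ('a, 'b) module \<Rightarrow> 'a set set" where
  "support R M = {\<pp>. primeideal \<pp> R \<and>
     carrier (localization R (carrier R - \<pp>) M) \<noteq> {\<zero>\<^bsub>localization R (carrier R - \<pp>) M\<^esub>}}"

definition zariski_closed :: "('a, 'm) ring_scheme \<Rightarrow> 'a set \<Rightarrow> 'a set set" where
  "zariski_closed R I = {\<pp>. primeideal \<pp> R \<and> I \<subseteq> \<pp>}"

text \<open>Membership in the category \<open>\<L>\<^sub>V\<close>, for a set \<open>V\<close> of primes.\<close>

definition in_L :: "('a, 'm) ring_scheme \<Rightarrow> 'a set set \<Rightarrow> ('a, 'b) module \<Rightarrow> bool" where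
  "in_L R V M \<longleftrightarrow> fin_gen_module R M \<and> support R M \<subseteq> V"


section \<open>Chain complexes\<close>

text \<open>Homological grading over all integers: \<open>bdry C n\<close> goes from degree \<open>n\<close> to degree \<open>n - 1\<close>.\<close>

record ('a, 'b) cplx =
  obj :: "int \<Rightarrow> ('a, 'b) module"
  bdry :: "int \<Rightarrow> 'b \<Rightarrow> 'b"

definition chain_complex :: "('a, 'm) ring_scheme \<Rightarrow> ('a, 'b) cplx \<Rightarrow> bool" where
  "chain_complex R C \<longleftrightarrow>
     (\<forall>n. module R (obj C n) \<and> bdry C n \<in> mod_hom R (obj C n) (obj C (n - 1)) \<and>
        (\<forall>x\<in>carrier (obj C n). bdry C (n - 1) (bdry C n x) = \<zero>\<^bsub>obj C (n - 1 - 1)\<^esub>))"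

definition concentrated :: "nat \<Rightarrow> ('a, 'b) cplx \<Rightarrow> bool" where
  "concentrated k C \<longleftrightarrow> (\<forall>n. n < 0 \<or> n > int k \<longrightarrow> carrier (obj C n) = {\<zero>\<^bsub>obj C n\<^esub>})"

definition cycles :: "('a, 'b) cplx \<Rightarrow> int \<Rightarrow> 'b set" where
  "cycles C n = a_kernel (obj C n) (obj C (n - 1)) (bdry C n)"

definition boundaries :: "('a, 'b) cplx \<Rightarrow> int \<Rightarrow> 'b set" where
  "boundaries C n = bdry C (n + 1) ` carrier (obj C (n + 1))"

definition homology ::
    "('a, 'm) ring_scheme \<Rightarrow> ('a, 'b) cplx \<Rightarrow> int \<Rightarrow> ('a, 'b set) module" where
  "homology R C n = quotient_module R ((obj C n)\<lparr>carrier := cycles C n\<rparr>) (boundaries C n)"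

definition chain_map ::
    "('a, 'm) ring_scheme \<Rightarrow> ('a, 'b) cplx \<Rightarrow> ('a, 'c) cplx \<Rightarrow> (int \<Rightarrow> 'b \<Rightarrow> 'c) \<Rightarrow> bool" where
  "chain_map R C D u \<longleftrightarrow>
     (\<forall>n. u n \<in> mod_hom R (obj C n) (obj D n) \<and>
        (\<forall>x\<in>carrier (obj C n). bdry D n (u n x) = u (n - 1) (bdry C n x)))"


section \<open>Projective dimension\<close>

definition projective_resolution ::
    "('a, 'm) ring_scheme \<Rightarrow> ('a, 'b) module \<Rightarrow> nat \<Rightarrow> ('a, 'c) cplx \<Rightarrow> ('c \<Rightarrow> 'b) \<Rightarrow> bool" where
  "projective_resolution R M n F \<epsilon> \<longleftrightarrow>
     chain_complex R F \<and> concentrated n F \<and> (\<forall>i. projective_module R (obj F i)) \<and>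
     \<epsilon> \<in> mod_hom R (obj F 0) M \<and> \<epsilon> ` carrier (obj F 0) = carrier M \<and>
     a_kernel (obj F 0) M \<epsilon> = boundaries F 0 \<and>
     (\<forall>i>0. cycles F i = boundaries F i)"

text \<open>The least length of a projective resolution, \<open>\<infinity>\<close> if there is no finite one; with this
  convention the zero module has projective dimension 0. The type \<open>nat \<times> 'a \<times> 'b \<Rightarrow> 'a\<close> of the
  modules in the resolution contains a free module whose rank is at least \<open>\<aleph>\<^sub>0\<close> and at least the
  cardinalities of \<open>R\<close> and \<open>M\<close>; as truncating a free resolution in this type at a projective syzygy
  shows, allowing other types would not decrease the infimum.\<close>

definition projective_dimension ::
    "('a, 'm) ring_scheme \<Rightarrow> ('a, 'b) module \<Rightarrow> enat" where
  "projective_dimension R M =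
     Inf {enat n | n. \<exists>(F :: ('a, nat \<times> 'a \<times> 'b \<Rightarrow> 'a) cplx) \<epsilon>. projective_resolution R M n F \<epsilon>}"


section \<open>Reducers\<close>

text \<open>\<open>Ch_L R V k C\<close> says that \<open>C\<close> is an object of \<open>Ch\<^sup>[\<^sup>0\<^sup>,\<^sup>k\<^sup>]\<close> of finitely generated projective
  modules, with homologies in \<open>\<L>\<^sub>V\<close>.\<close>

definition Ch_L :: "('a, 'm) ring_scheme \<Rightarrow> 'a set set \<Rightarrow> nat \<Rightarrow> ('a, 'b) cplx \<Rightarrow> bool" where
  "Ch_L R V k C \<longleftrightarrow> chain_complex R C \<and> concentrated k C \<and>
     (\<forall>n. fin_gen_module R (obj C n) \<and> projective_module R (obj C n)) \<and>
     (\<forall>n. in_L R V (homology R C n))"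

text \<open>Only meaningful for \<open>k \<ge> 1\<close>.\<close>

definition reducer ::
    "('a, 'm) ring_scheme \<Rightarrow> 'a set set \<Rightarrow> nat \<Rightarrow> ('a, 'b) cplx \<Rightarrow>
     ('a, 'c) cplx \<Rightarrow> (int \<Rightarrow> 'c \<Rightarrow> 'b) \<Rightarrow> bool" where
  "reducer R V k P Q u \<longleftrightarrow> Ch_L R V (k - 1) Q \<and> chain_map R Q P u \<and>
     u 0 ` carrier (obj Q 0) = carrier (obj P 0)"

text \<open>If \<open>I \<noteq> 0\<close> is generated by an idempotent (for instance \<open>I = R\<close>), then \<open>R/I\<close> has projective
  dimension 0, but the acyclic complex \<open>id : I \<rightarrow> I\<close> in degrees 1 and 0 has no reducer for \<open>k = 1\<close>:
  a reducer \<open>Q\<close> would be a module \<open>Q\<^sub>0\<close> supported in \<open>V(I)\<close> that maps onto \<open>I\<close>, whereas \<open>I\<close> is nonzero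
  and \<open>Supp I\<close> is disjoint from \<open>V(I)\<close>. The theorem therefore excludes the case \<open>pd(R/I) = 0\<close>,
  \<open>I \<noteq> 0\<close>.\<close>

text \<open>Up to isomorphism every finitely generated projective module is a submodule of some \<open>R\<^sup>n\<close>,
  hence lives in the type \<open>nat \<Rightarrow> 'a\<close>; so fixing that type for \<open>Q\<close>, and for \<open>P\<close> in \<open>reduction_bound\<close>
  (the number \<open>\<beta>(\<L>\<^sub>V)\<close>), is no restriction.\<close>

definition has_reducer :: "('a, 'm) ring_scheme \<Rightarrow> 'a set set \<Rightarrow> nat \<Rightarrow> ('a, 'b) cplx \<Rightarrow> bool" where
  "has_reducer R V k P \<longleftrightarrow> (\<exists>(Q :: ('a, nat \<Rightarrow> 'a) cplx) u. reducer R V k P Q u)"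

definition reduction_bound :: "('a, 'm) ring_scheme \<Rightarrow> 'a set set \<Rightarrow> enat" where
  "reduction_bound R V = Inf {enat m | m.
     \<forall>k>m. \<forall>P :: ('a, nat \<Rightarrow> 'a) cplx. Ch_L R V k P \<longrightarrow> has_reducer R V k P}"


section \<open>Characteristic\<close>

text \<open>The additive order of 1, which is 0 if that order is infinite.\<close>

definition ring_char :: "('a, 'm) ring_scheme \<Rightarrow> nat" where
  "ring_char R = group.ord (add_monoid R) \<one>\<^bsub>R\<^esub>"


section \<open>Basic facts\<close>

lemma quotient_smult:
  assumes "module R M" "submodule N R M" "a \<in> carrier R" "x \<in> carrier M"
  shows "a \<odot>\<^bsub>quotient_module R M N\<^esub> (N +>\<^bsub>M\<^esub> x) = N +>\<^bsub>M\<^esub> (a \<odot>\<^bsub>M\<^esub> x)"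
proof -
  interpret module R M by fact
  interpret N: submodule N R M by fact
  interpret NS: abelian_subgroup N M
    by (rule abelian_subgroupI3[OF additive_subgroupI[OF N.subgroup_axioms] M.abelian_group_axioms])
  have eq: "N +>\<^bsub>M\<^esub> (a \<odot>\<^bsub>M\<^esub> y) = N +>\<^bsub>M\<^esub> (a \<odot>\<^bsub>M\<^esub> x)" if y: "y \<in> N +>\<^bsub>M\<^esub> x" for y
  proof -
    obtain h where h: "h \<in> N" "y = h \<oplus>\<^bsub>M\<^esub> x" using y by (auto simp: a_r_coset_defs)
    have hc: "h \<in> carrier M" using h NS.a_subset by auto
    have "a \<odot>\<^bsub>M\<^esub> y = a \<odot>\<^bsub>M\<^esub> h \<oplus>\<^bsub>M\<^esub> a \<odot>\<^bsub>M\<^esub> x" using h hc assms by (simp add: smult_r_distr)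
    moreover have "a \<odot>\<^bsub>M\<^esub> h \<in> N" using h assms by simp
    ultimately have "a \<odot>\<^bsub>M\<^esub> y \<in> N +>\<^bsub>M\<^esub> (a \<odot>\<^bsub>M\<^esub> x)" by (auto simp: a_r_coset_defs)
    then show ?thesis
      by (rule M.a_repr_independence[symmetric])
        (use assms N.subgroup_axioms in simp_all)
  qed
  moreover have "x \<in> N +>\<^bsub>M\<^esub> x" using assms by (simp add: NS.a_rcos_self)
  ultimately have "(\<Union>y\<in>N +>\<^bsub>M\<^esub> x. N +>\<^bsub>M\<^esub> (a \<odot>\<^bsub>M\<^esub> y)) = N +>\<^bsub>M\<^esub> (a \<odot>\<^bsub>M\<^esub> x)"
    by blast
  then show ?thesis by (simp add: quotient_module_def)
qed

lemma quotient_module_module: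
  assumes "module R M" "submodule N R M"
  shows "module R (quotient_module R M N)"
proof -
  interpret module R M by fact
  interpret N: submodule N R M by fact
  interpret NS: abelian_subgroup N M
    by (rule abelian_subgroupI3[OF additive_subgroupI[OF N.subgroup_axioms] M.abelian_group_axioms])
  let ?Q = "quotient_module R M N"
  have car: "X \<in> carrier ?Q \<longleftrightarrow> (\<exists>x\<in>carrier M. X = N +>\<^bsub>M\<^esub> x)" for X
    by (auto simp: quotient_module_def A_RCOSETS_def')
  have add: "(N +>\<^bsub>M\<^esub> x) \<oplus>\<^bsub>?Q\<^esub> (N +>\<^bsub>M\<^esub> y) = N +>\<^bsub>M\<^esub> (x \<oplus>\<^bsub>M\<^esub> y)"
    if "x \<in> carrier M" "y \<in> carrier M" for x y
    using that by (simp add: quotient_module_def NS.a_rcos_sum)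
  note sm = quotient_smult[OF assms]
  show ?thesis
  proof (rule moduleI)
    show "cring R" ..
    have zero: "\<zero>\<^bsub>?Q\<^esub> = N +>\<^bsub>M\<^esub> \<zero>\<^bsub>M\<^esub>"
      by (simp add: quotient_module_def NS.a_subset)
    show "abelian_group ?Q"
    proof (rule abelian_groupI)
      fix X assume "X \<in> carrier ?Q"
      then obtain x where x: "x \<in> carrier M" "X = N +>\<^bsub>M\<^esub> x" by (auto simp: car)
      then show "\<exists>Y\<in>carrier ?Q. Y \<oplus>\<^bsub>?Q\<^esub> X = \<zero>\<^bsub>?Q\<^esub>"
        using M.l_neg by (intro bexI[of _ "N +>\<^bsub>M\<^esub> (\<ominus>\<^bsub>M\<^esub> x)"]) (auto simp: car add zero)
    qed (use zero in \<open>auto simp: car add M.a_ac\<close>)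
  qed (auto simp: car add sm smult_l_distr smult_r_distr smult_assoc1)
qed

lemma loc_rel_equiv:
  assumes "module R M" "submonoid S R"
  shows "equiv (carrier M \<times> S) (loc_rel R S M)"
proof -
  interpret module R M by fact
  interpret S: submonoid S R by fact
  have S: "s \<in> carrier R" if "s \<in> S" for s using that S.subset by auto
  show ?thesis
  proof (rule equivI)
    show "loc_rel R S M \<subseteq> (carrier M \<times> S) \<times> (carrier M \<times> S)" by (auto simp: loc_rel_def)
    show "refl_on (carrier M \<times> S) (loc_rel R S M)"
      unfolding refl_on_def using S.one_closed by (auto simp: loc_rel_def)
    show "sym (loc_rel R S M)" unfolding sym_def by (force simp: loc_rel_def)
    show "trans (loc_rel R S M)"
    proof (rule transI)
      fix X Y Z assume "(X, Y) \<in> loc_rel R S M" "(Y, Z) \<in> loc_rel R S M"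
      then obtain x s y t z r u v where
        e: "X = (x, s)" "Y = (y, t)" "Z = (z, r)" and c: "x \<in> carrier M" "y \<in> carrier M" "z \<in> carrier M"
        and m: "s \<in> S" "t \<in> S" "r \<in> S" "u \<in> S" "v \<in> S"
        and 1: "u \<odot>\<^bsub>M\<^esub> (t \<odot>\<^bsub>M\<^esub> x) = u \<odot>\<^bsub>M\<^esub> (s \<odot>\<^bsub>M\<^esub> y)"
        and 2: "v \<odot>\<^bsub>M\<^esub> (r \<odot>\<^bsub>M\<^esub> y) = v \<odot>\<^bsub>M\<^esub> (t \<odot>\<^bsub>M\<^esub> z)"
        by (auto simp: loc_rel_def)
      note mc = m[THEN S]
      let ?w = "u \<otimes>\<^bsub>R\<^esub> v \<otimes>\<^bsub>R\<^esub> t"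
      have "?w \<odot>\<^bsub>M\<^esub> (r \<odot>\<^bsub>M\<^esub> x) = (u \<otimes>\<^bsub>R\<^esub> v \<otimes>\<^bsub>R\<^esub> t \<otimes>\<^bsub>R\<^esub> r) \<odot>\<^bsub>M\<^esub> x" using mc c by (simp add: smult_assoc1)
      also have "u \<otimes>\<^bsub>R\<^esub> v \<otimes>\<^bsub>R\<^esub> t \<otimes>\<^bsub>R\<^esub> r = (v \<otimes>\<^bsub>R\<^esub> r) \<otimes>\<^bsub>R\<^esub> (u \<otimes>\<^bsub>R\<^esub> t)" using mc by (simp add: R.m_ac)
      also have "\<dots> \<odot>\<^bsub>M\<^esub> x = (v \<otimes>\<^bsub>R\<^esub> r) \<odot>\<^bsub>M\<^esub> (u \<odot>\<^bsub>M\<^esub> (s \<odot>\<^bsub>M\<^esub> y))" using mc c 1 by (simp add: smult_assoc1)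
      also have "\<dots> = (u \<otimes>\<^bsub>R\<^esub> s) \<odot>\<^bsub>M\<^esub> (v \<odot>\<^bsub>M\<^esub> (r \<odot>\<^bsub>M\<^esub> y))"
        using mc c by (simp add: smult_assoc1[symmetric] R.m_ac)
      also have "\<dots> = (u \<otimes>\<^bsub>R\<^esub> s) \<odot>\<^bsub>M\<^esub> (v \<odot>\<^bsub>M\<^esub> (t \<odot>\<^bsub>M\<^esub> z))" using 2 by simp
      also have "\<dots> = ?w \<odot>\<^bsub>M\<^esub> (s \<odot>\<^bsub>M\<^esub> z)"
        using mc c by (simp add: smult_assoc1[symmetric] R.m_ac)
      finally show "(X, Z) \<in> loc_rel R S M"
        using e c m S.m_closed by (auto simp: loc_rel_def)
    qed
  qed
qed

lemma loc_class_eq: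
  assumes "module R M" "submonoid S R" "x \<in> carrier M" "y \<in> carrier M" "s \<in> S" "t \<in> S"
  shows "loc_rel R S M `` {(x, s)} = loc_rel R S M `` {(y, t)} \<longleftrightarrow>
    (\<exists>u\<in>S. u \<odot>\<^bsub>M\<^esub> (t \<odot>\<^bsub>M\<^esub> x) = u \<odot>\<^bsub>M\<^esub> (s \<odot>\<^bsub>M\<^esub> y))"
  using eq_equiv_class_iff[OF loc_rel_equiv[OF assms(1,2)], of "(x,s)" "(y,t)"] assms
  by (auto simp: loc_rel_def)

lemma primeideal_compl_submonoid:
  assumes "primeideal P R" shows "submonoid (carrier R - P) R"
proof -
  interpret primeideal P R by fact
  show ?thesis using I_prime I_notcarr one_imp_carrier by unfold_locales auto
qed

lemma support_iff:
  fixes R :: "('a, 'm) ring_scheme" and M :: "('a, 'b) module"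
  assumes "module R M"
  shows "P \<in> support R M \<longleftrightarrow> primeideal P R \<and> (\<exists>x\<in>carrier M. \<forall>s\<in>carrier R - P. s \<odot>\<^bsub>M\<^esub> x \<noteq> \<zero>\<^bsub>M\<^esub>)"
proof (cases "primeideal P R")
  case True
  interpret module R M by fact
  let ?S = "carrier R - P"
  interpret S: submonoid ?S R by (rule primeideal_compl_submonoid[OF True])
  have S: "s \<in> carrier R" if "s \<in> ?S" for s using that by auto
  have z: "loc_rel R ?S M `` {(x, s)} = loc_rel R ?S M `` {(\<zero>\<^bsub>M\<^esub>, \<one>\<^bsub>R\<^esub>)} \<longleftrightarrow> (\<exists>u\<in>?S. u \<odot>\<^bsub>M\<^esub> x = \<zero>\<^bsub>M\<^esub>)"
    if "x \<in> carrier M" "s \<in> ?S" for x s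
    using that S.one_closed
    by (subst loc_class_eq[OF assms S.submonoid_axioms]) auto
  have "carrier (localization R ?S M) \<noteq> {\<zero>\<^bsub>localization R ?S M\<^esub>} \<longleftrightarrow>
      (\<exists>x\<in>carrier M. \<exists>s\<in>?S. loc_rel R ?S M `` {(x, s)} \<noteq> loc_rel R ?S M `` {(\<zero>\<^bsub>M\<^esub>, \<one>\<^bsub>R\<^esub>)})"
  proof -
    have "carrier (localization R ?S M) = {loc_rel R ?S M `` {(x, s)} | x s. x \<in> carrier M \<and> s \<in> ?S}"
      by (auto simp: localization_def quotient_def)
    moreover have "\<zero>\<^bsub>localization R ?S M\<^esub> = loc_rel R ?S M `` {(\<zero>\<^bsub>M\<^esub>, \<one>\<^bsub>R\<^esub>)}"
      by (simp add: localization_def)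
    moreover have "loc_rel R ?S M `` {(\<zero>\<^bsub>M\<^esub>, \<one>\<^bsub>R\<^esub>)} \<in> {loc_rel R ?S M `` {(x, s)} | x s. x \<in> carrier M \<and> s \<in> ?S}"
      using S.one_closed M.zero_closed by blast
    moreover have "A \<noteq> {z} \<longleftrightarrow> (\<exists>y\<in>A. y \<noteq> z)" if "z \<in> A" for A :: "('b \<times> 'a) set set" and z
      using that by auto
    ultimately have "?thesis \<longleftrightarrow> (\<exists>y\<in>{loc_rel R ?S M `` {(x, s)} | x s. x \<in> carrier M \<and> s \<in> ?S}.
        y \<noteq> loc_rel R ?S M `` {(\<zero>\<^bsub>M\<^esub>, \<one>\<^bsub>R\<^esub>)}) = (\<exists>x\<in>carrier M. \<exists>s\<in>?S.
        loc_rel R ?S M `` {(x, s)} \<noteq> loc_rel R ?S M `` {(\<zero>\<^bsub>M\<^esub>, \<one>\<^bsub>R\<^esub>)})"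
      by (simp only:)
    then show ?thesis by (simp only:) blast
  qed
  also have "\<dots> \<longleftrightarrow> (\<exists>x\<in>carrier M. \<forall>s\<in>carrier R - P. s \<odot>\<^bsub>M\<^esub> x \<noteq> \<zero>\<^bsub>M\<^esub>)"
    using z S.one_closed by auto
  finally show ?thesis using True by (simp add: support_def)
qed (simp add: support_def)


lemma ring_char_dvd:
  assumes "ring R"
  shows "[n] \<cdot>\<^bsub>R\<^esub> \<one>\<^bsub>R\<^esub> = \<zero>\<^bsub>R\<^esub> \<longleftrightarrow> ring_char R dvd n"
proof -
  interpret ring R by fact
  show ?thesis
    unfolding ring_char_def using group.pow_eq_id[OF a_group, of "\<one>\<^bsub>R\<^esub>" n]
    by (simp add: add_pow_def)
qed

lemma localization_module:
  assumes "module R M" "submonoid S R"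
  shows "module R (localization R S M)"
proof -
  interpret module R M by fact
  interpret S: submonoid S R by fact
  have S: "s \<in> carrier R" if "s \<in> S" for s using that S.subset by auto
  let ?L = "localization R S M"
  define cl where "cl x s = loc_rel R S M `` {(x, s)}" for x s
  note EQ = loc_rel_equiv[OF assms]
  have car: "X \<in> carrier ?L \<longleftrightarrow> (\<exists>x\<in>carrier M. \<exists>s\<in>S. X = cl x s)" for X
    by (auto simp: localization_def quotient_def cl_def)
  have mem: "(y, t) \<in> cl x s \<longleftrightarrow> y \<in> carrier M \<and> t \<in> S \<and> (\<exists>u\<in>S. u \<odot>\<^bsub>M\<^esub> (t \<odot>\<^bsub>M\<^esub> x) = u \<odot>\<^bsub>M\<^esub> (s \<odot>\<^bsub>M\<^esub> y))"
    if "x \<in> carrier M" "s \<in> S" for x s y t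
    using that by (auto simp: cl_def loc_rel_def)
  have eqI: "cl x s = cl y t" if "u \<odot>\<^bsub>M\<^esub> (t \<odot>\<^bsub>M\<^esub> x) = u \<odot>\<^bsub>M\<^esub> (s \<odot>\<^bsub>M\<^esub> y)"
    "x \<in> carrier M" "y \<in> carrier M" "s \<in> S" "t \<in> S" "u \<in> S" for x y s t u
    using that loc_class_eq[OF assms, of x y s t] by (auto simp: cl_def)
  have self: "(x, s) \<in> cl x s" if "x \<in> carrier M" "s \<in> S" for x s
    using that S.one_closed by (auto simp: mem)
  have sm: "a \<odot>\<^bsub>?L\<^esub> cl x s = cl (a \<odot>\<^bsub>M\<^esub> x) s" if a: "a \<in> carrier R" and x: "x \<in> carrier M" "s \<in> S" for a x s
  proof -
    have "cl (a \<odot>\<^bsub>M\<^esub> y) t = cl (a \<odot>\<^bsub>M\<^esub> x) s" if yt: "(y, t) \<in> cl x s" for y t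
    proof -
      obtain u where u: "y \<in> carrier M" "t \<in> S" "u \<in> S" and e: "u \<odot>\<^bsub>M\<^esub> (t \<odot>\<^bsub>M\<^esub> x) = u \<odot>\<^bsub>M\<^esub> (s \<odot>\<^bsub>M\<^esub> y)"
        using yt mem[OF x] by auto
      have "u \<odot>\<^bsub>M\<^esub> (s \<odot>\<^bsub>M\<^esub> (a \<odot>\<^bsub>M\<^esub> y)) = a \<odot>\<^bsub>M\<^esub> (u \<odot>\<^bsub>M\<^esub> (s \<odot>\<^bsub>M\<^esub> y))"
        using a x u S by (simp add: smult_assoc1[symmetric] R.m_ac)
      also have "\<dots> = u \<odot>\<^bsub>M\<^esub> (t \<odot>\<^bsub>M\<^esub> (a \<odot>\<^bsub>M\<^esub> x))"
        unfolding e[symmetric] using a x u S by (simp add: smult_assoc1[symmetric] R.m_ac)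
      finally show ?thesis using u a x by (intro eqI[of u]) auto
    qed
    then have "(\<Union>(y, t)\<in>cl x s. cl (a \<odot>\<^bsub>M\<^esub> y) t) = cl (a \<odot>\<^bsub>M\<^esub> x) s"
      using self[OF x] by fast
    then show ?thesis by (simp add: localization_def cl_def)
  qed
  have ad: "cl x s \<oplus>\<^bsub>?L\<^esub> cl y t = cl (t \<odot>\<^bsub>M\<^esub> x \<oplus>\<^bsub>M\<^esub> s \<odot>\<^bsub>M\<^esub> y) (s \<otimes>\<^bsub>R\<^esub> t)"
    if x: "x \<in> carrier M" "s \<in> S" and y: "y \<in> carrier M" "t \<in> S" for x y s t
  proof -
    have *: "cl (t' \<odot>\<^bsub>M\<^esub> x' \<oplus>\<^bsub>M\<^esub> s' \<odot>\<^bsub>M\<^esub> y') (s' \<otimes>\<^bsub>R\<^esub> t') = cl (t \<odot>\<^bsub>M\<^esub> x \<oplus>\<^bsub>M\<^esub> s \<odot>\<^bsub>M\<^esub> y) (s \<otimes>\<^bsub>R\<^esub> t)"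
      if xs': "(x', s') \<in> cl x s" and yt': "(y', t') \<in> cl y t" for x' s' y' t'
    proof -
      obtain u where u: "x' \<in> carrier M" "s' \<in> S" "u \<in> S" and e: "u \<odot>\<^bsub>M\<^esub> (s' \<odot>\<^bsub>M\<^esub> x) = u \<odot>\<^bsub>M\<^esub> (s \<odot>\<^bsub>M\<^esub> x')"
        using xs' mem[OF x] by auto
      obtain v where v: "y' \<in> carrier M" "t' \<in> S" "v \<in> S" and f: "v \<odot>\<^bsub>M\<^esub> (t' \<odot>\<^bsub>M\<^esub> y) = v \<odot>\<^bsub>M\<^esub> (t \<odot>\<^bsub>M\<^esub> y')"
        using yt' mem[OF y] by auto
      note c = S[OF x(2)] S[OF y(2)] S[OF u(2)] S[OF u(3)] S[OF v(2)] S[OF v(3)]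
      let ?w = "u \<otimes>\<^bsub>R\<^esub> v"
      have 1: "?w \<odot>\<^bsub>M\<^esub> ((s \<otimes>\<^bsub>R\<^esub> t) \<odot>\<^bsub>M\<^esub> (t' \<odot>\<^bsub>M\<^esub> x')) = ?w \<odot>\<^bsub>M\<^esub> ((s' \<otimes>\<^bsub>R\<^esub> t') \<odot>\<^bsub>M\<^esub> (t \<odot>\<^bsub>M\<^esub> x))"
      proof -
        have "?w \<odot>\<^bsub>M\<^esub> ((s \<otimes>\<^bsub>R\<^esub> t) \<odot>\<^bsub>M\<^esub> (t' \<odot>\<^bsub>M\<^esub> x')) = (v \<otimes>\<^bsub>R\<^esub> t \<otimes>\<^bsub>R\<^esub> t') \<odot>\<^bsub>M\<^esub> (u \<odot>\<^bsub>M\<^esub> (s \<odot>\<^bsub>M\<^esub> x'))"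
          using c x u by (simp add: smult_assoc1[symmetric] R.m_ac)
        also have "\<dots> = ?w \<odot>\<^bsub>M\<^esub> ((s' \<otimes>\<^bsub>R\<^esub> t') \<odot>\<^bsub>M\<^esub> (t \<odot>\<^bsub>M\<^esub> x))"
          unfolding e[symmetric] using c x u by (simp add: smult_assoc1[symmetric] R.m_ac)
        finally show ?thesis .
      qed
      have 2: "?w \<odot>\<^bsub>M\<^esub> ((s \<otimes>\<^bsub>R\<^esub> t) \<odot>\<^bsub>M\<^esub> (s' \<odot>\<^bsub>M\<^esub> y')) = ?w \<odot>\<^bsub>M\<^esub> ((s' \<otimes>\<^bsub>R\<^esub> t') \<odot>\<^bsub>M\<^esub> (s \<odot>\<^bsub>M\<^esub> y))"
      proof -
        have "?w \<odot>\<^bsub>M\<^esub> ((s \<otimes>\<^bsub>R\<^esub> t) \<odot>\<^bsub>M\<^esub> (s' \<odot>\<^bsub>M\<^esub> y')) = (u \<otimes>\<^bsub>R\<^esub> s \<otimes>\<^bsub>R\<^esub> s') \<odot>\<^bsub>M\<^esub> (v \<odot>\<^bsub>M\<^esub> (t \<odot>\<^bsub>M\<^esub> y'))"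
          using c y v by (simp add: smult_assoc1[symmetric] R.m_ac)
        also have "\<dots> = ?w \<odot>\<^bsub>M\<^esub> ((s' \<otimes>\<^bsub>R\<^esub> t') \<odot>\<^bsub>M\<^esub> (s \<odot>\<^bsub>M\<^esub> y))"
          unfolding f[symmetric] using c y v by (simp add: smult_assoc1[symmetric] R.m_ac)
        finally show ?thesis .
      qed
      have "?w \<odot>\<^bsub>M\<^esub> ((s \<otimes>\<^bsub>R\<^esub> t) \<odot>\<^bsub>M\<^esub> (t' \<odot>\<^bsub>M\<^esub> x' \<oplus>\<^bsub>M\<^esub> s' \<odot>\<^bsub>M\<^esub> y'))
          = ?w \<odot>\<^bsub>M\<^esub> ((s' \<otimes>\<^bsub>R\<^esub> t') \<odot>\<^bsub>M\<^esub> (t \<odot>\<^bsub>M\<^esub> x \<oplus>\<^bsub>M\<^esub> s \<odot>\<^bsub>M\<^esub> y))"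
        using 1 2 c x y u v by (simp add: smult_r_distr)
      then show ?thesis using c x y u v S.m_closed by (intro eqI[of ?w]) auto
    qed
    have "(\<Union>(x', s')\<in>cl x s. \<Union>(y', t')\<in>cl y t. cl (t' \<odot>\<^bsub>M\<^esub> x' \<oplus>\<^bsub>M\<^esub> s' \<odot>\<^bsub>M\<^esub> y') (s' \<otimes>\<^bsub>R\<^esub> t'))
        = cl (t \<odot>\<^bsub>M\<^esub> x \<oplus>\<^bsub>M\<^esub> s \<odot>\<^bsub>M\<^esub> y) (s \<otimes>\<^bsub>R\<^esub> t)"
      using self[OF x] self[OF y] * by fast
    then show ?thesis by (simp add: localization_def cl_def)
  qed
  have zero: "\<zero>\<^bsub>?L\<^esub> = cl \<zero>\<^bsub>M\<^esub> \<one>\<^bsub>R\<^esub>" by (simp add: localization_def cl_def)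
  have eq1: "cl x s = cl y t" if "t \<odot>\<^bsub>M\<^esub> x = s \<odot>\<^bsub>M\<^esub> y"
    "x \<in> carrier M" "y \<in> carrier M" "s \<in> S" "t \<in> S" for x y s t
    using that S.one_closed by (intro eqI[of "\<one>\<^bsub>R\<^esub>"]) auto
  note simps = smult_assoc1[symmetric] smult_r_distr R.m_ac M.add.m_ac
  have abel: "abelian_group ?L"
  proof (rule abelian_groupI)
    fix X Y assume "X \<in> carrier ?L" "Y \<in> carrier ?L"
    then obtain x s y t where [simp]: "X = cl x s" "Y = cl y t" and
      c: "x \<in> carrier M" "s \<in> S" "y \<in> carrier M" "t \<in> S" by (auto simp: car)
    show "X \<oplus>\<^bsub>?L\<^esub> Y \<in> carrier ?L" using c S unfolding car by (intro bexI[of _ "t \<odot>\<^bsub>M\<^esub> x \<oplus>\<^bsub>M\<^esub> s \<odot>\<^bsub>M\<^esub> y"] bexI[of _ "s \<otimes>\<^bsub>R\<^esub> t"]) (auto simp: ad)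
    show "X \<oplus>\<^bsub>?L\<^esub> Y = Y \<oplus>\<^bsub>?L\<^esub> X" using c S by (simp add: ad R.m_comm M.a_comm)
    fix Z assume "Z \<in> carrier ?L"
    then obtain z r where [simp]: "Z = cl z r" and d: "z \<in> carrier M" "r \<in> S" by (auto simp: car)
    show "X \<oplus>\<^bsub>?L\<^esub> Y \<oplus>\<^bsub>?L\<^esub> Z = X \<oplus>\<^bsub>?L\<^esub> (Y \<oplus>\<^bsub>?L\<^esub> Z)"
      using c d S by (simp add: ad simps)
  next
    show "\<zero>\<^bsub>?L\<^esub> \<in> carrier ?L" using S.one_closed M.zero_closed unfolding zero car by blast
    fix X assume "X \<in> carrier ?L"
    then obtain x s where [simp]: "X = cl x s" and c: "x \<in> carrier M" "s \<in> S" by (auto simp: car)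
    show "\<zero>\<^bsub>?L\<^esub> \<oplus>\<^bsub>?L\<^esub> X = X" using c S S.one_closed by (simp add: zero ad)
    have m: "cl (\<ominus>\<^bsub>M\<^esub> x) s \<in> carrier ?L" using c by (auto simp: car)
    have "cl (\<ominus>\<^bsub>M\<^esub> x) s \<oplus>\<^bsub>?L\<^esub> X = cl \<zero>\<^bsub>M\<^esub> (s \<otimes>\<^bsub>R\<^esub> s)" using c S by (simp add: ad smult_r_minus M.l_neg)
    also have "\<dots> = \<zero>\<^bsub>?L\<^esub>" unfolding zero using c S S.one_closed by (intro eq1) auto
    finally show "\<exists>Y\<in>carrier ?L. Y \<oplus>\<^bsub>?L\<^esub> X = \<zero>\<^bsub>?L\<^esub>" using m by blast
  qed
  show ?thesis
  proof (rule moduleI)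
    show "cring R" ..
    show "abelian_group ?L" by (rule abel)
    fix a X assume a: "a \<in> carrier R" and "X \<in> carrier ?L"
    then obtain x s where [simp]: "X = cl x s" and c: "x \<in> carrier M" "s \<in> S" by (auto simp: car)
    show "a \<odot>\<^bsub>?L\<^esub> X \<in> carrier ?L" using a c by (auto simp: sm car)
    fix b assume b: "b \<in> carrier R"
    show "(a \<otimes>\<^bsub>R\<^esub> b) \<odot>\<^bsub>?L\<^esub> X = a \<odot>\<^bsub>?L\<^esub> (b \<odot>\<^bsub>?L\<^esub> X)" using a b c by (simp add: sm smult_assoc1)
    show "(a \<oplus>\<^bsub>R\<^esub> b) \<odot>\<^bsub>?L\<^esub> X = a \<odot>\<^bsub>?L\<^esub> X \<oplus>\<^bsub>?L\<^esub> b \<odot>\<^bsub>?L\<^esub> X"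
      using a b c S by (simp add: sm ad, intro eq1) (auto simp: smult_l_distr simps R.l_distr R.r_distr)
  next
    fix a X Y assume a: "a \<in> carrier R" and "X \<in> carrier ?L" "Y \<in> carrier ?L"
    then obtain x s y t where [simp]: "X = cl x s" "Y = cl y t" and
      c: "x \<in> carrier M" "s \<in> S" "y \<in> carrier M" "t \<in> S" by (auto simp: car)
    show "a \<odot>\<^bsub>?L\<^esub> (X \<oplus>\<^bsub>?L\<^esub> Y) = a \<odot>\<^bsub>?L\<^esub> X \<oplus>\<^bsub>?L\<^esub> a \<odot>\<^bsub>?L\<^esub> Y"
      using a c S by (simp add: sm ad simps)
  next
    fix X assume "X \<in> carrier ?L"
    then show "\<one>\<^bsub>R\<^esub> \<odot>\<^bsub>?L\<^esub> X = X" by (auto simp: car sm)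
  qed
qed

text \<open>The free module on \<open>B\<close>, as finitely supported functions, and the linear extension of a map
  defined on \<open>B\<close>.\<close>

definition free_module :: "('a, 'm) ring_scheme \<Rightarrow> 'b set \<Rightarrow> ('a, 'b \<Rightarrow> 'a) module" where
  "free_module R B = \<lparr>carrier = {\<phi>. finite {b. \<phi> b \<noteq> \<zero>\<^bsub>R\<^esub>} \<and> (\<forall>b. \<phi> b \<in> carrier R) \<and> (\<forall>b. b \<notin> B \<longrightarrow> \<phi> b = \<zero>\<^bsub>R\<^esub>)},
     mult = undefined, one = undefined, zero = (\<lambda>b. \<zero>\<^bsub>R\<^esub>),
     add = (\<lambda>\<phi> \<psi> b. \<phi> b \<oplus>\<^bsub>R\<^esub> \<psi> b), smult = (\<lambda>a \<phi> b. a \<otimes>\<^bsub>R\<^esub> \<phi> b)\<rparr>"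

lemma free_module_module:
  fixes R :: "('a, 'm) ring_scheme" and B :: "'b set"
  assumes "cring R"
  shows "module R (free_module R B)"
proof -
  interpret cring R by fact
  show ?thesis
  proof (rule moduleI)
    show "cring R" by fact
    have add: "finite {b. \<phi> b \<oplus>\<^bsub>R\<^esub> \<psi> b \<noteq> \<zero>\<^bsub>R\<^esub>}" if "finite {b. \<phi> b \<noteq> \<zero>\<^bsub>R\<^esub>}" "finite {b. \<psi> b \<noteq> \<zero>\<^bsub>R\<^esub>}" for \<phi> \<psi> :: "'b \<Rightarrow> 'a"
      by (rule finite_subset[of _ "{b. \<phi> b \<noteq> \<zero>\<^bsub>R\<^esub>} \<union> {b. \<psi> b \<noteq> \<zero>\<^bsub>R\<^esub>}"]) (use that in auto)
    show "abelian_group (free_module R B)"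
    proof (rule abelian_groupI)
      fix \<phi> assume \<phi>: "\<phi> \<in> carrier (free_module R B)"
      have "{b. \<ominus>\<^bsub>R\<^esub> \<phi> b \<noteq> \<zero>\<^bsub>R\<^esub>} \<subseteq> {b. \<phi> b \<noteq> \<zero>\<^bsub>R\<^esub>}" by auto
      then have "finite {b. \<ominus>\<^bsub>R\<^esub> \<phi> b \<noteq> \<zero>\<^bsub>R\<^esub>}"
        by (rule finite_subset) (use \<phi> in \<open>simp add: free_module_def\<close>)
      then show "\<exists>\<psi>\<in>carrier (free_module R B). \<psi> \<oplus>\<^bsub>free_module R B\<^esub> \<phi> = \<zero>\<^bsub>free_module R B\<^esub>"
        using \<phi> by (intro bexI[of _ "\<lambda>b. \<ominus>\<^bsub>R\<^esub> \<phi> b"]) (auto simp: free_module_def l_neg)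
    qed (auto simp: free_module_def add a_ac)
    fix a \<phi> assume a: "a \<in> carrier R" and \<phi>: "\<phi> \<in> carrier (free_module R B)"
    have "{b. a \<otimes>\<^bsub>R\<^esub> \<phi> b \<noteq> \<zero>\<^bsub>R\<^esub>} \<subseteq> {b. \<phi> b \<noteq> \<zero>\<^bsub>R\<^esub>}" using a by auto
    then have "finite {b. a \<otimes>\<^bsub>R\<^esub> \<phi> b \<noteq> \<zero>\<^bsub>R\<^esub>}"
      by (rule finite_subset) (use \<phi> in \<open>simp add: free_module_def\<close>)
    then show "a \<odot>\<^bsub>free_module R B\<^esub> \<phi> \<in> carrier (free_module R B)" using a \<phi> by (auto simp: free_module_def)
  qed (auto simp: free_module_def l_distr r_distr m_assoc)
qed

definition lin_ext :: "('a, 'm) ring_scheme \<Rightarrow> ('a, 'c) module \<Rightarrow> ('b \<Rightarrow> 'c) \<Rightarrow> ('b \<Rightarrow> 'a) \<Rightarrow> 'c" where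
  "lin_ext R M m \<phi> = (\<Oplus>\<^bsub>M\<^esub>b\<in>{b. \<phi> b \<noteq> \<zero>\<^bsub>R\<^esub>}. \<phi> b \<odot>\<^bsub>M\<^esub> m b)"

lemma lin_ext_superset:
  assumes "module R M" "\<phi> \<in> carrier (free_module R B)" "m \<in> B \<rightarrow> carrier M"
    and A: "finite A" "{b. \<phi> b \<noteq> \<zero>\<^bsub>R\<^esub>} \<subseteq> A" "A \<subseteq> B"
  shows "lin_ext R M m \<phi> = (\<Oplus>\<^bsub>M\<^esub>b\<in>A. \<phi> b \<odot>\<^bsub>M\<^esub> m b)"
proof -
  interpret module R M by fact
  show ?thesis unfolding lin_ext_def
    by (rule M.add.finprod_mono_neutral_cong_left)
      (use assms in \<open>auto simp: free_module_def Pi_def subset_iff\<close>)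
qed

lemma lin_ext_hom:
  assumes "module R M" "m \<in> B \<rightarrow> carrier M"
  shows "lin_ext R M m \<in> mod_hom R (free_module R B) M"
proof -
  interpret module R M by fact
  interpret F: module R "free_module R B" by (rule free_module_module) (rule R.is_cring)
  have supp: "finite {b. \<phi> b \<noteq> \<zero>\<^bsub>R\<^esub>}" "{b. \<phi> b \<noteq> \<zero>\<^bsub>R\<^esub>} \<subseteq> B" "\<phi> b \<in> carrier R"
    if "\<phi> \<in> carrier (free_module R B)" for \<phi> b
    using that by (auto simp: free_module_def)
  have mc: "m b \<in> carrier M" if "b \<in> B" for b using assms that by auto
  note sup = lin_ext_superset[OF assms(1) _ assms(2)]
  have "lin_ext R M m \<phi> \<in> carrier M" if "\<phi> \<in> carrier (free_module R B)" for \<phi>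
    unfolding lin_ext_def using supp[OF that] mc by (intro M.finsum_closed) auto
  moreover have "lin_ext R M m (\<phi> \<oplus>\<^bsub>free_module R B\<^esub> \<psi>) = lin_ext R M m \<phi> \<oplus>\<^bsub>M\<^esub> lin_ext R M m \<psi>"
    if \<phi>: "\<phi> \<in> carrier (free_module R B)" and \<psi>: "\<psi> \<in> carrier (free_module R B)" for \<phi> \<psi>
  proof -
    let ?A = "{b. \<phi> b \<noteq> \<zero>\<^bsub>R\<^esub>} \<union> {b. \<psi> b \<noteq> \<zero>\<^bsub>R\<^esub>}"
    have A: "finite ?A" "?A \<subseteq> B" using supp[OF \<phi>] supp[OF \<psi>] by auto
    have AB: "b \<in> B" if "b \<in> ?A" for b using A that by blast
    have "lin_ext R M m (\<phi> \<oplus>\<^bsub>free_module R B\<^esub> \<psi>) = (\<Oplus>\<^bsub>M\<^esub>b\<in>?A. (\<phi> b \<oplus>\<^bsub>R\<^esub> \<psi> b) \<odot>\<^bsub>M\<^esub> m b)"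
      by (subst sup[OF F.add.m_closed[OF \<phi> \<psi>], of ?A]) (use A in \<open>auto simp: free_module_def\<close>)
    also have "\<dots> = (\<Oplus>\<^bsub>M\<^esub>b\<in>?A. \<phi> b \<odot>\<^bsub>M\<^esub> m b \<oplus>\<^bsub>M\<^esub> \<psi> b \<odot>\<^bsub>M\<^esub> m b)"
      by (rule M.finsum_cong') (use supp[OF \<phi>] supp[OF \<psi>] mc[OF AB] in \<open>auto simp: smult_l_distr\<close>)
    also have "\<dots> = (\<Oplus>\<^bsub>M\<^esub>b\<in>?A. \<phi> b \<odot>\<^bsub>M\<^esub> m b) \<oplus>\<^bsub>M\<^esub> (\<Oplus>\<^bsub>M\<^esub>b\<in>?A. \<psi> b \<odot>\<^bsub>M\<^esub> m b)"
      by (rule M.finsum_addf) (use supp[OF \<phi>] supp[OF \<psi>] mc[OF AB] in auto)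
    also have "\<dots> = lin_ext R M m \<phi> \<oplus>\<^bsub>M\<^esub> lin_ext R M m \<psi>"
      using sup[OF \<phi>, of ?A] sup[OF \<psi>, of ?A] A by simp
    finally show ?thesis .
  qed
  moreover have "lin_ext R M m (a \<odot>\<^bsub>free_module R B\<^esub> \<phi>) = a \<odot>\<^bsub>M\<^esub> lin_ext R M m \<phi>"
    if a: "a \<in> carrier R" and \<phi>: "\<phi> \<in> carrier (free_module R B)" for a \<phi>
  proof -
    let ?A = "{b. \<phi> b \<noteq> \<zero>\<^bsub>R\<^esub>}"
    have A: "finite ?A" "?A \<subseteq> B" using supp[OF \<phi>] by auto
    have AB: "b \<in> B" if "b \<in> ?A" for b using A that by blast
    have "lin_ext R M m (a \<odot>\<^bsub>free_module R B\<^esub> \<phi>) = (\<Oplus>\<^bsub>M\<^esub>b\<in>?A. (a \<otimes>\<^bsub>R\<^esub> \<phi> b) \<odot>\<^bsub>M\<^esub> m b)"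
      by (subst sup[OF F.smult_closed[OF a \<phi>], of ?A]) (use A a in \<open>auto simp: free_module_def\<close>)
    also have "\<dots> = (\<Oplus>\<^bsub>M\<^esub>b\<in>?A. a \<odot>\<^bsub>M\<^esub> (\<phi> b \<odot>\<^bsub>M\<^esub> m b))"
      by (rule M.finsum_cong') (use a supp[OF \<phi>] mc[OF AB] in \<open>auto simp: smult_assoc1\<close>)
    also have "\<dots> = a \<odot>\<^bsub>M\<^esub> lin_ext R M m \<phi>"
      unfolding lin_ext_def using a A supp[OF \<phi>] mc[OF AB]
      by (intro finsum_smult_ldistr[symmetric]) auto
    finally show ?thesis .
  qed
  ultimately show ?thesis by (auto simp: mod_hom_def)
qed

lemma mod_hom_zero:
  assumes "module R M" "module R N" "f \<in> mod_hom R M N"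
  shows "f \<zero>\<^bsub>M\<^esub> = \<zero>\<^bsub>N\<^esub>"
proof -
  interpret M: module R M by fact
  interpret N: module R N by fact
  have "f (\<zero>\<^bsub>R\<^esub> \<odot>\<^bsub>M\<^esub> \<zero>\<^bsub>M\<^esub>) = \<zero>\<^bsub>R\<^esub> \<odot>\<^bsub>N\<^esub> f \<zero>\<^bsub>M\<^esub>" "f \<zero>\<^bsub>M\<^esub> \<in> carrier N"
    using assms(3) M.zero_closed M.R.zero_closed by (simp_all add: mod_hom_def Pi_def del: M.smult_r_null M.smult_l_null)
  then show ?thesis by simp
qed

lemma mod_hom_finsum:
  assumes "module R M" "module R N" "f \<in> mod_hom R M N" "finite A" "x \<in> A \<rightarrow> carrier M"
  shows "f (\<Oplus>\<^bsub>M\<^esub>b\<in>A. x b) = (\<Oplus>\<^bsub>N\<^esub>b\<in>A. f (x b))"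
proof -
  interpret M: module R M by fact
  interpret N: module R N by fact
  have f: "f y \<in> carrier N" if "y \<in> carrier M" for y using that assms(3) by (auto simp: mod_hom_def)
  show ?thesis using assms(4,5)
  proof induction
    case empty then show ?case using mod_hom_zero[OF assms(1-3)] by simp
  next
    case (insert b A)
    have "f (\<Oplus>\<^bsub>M\<^esub>b\<in>insert b A. x b) = f (x b \<oplus>\<^bsub>M\<^esub> (\<Oplus>\<^bsub>M\<^esub>b\<in>A. x b))" using insert by (subst M.finsum_insert) auto
    also have "\<dots> = f (x b) \<oplus>\<^bsub>N\<^esub> f (\<Oplus>\<^bsub>M\<^esub>b\<in>A. x b)"
      using insert assms(3) by (simp add: mod_hom_def Pi_def)
    also have "\<dots> = (\<Oplus>\<^bsub>N\<^esub>b\<in>insert b A. f (x b))" using insert f by (subst N.finsum_insert) auto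
    finally show ?case .
  qed
qed

lemma lin_ext_comp:
  assumes "module R M" "module R N" "g \<in> mod_hom R M N" "m \<in> B \<rightarrow> carrier M"
    "\<phi> \<in> carrier (free_module R B)"
  shows "g (lin_ext R M m \<phi>) = lin_ext R N (\<lambda>b. g (m b)) \<phi>"
proof -
  interpret M: module R M by fact
  interpret N: module R N by fact
  have \<phi>: "finite {b. \<phi> b \<noteq> \<zero>\<^bsub>R\<^esub>}" "\<And>b. \<phi> b \<in> carrier R" "\<And>b. \<phi> b \<noteq> \<zero>\<^bsub>R\<^esub> \<Longrightarrow> m b \<in> carrier M"
    using assms by (auto simp: free_module_def)
  have g: "g y \<in> carrier N" "\<And>a. a \<in> carrier R \<Longrightarrow> g (a \<odot>\<^bsub>M\<^esub> y) = a \<odot>\<^bsub>N\<^esub> g y" if "y \<in> carrier M" for y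
    using that assms(3) by (auto simp: mod_hom_def)
  have "g (lin_ext R M m \<phi>) = (\<Oplus>\<^bsub>N\<^esub>b\<in>{b. \<phi> b \<noteq> \<zero>\<^bsub>R\<^esub>}. g (\<phi> b \<odot>\<^bsub>M\<^esub> m b))"
    unfolding lin_ext_def by (rule mod_hom_finsum[OF assms(1-3)]) (use \<phi> in auto)
  also have "\<dots> = lin_ext R N (\<lambda>b. g (m b)) \<phi>"
    unfolding lin_ext_def by (rule N.finsum_cong') (use \<phi> g in auto)
  finally show ?thesis .
qed

lemma projective_module_section:
  assumes "projective_module R P"
  shows "\<exists>h \<in> mod_hom R P (free_module R (carrier P)). \<forall>x\<in>carrier P. lin_ext R P (\<lambda>b. b) (h x) = x"
proof -
  interpret module R P using assms by (simp add: projective_module_def)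
  let ?F = "free_module R (carrier P)" and ?\<pi> = "lin_ext R P (\<lambda>b. b)"
  have hom: "?\<pi> \<in> mod_hom R ?F P" by (rule lin_ext_hom[OF module_axioms]) auto
  have "?\<pi> ` carrier ?F = carrier P"
  proof
    show "?\<pi> ` carrier ?F \<subseteq> carrier P" using hom by (auto simp: mod_hom_def)
    show "carrier P \<subseteq> ?\<pi> ` carrier ?F"
    proof
      fix x assume x: "x \<in> carrier P"
      let ?\<delta> = "\<lambda>b. if b = x then \<one>\<^bsub>R\<^esub> else \<zero>\<^bsub>R\<^esub>"
      have \<delta>: "?\<delta> \<in> carrier ?F" using x by (auto simp: free_module_def)
      have "?\<pi> ?\<delta> = (\<Oplus>\<^bsub>P\<^esub>b\<in>{x}. ?\<delta> b \<odot>\<^bsub>P\<^esub> b)"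
        by (rule lin_ext_superset[OF module_axioms \<delta>]) (use x in auto)
      also have "\<dots> = x" using x by simp
      finally show "x \<in> ?\<pi> ` carrier ?F" using \<delta> by force
    qed
  qed
  moreover have "(\<lambda>x. x) \<in> mod_hom R P P" by (auto simp: mod_hom_def)
  ultimately show ?thesis
    using assms hom free_module_module[OF R.is_cring, of "carrier P"] module_axioms
    unfolding projective_module_def by blast
qed

lemma projective_module_lift:
  fixes M :: "('a, 'c) module" and N :: "('a, 'd) module"
  assumes "projective_module R P" "module R M" "module R N"
    and g: "g \<in> mod_hom R M N" "g ` carrier M = carrier N" and f: "f \<in> mod_hom R P N"
  shows "\<exists>h \<in> mod_hom R P M. \<forall>x\<in>carrier P. g (h x) = f x"
proof -
  interpret P: module R P using assms by (simp add: projective_module_def)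
  interpret M: module R M by fact
  interpret N: module R N by fact
  let ?F = "free_module R (carrier P)"
  obtain h where h: "h \<in> mod_hom R P ?F" "\<And>x. x \<in> carrier P \<Longrightarrow> lin_ext R P (\<lambda>b. b) (h x) = x"
    using projective_module_section[OF assms(1)] by blast
  have "\<forall>b\<in>carrier P. \<exists>y\<in>carrier M. g y = f b"
  proof
    fix b assume "b \<in> carrier P"
    then have "f b \<in> g ` carrier M" using g(2) f by (auto simp: mod_hom_def)
    then show "\<exists>y\<in>carrier M. g y = f b" by auto
  qed
  then obtain m where m: "\<And>b. b \<in> carrier P \<Longrightarrow> m b \<in> carrier M" "\<And>b. b \<in> carrier P \<Longrightarrow> g (m b) = f b"
    by metis
  have k: "lin_ext R M m \<in> mod_hom R ?F M" using m by (intro lin_ext_hom[OF assms(2)]) auto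
  have "g (lin_ext R M m (h x)) = f x" if x: "x \<in> carrier P" for x
  proof -
    have hx: "h x \<in> carrier ?F" using h x by (auto simp: mod_hom_def)
    have "g (lin_ext R M m (h x)) = lin_ext R N (\<lambda>b. g (m b)) (h x)"
      using m by (intro lin_ext_comp[OF assms(2,3) g(1) _ hx]) auto
    also have "\<dots> = lin_ext R N (\<lambda>b. f b) (h x)"
    proof -
      have "b \<in> carrier P" if "h x b \<noteq> \<zero>\<^bsub>R\<^esub>" for b
        using hx that by (auto simp: free_module_def)
      moreover have "h x b \<in> carrier R" for b using hx by (simp add: free_module_def)
      moreover have "f b \<in> carrier N" if "b \<in> carrier P" for b using f that by (auto simp: mod_hom_def)
      ultimately show ?thesis
        unfolding lin_ext_def by (intro N.finsum_cong') (simp_all add: m(2) Pi_def)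
    qed
    also have "\<dots> = f (lin_ext R P (\<lambda>b. b) (h x))"
      by (rule lin_ext_comp[symmetric, OF P.module_axioms assms(3) f _ hx]) auto
    finally show ?thesis using h x by simp
  qed
  moreover have "(\<lambda>x. lin_ext R M m (h x)) \<in> mod_hom R P M"
    using h(1) k by (simp add: mod_hom_def Pi_def)
  ultimately show ?thesis by (intro bexI[of _ "\<lambda>x. lin_ext R M m (h x)"] ballI)
qed

end

theory Submission
  imports Defs
begin

text \<open>Let \<open>G\<close> be a resolution of \<open>(R/I)\<^sup>g\<close> by free modules of finite rank with \<open>G\<^sub>0 = R\<^sup>g\<close>, where \<open>P\<^sub>0\<close>
  has \<open>g\<close> generators, and let \<open>m\<close> be the projective dimension of \<open>R/I\<close>. Then the differential
  \<open>D\<^sub>m : G\<^sub>m\<^sub>+\<^sub>1 \<rightarrow> G\<^sub>m\<close> splits, \<open>D\<^sub>m h D\<^sub>m = D\<^sub>m\<close>, and each generator of \<open>I\<close> acts null-homotopically on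
  \<open>G\<close>. These are identities between matrices, so they survive the Frobenius map: the pullback \<open>G\<^sup>(\<^sup>q\<^sup>)\<close>,
  truncated by a complement of the image of \<open>D\<^sub>m\<close> in degree \<open>m\<close>, is a complex of projective modules of
  length \<open>m\<close> whose homologies are annihilated by the \<open>q\<close>-th powers of the generators. Its exactness
  (Peskine and Szpiro) is not needed. The Artin-Rees lemma for \<open>G\<close> provides chain maps from
  \<open>G\<^sup>(\<^sup>q\<^sup>)\<close> to \<open>G\<close> that are the identity in degree 0 and divisible by high powers of the generators in
  positive degrees. Precomposing with their Frobenius pullbacks kills the obstructions in the homology
  of \<open>P\<close> to extending \<open>R\<^sup>g \<rightarrow> P\<^sub>0\<close> to a chain map from \<open>G\<^sup>(\<^sup>q\<^sup>)\<close> to \<open>P\<close>.\<close>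

section \<open>Homomorphisms and submodules\<close>

text \<open>The only map into \<open>P\<close> given in advance is
  \<open>R^g \<rightarrow> P_0\<close>. Extending it by one degree asks cycles of \<open>P\<close>
  to be boundaries; homology supported in V(I) promises this only after multiplication by
  \<open>t^N\<close>, with \<open>N\<close> depending on \<open>P\<close>. Koszul complexes on
  powers of the generators would absorb such an \<open>N\<close>, but their length is the number of
  generators; Frobenius powers of a resolution absorb it while keeping the length
  \<open>pd(R/I)\<close>. Frobenius acts on matrices, so the resolution has to consist of free
  modules with chosen bases, and such a resolution may be infinite. The given finite resolution, by
  projective modules of any size, enters only through the splitting of \<open>D_m\<close>. The
  exponent \<open>q\<close> cannot be fixed at the start: each extension by one degree may raise it,
  while \<open>R^g\<close> in degree 0 stays untouched so that the map remains onto. The condition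
  \<open>k > m\<close> is \<open>m \<le> k - 1\<close>, the length allowed for a reducer.\<close>

lemma mod_homI:
  assumes "\<And>x. x \<in> carrier M \<Longrightarrow> f x \<in> carrier N"
    and "\<And>x y. x \<in> carrier M \<Longrightarrow> y \<in> carrier M \<Longrightarrow> f (x \<oplus>\<^bsub>M\<^esub> y) = f x \<oplus>\<^bsub>N\<^esub> f y"
    and "\<And>a x. a \<in> carrier R \<Longrightarrow> x \<in> carrier M \<Longrightarrow> f (a \<odot>\<^bsub>M\<^esub> x) = a \<odot>\<^bsub>N\<^esub> f x"
  shows "f \<in> mod_hom R M N"
  using assms by (auto simp: mod_hom_def)

lemma mod_homD:
  assumes "f \<in> mod_hom R M N"
  shows "x \<in> carrier M \<Longrightarrow> f x \<in> carrier N"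
    and "x \<in> carrier M \<Longrightarrow> y \<in> carrier M \<Longrightarrow> f (x \<oplus>\<^bsub>M\<^esub> y) = f x \<oplus>\<^bsub>N\<^esub> f y"
    and "a \<in> carrier R \<Longrightarrow> x \<in> carrier M \<Longrightarrow> f (a \<odot>\<^bsub>M\<^esub> x) = a \<odot>\<^bsub>N\<^esub> f x"
  using assms by (auto simp: mod_hom_def)

lemma mod_hom_comp:
  assumes "f \<in> mod_hom R M N" "g \<in> mod_hom R N K"
  shows "(\<lambda>x. g (f x)) \<in> mod_hom R M K"
  using assms by (auto simp: mod_hom_def Pi_def)

lemma mod_hom_minus:
  assumes "module R M" "module R N" "f \<in> mod_hom R M N" "x \<in> carrier M" "y \<in> carrier M"
  shows "f (x \<ominus>\<^bsub>M\<^esub> y) = f x \<ominus>\<^bsub>N\<^esub> f y"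
proof -
  interpret M: module R M by fact
  interpret N: module R N by fact
  have "f ((\<ominus>\<^bsub>R\<^esub> \<one>\<^bsub>R\<^esub>) \<odot>\<^bsub>M\<^esub> y) = (\<ominus>\<^bsub>R\<^esub> \<one>\<^bsub>R\<^esub>) \<odot>\<^bsub>N\<^esub> f y"
    by (rule mod_homD[OF assms(3)]) (use assms in auto)
  then have "f (\<ominus>\<^bsub>M\<^esub> y) = \<ominus>\<^bsub>N\<^esub> f y"
    using assms mod_homD[OF assms(3)] by (simp add: M.smult_l_minus N.smult_l_minus)
  then show ?thesis
    using assms mod_homD[OF assms(3)] by (simp add: M.minus_eq N.minus_eq)
qed

lemma mod_hom_add:
  assumes "module R N" "f \<in> mod_hom R M N" "g \<in> mod_hom R M N"
  shows "(\<lambda>x. f x \<oplus>\<^bsub>N\<^esub> g x) \<in> mod_hom R M N"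
proof -
  interpret N: module R N by fact
  show ?thesis
    by (rule mod_homI) (use assms in \<open>auto simp: mod_homD N.smult_r_distr N.M.add.m_ac\<close>)
qed

lemma mod_hom_smult:
  assumes "module R N" "f \<in> mod_hom R M N" "a \<in> carrier R"
  shows "(\<lambda>x. a \<odot>\<^bsub>N\<^esub> f x) \<in> mod_hom R M N"
proof -
  interpret N: module R N by fact
  show ?thesis
  proof (rule mod_homI)
    fix b x assume b: "b \<in> carrier R" and x: "x \<in> carrier M"
    note fx = mod_homD(1)[OF assms(2) x]
    show "a \<odot>\<^bsub>N\<^esub> f (b \<odot>\<^bsub>M\<^esub> x) = b \<odot>\<^bsub>N\<^esub> (a \<odot>\<^bsub>N\<^esub> f x)"
      using N.smult_assoc1[of a b "f x"] N.smult_assoc1[of b a "f x"] N.R.m_comm[of a b] assms(3) b fx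
      by (simp add: mod_homD(3)[OF assms(2) b x])
  qed (use assms(3) mod_homD[OF assms(2)] in \<open>simp_all add: N.smult_r_distr\<close>)
qed

lemma mod_hom_diff:
  assumes M: "module R M" and "module R N" "f \<in> mod_hom R M N" "g \<in> mod_hom R M N"
  shows "(\<lambda>x. f x \<ominus>\<^bsub>N\<^esub> g x) \<in> mod_hom R M N"
proof -
  interpret M: module R M by fact
  interpret N: module R N by fact
  \<comment> \<open>Subtraction as addition of a multiple by -1 reduces the claim to sums and scalar
    multiples of homomorphisms.\<close>
  have sub: "f x \<ominus>\<^bsub>N\<^esub> g x = f x \<oplus>\<^bsub>N\<^esub> (\<ominus>\<^bsub>R\<^esub> \<one>\<^bsub>R\<^esub>) \<odot>\<^bsub>N\<^esub> g x" if "x \<in> carrier M" for x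
    using mod_homD(1)[OF assms(4) that] by (simp add: N.M.minus_eq N.smult_l_minus)
  have "(\<lambda>x. f x \<oplus>\<^bsub>N\<^esub> (\<ominus>\<^bsub>R\<^esub> \<one>\<^bsub>R\<^esub>) \<odot>\<^bsub>N\<^esub> g x) \<in> mod_hom R M N" (is "?h \<in> _")
    by (intro mod_hom_add mod_hom_smult assms) auto
  note h = mod_homD[OF this]
  show ?thesis
  proof (rule mod_homI)
    fix x y assume "x \<in> carrier M" "y \<in> carrier M"
    then show "f (x \<oplus>\<^bsub>M\<^esub> y) \<ominus>\<^bsub>N\<^esub> g (x \<oplus>\<^bsub>M\<^esub> y) = (f x \<ominus>\<^bsub>N\<^esub> g x) \<oplus>\<^bsub>N\<^esub> (f y \<ominus>\<^bsub>N\<^esub> g y)"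
      using h(2)[of x y] by (simp only: sub M.a_closed)
  next
    fix x assume "x \<in> carrier M"
    then show "f x \<ominus>\<^bsub>N\<^esub> g x \<in> carrier N" using h(1)[of x] by (simp only: sub)
    fix a assume "a \<in> carrier R"
    then show "f (a \<odot>\<^bsub>M\<^esub> x) \<ominus>\<^bsub>N\<^esub> g (a \<odot>\<^bsub>M\<^esub> x) = a \<odot>\<^bsub>N\<^esub> (f x \<ominus>\<^bsub>N\<^esub> g x)"
      using h(3)[of a x] \<open>x \<in> _\<close> by (simp only: sub M.smult_closed)
  qed
qed

text \<open>Negation is scaling by \<open>\<ominus> \<one>\<close>, so closure under it comes for
  free.\<close>

lemma (in module) submoduleI':
  assumes "H \<subseteq> carrier M" "\<zero>\<^bsub>M\<^esub> \<in> H"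
    and "\<And>x y. x \<in> H \<Longrightarrow> y \<in> H \<Longrightarrow> x \<oplus>\<^bsub>M\<^esub> y \<in> H"
    and "\<And>a x. a \<in> carrier R \<Longrightarrow> x \<in> H \<Longrightarrow> a \<odot>\<^bsub>M\<^esub> x \<in> H"
  shows "submodule H R M"
proof (rule submoduleI)
  fix x assume x: "x \<in> H"
  then have "(\<ominus> \<one>) \<odot>\<^bsub>M\<^esub> x \<in> H" by (intro assms) auto
  then show "\<ominus>\<^bsub>M\<^esub> x \<in> H" using x assms(1) by (auto simp: smult_l_minus)
qed (use assms in auto)

lemma submoduleD:
  assumes "submodule H R M"
  shows "x \<in> H \<Longrightarrow> x \<in> carrier M" "\<zero>\<^bsub>M\<^esub> \<in> H"
    and "x \<in> H \<Longrightarrow> y \<in> H \<Longrightarrow> x \<oplus>\<^bsub>M\<^esub> y \<in> H"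
    and "x \<in> H \<Longrightarrow> y \<in> H \<Longrightarrow> x \<ominus>\<^bsub>M\<^esub> y \<in> H"
    and "a \<in> carrier R \<Longrightarrow> x \<in> H \<Longrightarrow> a \<odot>\<^bsub>M\<^esub> x \<in> H"
proof -
  interpret submodule H R M by fact
  show "x \<in> H \<Longrightarrow> x \<in> carrier M" using subset by auto
  show "\<zero>\<^bsub>M\<^esub> \<in> H" using one_closed by simp
  show p: "x \<in> H \<Longrightarrow> y \<in> H \<Longrightarrow> x \<oplus>\<^bsub>M\<^esub> y \<in> H" for y using m_closed by simp
  have "y \<in> H \<Longrightarrow> \<ominus>\<^bsub>M\<^esub> y \<in> H" using m_inv_closed by (simp add: a_inv_def)
  then show "x \<in> H \<Longrightarrow> y \<in> H \<Longrightarrow> x \<ominus>\<^bsub>M\<^esub> y \<in> H" using p by (simp add: a_minus_def)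
  show "a \<in> carrier R \<Longrightarrow> x \<in> H \<Longrightarrow> a \<odot>\<^bsub>M\<^esub> x \<in> H" by simp
qed

lemma preimage_submodule:
  assumes "module R M" "module R N" "f \<in> mod_hom R M N" "submodule K R N"
  shows "submodule {x \<in> carrier M. f x \<in> K} R M"
proof -
  interpret M: module R M by fact
  show ?thesis
    by (rule M.submoduleI') (use assms in \<open>auto simp: mod_homD submoduleD mod_hom_zero\<close>)
qed

lemma image_submodule:
  assumes "module R M" "module R N" "f \<in> mod_hom R M N" "submodule H R M"
  shows "submodule (f ` H) R N"
proof -
  interpret N: module R N by fact
  note h = submoduleD[OF assms(4)] mod_homD[OF assms(3)]
  show ?thesis
  proof (rule N.submoduleI')
    show "f ` H \<subseteq> carrier N" using h by auto
    show "\<zero>\<^bsub>N\<^esub> \<in> f ` H" using h(2) mod_hom_zero[OF assms(1-3)] by (metis imageI)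
    fix x y assume "x \<in> f ` H" "y \<in> f ` H"
    then obtain x' y' where "x' \<in> H" "y' \<in> H" "x = f x'" "y = f y'" by auto
    then show "x \<oplus>\<^bsub>N\<^esub> y \<in> f ` H" using h by (intro image_eqI[of _ _ "x' \<oplus>\<^bsub>M\<^esub> y'"]) auto
  next
    fix a x assume a: "a \<in> carrier R" "x \<in> f ` H"
    then obtain x' where "x' \<in> H" "x = f x'" by auto
    then show "a \<odot>\<^bsub>N\<^esub> x \<in> f ` H" using h a by (intro image_eqI[of _ _ "a \<odot>\<^bsub>M\<^esub> x'"]) auto
  qed
qed

lemma inter_submodule:
  assumes "module R M" "submodule H R M" "submodule K R M"
  shows "submodule (H \<inter> K) R M"
proof -
  interpret M: module R M by fact
  show ?thesis
    by (rule M.submoduleI') (use assms in \<open>auto simp: submoduleD\<close>)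
qed

lemma zero_submodule:
  assumes "module R M" shows "submodule {\<zero>\<^bsub>M\<^esub>} R M"
proof -
  interpret M: module R M by fact
  show ?thesis by (rule M.submoduleI') auto
qed

lemma equalizer_submodule:
  assumes "module R M" "module R N" "f \<in> mod_hom R M N" "g \<in> mod_hom R M N"
  shows "submodule {x \<in> carrier M. f x = g x} R M"
proof -
  interpret M: module R M by fact
  show ?thesis
    by (rule M.submoduleI') (use assms in \<open>auto simp: mod_homD mod_hom_zero[of R M N]\<close>)
qed

lemma fin_gen_image:
  assumes "fin_gen_module R M" "module R N" "f \<in> mod_hom R M N" "f ` carrier M = carrier N"
  shows "fin_gen_module R N"
proof -
  obtain A where A: "module R M" "finite A" "A \<subseteq> carrier M"
    "\<And>K. submodule K R M \<Longrightarrow> A \<subseteq> K \<Longrightarrow> K = carrier M"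
    using assms(1) by (auto simp: fin_gen_module_def)
  have "K = carrier N" if K: "submodule K R N" "f ` A \<subseteq> K" for K
  proof
    have "A \<subseteq> {x \<in> carrier M. f x \<in> K}" using A(3) K(2) by blast
    from A(4)[OF preimage_submodule[OF A(1) assms(2,3) K(1)] this] show "carrier N \<subseteq> K"
      unfolding assms(4)[symmetric] by blast
  qed (use submoduleD(1)[OF K(1)] in blast)
  then show ?thesis
    unfolding fin_gen_module_def using A(2,3) assms(2) mod_homD(1)[OF assms(3)]
    by (intro conjI exI[of _ "f ` A"]) auto
qed

text \<open>Intended for \<open>A \<subseteq> carrier M\<close>: otherwise no submodule contains
  \<open>A\<close> and the intersection is the whole type. Describing the span by minimality keeps
  linear combinations out of the later arguments.\<close>

definition mspan :: "('a, 'm) ring_scheme \<Rightarrow> ('a, 'b) module \<Rightarrow> 'b set \<Rightarrow> 'b set" where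
  "mspan R M A = \<Inter>{N. submodule N R M \<and> A \<subseteq> N}"

lemma mspan_submodule:
  assumes "module R M" "A \<subseteq> carrier M"
  shows "submodule (mspan R M A) R M"
proof -
  interpret M: module R M by fact
  show ?thesis
  proof (rule M.submoduleI')
    show "mspan R M A \<subseteq> carrier M"
      using M.carrier_is_submodule assms by (auto simp: mspan_def)
  qed (auto simp: mspan_def submoduleD)
qed

lemma mspan_incl: "A \<subseteq> mspan R M A"
  by (auto simp: mspan_def)

lemma mspan_least: "submodule N R M \<Longrightarrow> A \<subseteq> N \<Longrightarrow> mspan R M A \<subseteq> N"
  by (auto simp: mspan_def)

lemma mspan_image:
  assumes "module R M" "module R N" "f \<in> mod_hom R M N" "A \<subseteq> carrier M"
  shows "f ` mspan R M A = mspan R N (f ` A)"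
proof
  have fA: "f ` A \<subseteq> carrier N" using assms mod_homD(1)[OF assms(3)] by auto
  have "mspan R M A \<subseteq> {x \<in> carrier M. f x \<in> mspan R N (f ` A)}"
    by (rule mspan_least[OF preimage_submodule[OF assms(1-3) mspan_submodule[OF assms(2) fA]]])
      (use assms mspan_incl[of "f ` A" R N] in auto)
  then show "f ` mspan R M A \<subseteq> mspan R N (f ` A)" by auto
  show "mspan R N (f ` A) \<subseteq> f ` mspan R M A"
    by (rule mspan_least[OF image_submodule[OF assms(1-3) mspan_submodule[OF assms(1,4)]]])
      (use mspan_incl[of A R M] in auto)
qed

section \<open>Projective modules\<close>

lemma submodule_module:
  assumes "module R M" "submodule H R M"
  shows "module R (M\<lparr>carrier := H\<rparr>)"
  using submodule.submodule_is_module[OF assms(2,1)] .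

text \<open>Differentials are rarely onto, but shrinking the target to the image of \<open>g\<close>
  makes lifting applicable. The later constructions of chain maps and homotopies reduce to checking
  that an obstruction lies in such an image.\<close>

lemma projective_module_lift_into:
  assumes P: "projective_module R P" and "module R M" "module R N" "g \<in> mod_hom R M N"
    and f: "f \<in> mod_hom R P N" and im: "\<And>x. x \<in> carrier P \<Longrightarrow> f x \<in> g ` carrier M"
  shows "\<exists>h \<in> mod_hom R P M. \<forall>x\<in>carrier P. g (h x) = f x"
proof -
  interpret M: module R M by fact
  let ?N = "N\<lparr>carrier := g ` carrier M\<rparr>"
  have "submodule (g ` carrier M) R N"
    by (rule image_submodule[OF assms(2-4) M.carrier_is_submodule])
  then have N: "module R ?N" by (rule submodule_module[OF assms(3)])
  have g: "g \<in> mod_hom R M ?N"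
    by (rule mod_homI) (use mod_homD[OF assms(4)] in auto)
  have f': "f \<in> mod_hom R P ?N"
    by (rule mod_homI) (use mod_homD[OF f] im in auto)
  show ?thesis
    by (rule projective_module_lift[OF P assms(2) N g _ f']) simp
qed

text \<open>Lift the composite of \<open>f\<close> with \<open>r\<close> along \<open>F\<close>,
  then restrict by \<open>i\<close>. The modules \<open>F\<close> and \<open>P\<close> may live in
  different types, which \<open>projective_module_lift\<close> absorbs.\<close>

lemma projective_module_retract:
  assumes F: "projective_module R F" and P: "module R P"
    and i: "i \<in> mod_hom R P F" and r: "r \<in> mod_hom R F P"
    and ri: "\<And>x. x \<in> carrier P \<Longrightarrow> r (i x) = x"
  shows "projective_module R P"
  unfolding projective_module_def
proof (intro conjI allI impI; (elim conjE)?)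
  fix M :: "('a, 'd \<Rightarrow> 'a) module" and N :: "('a, 'd) module" and g f
  assume a: "module R M" "module R N" "g \<in> mod_hom R M N" "g ` carrier M = carrier N"
    "f \<in> mod_hom R P N"
  obtain h where h: "h \<in> mod_hom R F M" "\<And>x. x \<in> carrier F \<Longrightarrow> g (h x) = f (r x)"
    using projective_module_lift[OF F a(1-4) mod_hom_comp[OF r a(5)]] by blast
  show "\<exists>h\<in>mod_hom R P M. \<forall>x\<in>carrier P. g (h x) = f x"
    by (rule bexI[OF _ mod_hom_comp[OF i h(1)]]) (use h mod_homD(1)[OF i] ri in auto)
qed fact

section \<open>Free modules of finite rank\<close>

text \<open>All ranks share the type \<open>nat \<Rightarrow> 'a\<close>, so complexes with varying
  ranks fit the record \<open>cplx\<close>, and \<open>FM R n\<close> is literally contained in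
  \<open>FM R (Suc n)\<close>, which the induction over the rank exploits.\<close>

abbreviation FM :: "('a, 'm) ring_scheme \<Rightarrow> nat \<Rightarrow> ('a, nat \<Rightarrow> 'a) module" where
  "FM R n \<equiv> free_module R {..<n}"

definition unit_vec :: "('a, 'm) ring_scheme \<Rightarrow> 'b \<Rightarrow> 'b \<Rightarrow> 'a" where
  "unit_vec R b = (\<lambda>i. if i = b then \<one>\<^bsub>R\<^esub> else \<zero>\<^bsub>R\<^esub>)"

lemma free_module_simps [simp]:
  "\<zero>\<^bsub>free_module R B\<^esub> = (\<lambda>_. \<zero>\<^bsub>R\<^esub>)"
  "v \<oplus>\<^bsub>free_module R B\<^esub> w = (\<lambda>i. v i \<oplus>\<^bsub>R\<^esub> w i)"
  "a \<odot>\<^bsub>free_module R B\<^esub> v = (\<lambda>i. a \<otimes>\<^bsub>R\<^esub> v i)"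
  by (auto simp: free_module_def)

lemma FM_carrier_iff:
  "v \<in> carrier (FM R n) \<longleftrightarrow> (\<forall>i. v i \<in> carrier R) \<and> (\<forall>i\<ge>n. v i = \<zero>\<^bsub>R\<^esub>)"
proof -
  have "finite {i. v i \<noteq> \<zero>\<^bsub>R\<^esub>}" if "\<forall>i\<ge>n. v i = \<zero>\<^bsub>R\<^esub>"
    by (rule finite_subset[of _ "{..<n}"]) (use that in \<open>auto simp: not_le[symmetric]\<close>)
  then show ?thesis by (auto simp: free_module_def)
qed

context cring
begin

lemma FM_module: "module R (FM R n)"
  by (rule free_module_module) (rule is_cring)

lemma free_module_diff:
  assumes "v \<in> carrier (free_module R B)" "w \<in> carrier (free_module R B)"
  shows "v \<ominus>\<^bsub>free_module R B\<^esub> w = (\<lambda>i. v i \<ominus> w i)"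
proof -
  interpret F: module R "free_module R B" by (rule free_module_module) (rule is_cring)
  have c: "v i \<in> carrier R" "w i \<in> carrier R" for i using assms by (auto simp: free_module_def)
  have "\<ominus>\<^bsub>free_module R B\<^esub> w = (\<ominus> \<one>) \<odot>\<^bsub>free_module R B\<^esub> w"
    using assms by (simp add: F.smult_l_minus del: free_module_simps)
  then show ?thesis using c by (simp add: a_minus_def fun_eq_iff l_minus)
qed

lemma unit_vec_carrier: "b \<in> B \<Longrightarrow> unit_vec R b \<in> carrier (free_module R B)"
  by (auto simp: unit_vec_def free_module_def)

lemma lin_ext_unit_vec:
  assumes "module R M" "m \<in> B \<rightarrow> carrier M" "b \<in> B"
  shows "lin_ext R M m (unit_vec R b) = m b"
proof -
  interpret M: module R M by fact
  have mb: "m b \<in> carrier M" using assms by auto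
  have "lin_ext R M m (unit_vec R b) = (\<Oplus>\<^bsub>M\<^esub>c\<in>{b}. unit_vec R b c \<odot>\<^bsub>M\<^esub> m c)"
    by (rule lin_ext_superset[OF assms(1) unit_vec_carrier[OF assms(3)]])
      (use assms in \<open>auto simp: unit_vec_def\<close>)
  then show ?thesis using mb by (simp add: unit_vec_def)
qed

lemma FM_mem_submodule:
  assumes K: "submodule K R (FM R n)" and v: "v \<in> carrier (FM R n)"
    and vK: "\<And>b. b < n \<Longrightarrow> v b \<odot>\<^bsub>FM R n\<^esub> unit_vec R b \<in> K"
  shows "v \<in> K"
proof -
  \<comment> \<open>The coordinates are switched on one at a time, so that the truncations of
    \<open>v\<close> stay inside \<open>K\<close> and no finite sum in the module is formed.\<close>
  have "(\<lambda>i. if i < k then v i else \<zero>) \<in> K" if "k \<le> n" for k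
    using that
  proof (induction k)
    case 0 then show ?case using submoduleD(2)[OF K] by simp
  next
    case (Suc k)
    have "(\<lambda>i. if i < k then v i else \<zero>) \<oplus>\<^bsub>FM R n\<^esub> v k \<odot>\<^bsub>FM R n\<^esub> unit_vec R k \<in> K"
      using Suc by (intro submoduleD(3)[OF K] vK) auto
    also have "(\<lambda>i. if i < k then v i else \<zero>) \<oplus>\<^bsub>FM R n\<^esub> v k \<odot>\<^bsub>FM R n\<^esub> unit_vec R k
        = (\<lambda>i. if i < Suc k then v i else \<zero>)"
      using v by (auto simp: unit_vec_def FM_carrier_iff fun_eq_iff less_Suc_eq)
    finally show ?case .
  qed
  from this[OF order_refl] show ?thesis
    by (rule back_subst[of "\<lambda>w. w \<in> K"]) (use v in \<open>auto simp: FM_carrier_iff fun_eq_iff\<close>)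
qed

lemma FM_unit_vec_generate:
  assumes H: "submodule H R (FM R n)" and u: "\<And>b. b < n \<Longrightarrow> unit_vec R b \<in> H"
  shows "H = carrier (FM R n)"
proof
  show "H \<subseteq> carrier (FM R n)" using submoduleD(1)[OF H] by auto
  show "carrier (FM R n) \<subseteq> H"
  proof
    fix v assume v: "v \<in> carrier (FM R n)"
    show "v \<in> H"
      by (rule FM_mem_submodule[OF H v submoduleD(5)[OF H _ u]]) (use v in \<open>simp_all add: FM_carrier_iff\<close>)
  qed
qed

lemma FM_subset_submodule:
  assumes "module R M" "f \<in> mod_hom R (FM R n) M" "submodule K R M"
    and "\<And>b. b < n \<Longrightarrow> f (unit_vec R b) \<in> K" and v: "v \<in> carrier (FM R n)"
  shows "f v \<in> K"
proof -
  have "{v \<in> carrier (FM R n). f v \<in> K} = carrier (FM R n)"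
    by (rule FM_unit_vec_generate[OF preimage_submodule[OF FM_module assms(1,2,3)]])
      (use assms(4) in \<open>auto intro: unit_vec_carrier\<close>)
  then show ?thesis using v by blast
qed

lemma FM_hom_eqI:
  assumes "module R M" "f \<in> mod_hom R (FM R n) M" "g \<in> mod_hom R (FM R n) M"
    and "\<And>b. b < n \<Longrightarrow> f (unit_vec R b) = g (unit_vec R b)" and v: "v \<in> carrier (FM R n)"
  shows "f v = g v"
proof -
  have "{v \<in> carrier (FM R n). f v = g v} = carrier (FM R n)"
    by (rule FM_unit_vec_generate[OF equalizer_submodule[OF FM_module assms(1,2,3)]])
      (use assms(4) in \<open>auto intro: unit_vec_carrier\<close>)
  then show ?thesis using v by blast
qed

lemma FM_fin_gen: "fin_gen_module R (FM R n)"
  unfolding fin_gen_module_def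
proof (intro conjI FM_module exI[of _ "unit_vec R ` {..<n}"] allI impI)
  show "unit_vec R ` {..<n} \<subseteq> carrier (FM R n)"
    by (intro image_subsetI unit_vec_carrier)
  fix N assume "submodule N R (FM R n) \<and> unit_vec R ` {..<n} \<subseteq> N"
  then show "N = carrier (FM R n)" by (intro FM_unit_vec_generate) auto
qed simp

lemma FM_projective: "projective_module R (FM R n)"
  unfolding projective_module_def
proof (intro conjI allI impI; (elim conjE)?)
  show "module R (FM R n)" by (rule FM_module)
  fix M :: "('a, (nat \<Rightarrow> 'a) \<Rightarrow> 'a) module" and N :: "('a, nat \<Rightarrow> 'a) module" and g f
  assume M: "module R M" and N: "module R N" and g: "g \<in> mod_hom R M N" "g ` carrier M = carrier N"
    and f: "f \<in> mod_hom R (FM R n) N"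
  have "\<exists>y\<in>carrier M. g y = f (unit_vec R b)" if "b < n" for b
    using g(2) mod_homD(1)[OF f, of "unit_vec R b"] unit_vec_carrier[of b "{..<n}"] that by force
  then obtain m where m: "\<And>b. b < n \<Longrightarrow> m b \<in> carrier M" "\<And>b. b < n \<Longrightarrow> g (m b) = f (unit_vec R b)"
    by metis
  have hom: "lin_ext R M m \<in> mod_hom R (FM R n) M" by (rule lin_ext_hom[OF M]) (use m in auto)
  have "g (lin_ext R M m x) = f x" if "x \<in> carrier (FM R n)" for x
    by (rule FM_hom_eqI[OF N mod_hom_comp[OF hom g(1)] f _ that])
      (use m in \<open>auto simp: lin_ext_unit_vec[OF M, of m "{..<n}"]\<close>)
  then show "\<exists>h\<in>mod_hom R (FM R n) M. \<forall>x\<in>carrier (FM R n). g (h x) = f x" using hom by blast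
qed

end

section \<open>Noetherian rings\<close>

context cring
begin

lemma regular_module_simps [simp]:
  "carrier (regular_module R) = carrier R" "\<zero>\<^bsub>regular_module R\<^esub> = \<zero>"
  "x \<oplus>\<^bsub>regular_module R\<^esub> y = x \<oplus> y" "a \<odot>\<^bsub>regular_module R\<^esub> x = a \<otimes> x"
  by (auto simp: regular_module_def)

lemma regular_module_module: "module R (regular_module R)"
proof (rule moduleI[OF is_cring abelian_groupI])
  fix x assume "x \<in> carrier (regular_module R)"
  then show "\<exists>y\<in>carrier (regular_module R). y \<oplus>\<^bsub>regular_module R\<^esub> x = \<zero>\<^bsub>regular_module R\<^esub>"
    by (intro bexI[of _ "\<ominus> x"]) (auto simp: l_neg)
qed (auto simp: a_ac m_ac l_distr r_distr)

text \<open>Noetherian rings and \<open>genideal\<close> speak about ideals; through this bridge,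
  images and preimages under homomorphisms become ideals without separate verification.\<close>

lemma submodule_regular_iff: "submodule J R (regular_module R) \<longleftrightarrow> ideal J R"
proof
  assume J: "submodule J R (regular_module R)"
  note J' = submoduleD[OF J, simplified]
  interpret Reg: module R "regular_module R" by (rule regular_module_module)
  have minv: "\<ominus> x \<in> J" if "x \<in> J" for x
    using J'(5)[of "\<ominus> \<one>" x] J'(1)[OF that] that by (simp add: l_minus)
  show "ideal J R"
  proof (rule idealI[OF ring_axioms])
    show "subgroup J (add_monoid R)"
      by (rule add.subgroupI) (use J' minv in \<open>auto simp: a_inv_def[symmetric]\<close>)
    fix a x assume a: "a \<in> J" and x: "x \<in> carrier R"
    show "x \<otimes> a \<in> J" by (rule J'(5)[OF x a])
    then show "a \<otimes> x \<in> J" using m_comm[OF J'(1)[OF a] x] by simp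
  qed
next
  assume "ideal J R"
  then interpret J: ideal J R .
  interpret Reg: module R "regular_module R" by (rule regular_module_module)
  show "submodule J R (regular_module R)"
    by (rule Reg.submoduleI') (auto simp: J.a_subset J.I_l_closed)
qed

lemma coordinate_hom: "(\<lambda>v. v i) \<in> mod_hom R (FM R n) (regular_module R)"
  by (rule mod_homI) (auto simp: FM_carrier_iff)

lemma FM_hyperplane_submodule:
  assumes K: "submodule K R (FM R (Suc n))"
  shows "submodule {v \<in> K. v n = \<zero>} R (FM R n)"
proof -
  interpret F: module R "FM R n" by (rule FM_module)
  note K = submoduleD[OF K]
  show ?thesis
  proof (rule F.submoduleI')
    show "{v \<in> K. v n = \<zero>} \<subseteq> carrier (FM R n)"
    proof
      fix v assume v: "v \<in> {v \<in> K. v n = \<zero>}"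
      then have "v \<in> carrier (FM R (Suc n))" using K(1) by blast
      then show "v \<in> carrier (FM R n)"
        using v unfolding FM_carrier_iff Suc_le_eq by (auto simp: le_less)
    qed
  next
    fix v w assume "v \<in> {v \<in> K. v n = \<zero>}" "w \<in> {v \<in> K. v n = \<zero>}"
    then show "v \<oplus>\<^bsub>FM R n\<^esub> w \<in> {v \<in> K. v n = \<zero>}" using K(3)[of v w] by auto
  next
    fix a v assume "a \<in> carrier R" "v \<in> {v \<in> K. v n = \<zero>}"
    then show "a \<odot>\<^bsub>FM R n\<^esub> v \<in> {v \<in> K. v n = \<zero>}" using K(5)[of a v] by auto
  qed (use K(2) in auto)
qed

end

section \<open>Submodules of free modules over a noetherian ring\<close>

locale noetherian_cring = cring + noetherian_ring

context noetherian_cring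
begin

text \<open>Induction over the rank: the generators are those of the part of \<open>H\<close> in the
  hyperplane \<open>v n = \<zero>\<close>, together with lifts of generators of the ideal of last
  coordinates. Generation is phrased through all \<open>K\<close> containing \<open>A\<close>, so no
  linear combinations occur.\<close>

lemma FM_submodule_fin_gen:
  assumes "submodule H R (FM R n)"
  shows "\<exists>A. finite A \<and> A \<subseteq> H \<and> (\<forall>K. submodule K R (FM R n) \<longrightarrow> A \<subseteq> K \<longrightarrow> H \<subseteq> K)"
  using assms
proof (induction n arbitrary: H)
  case 0
  have "carrier (FM R 0) = {\<zero>\<^bsub>FM R 0\<^esub>}"
    by (auto simp: free_module_def)
  then have "H \<subseteq> K" if "submodule K R (FM R 0)" for K
    using submoduleD(1)[OF 0] submoduleD(2)[OF that] by (metis singletonD subsetI)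
  then show ?case by (intro exI[of _ "{}"]) auto
next
  case (Suc n)
  note mods = FM_module[of "Suc n"] regular_module_module coordinate_hom[of n "Suc n"]
  interpret F: module R "FM R (Suc n)" by (rule FM_module)
  note H = submoduleD[OF Suc.prems]
  obtain A0 where A0: "finite A0" "A0 \<subseteq> {v \<in> H. v n = \<zero>}"
    "\<And>K. submodule K R (FM R n) \<Longrightarrow> A0 \<subseteq> K \<Longrightarrow> {v \<in> H. v n = \<zero>} \<subseteq> K"
    using Suc.IH[OF FM_hyperplane_submodule[OF Suc.prems]] by meson
  let ?J = "(\<lambda>v. v n) ` H"
  have "ideal ?J R"
    unfolding submodule_regular_iff[symmetric] by (rule image_submodule[OF mods Suc.prems])
  then obtain B where B: "B \<subseteq> carrier R" "finite B" "?J = Idl B"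
    using finetely_gen by blast
  have "B \<subseteq> ?J" unfolding B(3) by (rule genideal_self[OF B(1)])
  then have "\<forall>b\<in>B. \<exists>v. v \<in> H \<and> v n = b" by blast
  then obtain w where w: "\<And>b. b \<in> B \<Longrightarrow> w b \<in> H" "\<And>b. b \<in> B \<Longrightarrow> w b n = b"
    unfolding bchoice_iff by blast
  have "H \<subseteq> K" if K: "submodule K R (FM R (Suc n))" and sub: "A0 \<union> w ` B \<subseteq> K" for K
  proof
    fix v assume v: "v \<in> H"
    note K' = submoduleD[OF K]
    \<comment> \<open>The last coordinates of \<open>H \<inter> K\<close> form an ideal that
      contains \<open>B\<close>, hence all of \<open>?J\<close>. So some \<open>x\<close> in
      \<open>H \<inter> K\<close> has the last coordinate of \<open>v\<close>, and the difference
      lies in the hyperplane.\<close>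
    have "ideal ((\<lambda>v. v n) ` (H \<inter> K)) R"
      unfolding submodule_regular_iff[symmetric]
      by (rule image_submodule[OF mods inter_submodule[OF mods(1) Suc.prems K]])
    moreover have "b \<in> (\<lambda>v. v n) ` (H \<inter> K)" if "b \<in> B" for b
      using w[OF that] sub that by (intro image_eqI[of _ _ "w b"]) auto
    ultimately have "?J \<subseteq> (\<lambda>v. v n) ` (H \<inter> K)"
      unfolding B(3) by (intro genideal_minimal) auto
    with v have "v n \<in> (\<lambda>v. v n) ` (H \<inter> K)" by blast
    then obtain x where "x \<in> H \<inter> K" "v n = x n" by (rule imageE)
    then have x: "x \<in> H" "x \<in> K" "x n = v n" by simp_all
    have "v n \<in> carrier R" using H(1)[OF v] by (auto simp: FM_carrier_iff)
    then have "v \<ominus>\<^bsub>FM R (Suc n)\<^esub> x \<in> {v \<in> H. v n = \<zero>}"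
      using H(4)[OF v x(1)] x(3) free_module_diff[OF H(1)[OF v] H(1)[OF x(1)]] r_neg
      by (simp add: minus_eq)
    moreover have "A0 \<subseteq> {v \<in> K. v n = \<zero>}" using A0(2) sub by blast
    ultimately have "v \<ominus>\<^bsub>FM R (Suc n)\<^esub> x \<in> K"
      using A0(3)[OF FM_hyperplane_submodule[OF K]] by blast
    then have "(v \<ominus>\<^bsub>FM R (Suc n)\<^esub> x) \<oplus>\<^bsub>FM R (Suc n)\<^esub> x \<in> K" by (rule K'(3)[OF _ x(2)])
    also have "(v \<ominus>\<^bsub>FM R (Suc n)\<^esub> x) \<oplus>\<^bsub>FM R (Suc n)\<^esub> x = v"
      using H(1)[OF v] H(1)[OF x(1)]
      by (simp add: F.M.minus_eq F.M.a_assoc F.M.l_neg del: free_module_simps)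
    finally show "v \<in> K" .
  qed
  then show ?case
    by (intro exI[of _ "A0 \<union> w ` B"]) (use A0(1,2) B(2) w(1) in blast)
qed

text \<open>The union of a chain is finitely generated and therefore one of its members, so Zorn's
  lemma applies. This is the form in which \<open>artin_rees\<close> uses the ascending chain
  condition, both to choose \<open>L\<close> and to make colon submodules stabilise.\<close>

lemma FM_submodule_maximal:
  assumes "\<S> \<noteq> {}" and sub: "\<And>H. H \<in> \<S> \<Longrightarrow> submodule H R (FM R n)"
  shows "\<exists>L\<in>\<S>. \<forall>K\<in>\<S>. L \<subseteq> K \<longrightarrow> K = L"
proof (rule subset_Zorn_nonempty[OF assms(1)])
  fix C assume C: "C \<noteq> {}" "subset.chain \<S> C"
  interpret F: module R "FM R n" by (rule FM_module)
  have CS: "H \<in> C \<Longrightarrow> submodule H R (FM R n)" for H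
    by (rule sub, rule subsetD[of C]) (use C(2) in \<open>simp_all add: subset_chain_def\<close>)
  have dir: "\<exists>H\<in>C. A \<subseteq> H" if "finite A" "A \<subseteq> \<Union>C" for A
    using finite_subset_Union_chain[OF that C] by blast
  have "submodule (\<Union>C) R (FM R n)"
  proof (rule F.submoduleI')
    show "\<Union>C \<subseteq> carrier (FM R n)" by (intro Union_least subsetI submoduleD(1)[OF CS])
    show "\<zero>\<^bsub>FM R n\<^esub> \<in> \<Union>C" using submoduleD(2)[OF CS] C(1) by blast
    fix x y assume "x \<in> \<Union>C" "y \<in> \<Union>C"
    then obtain H where "H \<in> C" "{x, y} \<subseteq> H" using dir[of "{x, y}"] by auto
    then show "x \<oplus>\<^bsub>FM R n\<^esub> y \<in> \<Union>C" using submoduleD(3)[OF CS, of H x y] by blast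
  next
    fix a x assume "a \<in> carrier R" "x \<in> \<Union>C"
    then show "a \<odot>\<^bsub>FM R n\<^esub> x \<in> \<Union>C" using submoduleD(5)[OF CS] by blast
  qed
  from FM_submodule_fin_gen[OF this] obtain A where A: "finite A" "A \<subseteq> \<Union>C"
    "\<And>K. submodule K R (FM R n) \<Longrightarrow> A \<subseteq> K \<Longrightarrow> \<Union>C \<subseteq> K" by meson
  then obtain H where H: "H \<in> C" "A \<subseteq> H" using dir by blast
  have "\<Union>C = H" using A(3)[OF CS[OF H(1)] H(2)] H(1) by (intro equalityI Union_upper)
  then show "\<Union>C \<in> \<S>" using subsetD[OF _ H(1)] C(2) by (simp add: subset_chain_def)
qed

end

text \<open>For a submodule \<open>H\<close> this is \<open>J H\<close>, with \<open>J\<close>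
  generated by the \<open>N\<close>-th powers of the elements of \<open>X\<close>. For finite
  \<open>X\<close> it defines the same topology as the powers of the ideal, and it matches the
  annihilation of homology, which is stated generator by generator.\<close>

definition power_span ::
    "('a, 'm) ring_scheme \<Rightarrow> ('a, 'b) module \<Rightarrow> 'a set \<Rightarrow> nat \<Rightarrow> 'b set \<Rightarrow> 'b set" where
  "power_span R M X N H = mspan R M {(t [^]\<^bsub>R\<^esub> N) \<odot>\<^bsub>M\<^esub> x | t x. t \<in> X \<and> x \<in> H}"

lemma power_span_submodule:
  assumes "module R M" "X \<subseteq> carrier R" "H \<subseteq> carrier M"
  shows "submodule (power_span R M X N H) R M"
proof -
  interpret module R M by fact
  show ?thesis unfolding power_span_def
    by (rule mspan_submodule[OF assms(1)]) (use assms in auto)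
qed

lemma power_span_memI:
  assumes "t \<in> X" "x \<in> H"
  shows "(t [^]\<^bsub>R\<^esub> N) \<odot>\<^bsub>M\<^esub> x \<in> power_span R M X N H"
  unfolding power_span_def by (rule subsetD[OF mspan_incl]) (use assms in blast)

lemma power_span_least:
  assumes "submodule K R M" "\<And>t x. t \<in> X \<Longrightarrow> x \<in> H \<Longrightarrow> (t [^]\<^bsub>R\<^esub> N) \<odot>\<^bsub>M\<^esub> x \<in> K"
  shows "power_span R M X N H \<subseteq> K"
  unfolding power_span_def by (rule mspan_least[OF assms(1)]) (use assms(2) in auto)

lemma power_span_image:
  assumes "module R M" "module R N" "f \<in> mod_hom R M N" "X \<subseteq> carrier R" "H \<subseteq> carrier M"
  shows "f ` power_span R M X n H = power_span R N X n (f ` H)"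
proof -
  interpret module R M by fact
  have c: "t [^]\<^bsub>R\<^esub> n \<in> carrier R" "x \<in> carrier M" if "t \<in> X" "x \<in> H" for t x using that assms by auto
  have "f ` {(t [^]\<^bsub>R\<^esub> n) \<odot>\<^bsub>M\<^esub> x | t x. t \<in> X \<and> x \<in> H}
      = {(t [^]\<^bsub>R\<^esub> n) \<odot>\<^bsub>N\<^esub> x | t x. t \<in> X \<and> x \<in> f ` H}" (is "f ` ?A = ?B")
  proof
    show "f ` ?A \<subseteq> ?B"
    proof
      fix y assume "y \<in> f ` ?A"
      then obtain t x where "t \<in> X" "x \<in> H" "y = f ((t [^]\<^bsub>R\<^esub> n) \<odot>\<^bsub>M\<^esub> x)" by auto
      then show "y \<in> ?B" using mod_homD(3)[OF assms(3) c, of t x] by blast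
    qed
    show "?B \<subseteq> f ` ?A"
    proof
      fix y assume "y \<in> ?B"
      then obtain t x where tx: "t \<in> X" "x \<in> H" "y = (t [^]\<^bsub>R\<^esub> n) \<odot>\<^bsub>N\<^esub> f x" by auto
      then show "y \<in> f ` ?A"
        using mod_homD(3)[OF assms(3) c[OF tx(1,2)]] by (intro image_eqI[of _ _ "(t [^]\<^bsub>R\<^esub> n) \<odot>\<^bsub>M\<^esub> x"]) auto
    qed
  qed
  moreover have "?A \<subseteq> carrier M" using c by auto
  ultimately show ?thesis
    unfolding power_span_def using mspan_image[OF assms(1-3), of ?A] by metis
qed

text \<open>The surplus factor \<open>t^(n - k)\<close> is absorbed by \<open>H\<close>, which is
  closed under scaling.\<close>

lemma power_span_antimono:
  assumes "module R M" "X \<subseteq> carrier R" "submodule H R M" "k \<le> n"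
  shows "power_span R M X n H \<subseteq> power_span R M X k H"
proof (rule power_span_least)
  interpret module R M by fact
  have HM: "H \<subseteq> carrier M" using submoduleD(1)[OF assms(3)] by auto
  show "submodule (power_span R M X k H) R M" by (rule power_span_submodule[OF assms(1,2) HM])
  fix t x assume tx: "t \<in> X" "x \<in> H"
  have t: "t \<in> carrier R" and x: "x \<in> carrier M" using tx assms(2) HM by auto
  have "(t [^]\<^bsub>R\<^esub> (k + (n - k))) \<odot>\<^bsub>M\<^esub> x = (t [^]\<^bsub>R\<^esub> k) \<odot>\<^bsub>M\<^esub> ((t [^]\<^bsub>R\<^esub> (n - k)) \<odot>\<^bsub>M\<^esub> x)"
    using t x by (simp add: R.nat_pow_mult[symmetric] smult_assoc1)
  moreover have "(t [^]\<^bsub>R\<^esub> (n - k)) \<odot>\<^bsub>M\<^esub> x \<in> H"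
    using submoduleD(5)[OF assms(3)] t tx(2) by auto
  ultimately show "(t [^]\<^bsub>R\<^esub> n) \<odot>\<^bsub>M\<^esub> x \<in> power_span R M X k H"
    using power_span_memI[OF tx(1)] assms(4) by (metis le_add_diff_inverse)
qed

text \<open>Krull's trick in place of the Rees algebra: if \<open>L\<close> is maximal among the submodules that contain
  \<open>X\<^sup>NH\<close> and meet \<open>H\<close> only there, then some power of each \<open>t \<in> X\<close> maps the whole module into \<open>L\<close>.\<close>

lemma artin_rees:
  fixes R (structure) and M :: "('a, 'b) module"
  assumes M: "module R M"
    and max: "\<And>\<S>. \<S> \<noteq> {} \<Longrightarrow> (\<And>H. H \<in> \<S> \<Longrightarrow> submodule H R M) \<Longrightarrow>
      \<exists>L\<in>\<S>. \<forall>K\<in>\<S>. L \<subseteq> K \<longrightarrow> K = L"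
    and X: "finite X" "X \<subseteq> carrier R" and H: "submodule H R M"
  shows "\<exists>k. power_span R M X k (carrier M) \<inter> H \<subseteq> power_span R M X N H"
proof -
  let ?S = "power_span R M X N H"
  interpret module R M by (rule M)
  have HM: "H \<subseteq> carrier M" using submoduleD(1)[OF H] by auto
  have S: "submodule ?S R M" by (rule power_span_submodule[OF M X(2) HM])
  let ?F = "{L. submodule L R M \<and> ?S \<subseteq> L \<and> L \<inter> H \<subseteq> ?S}"
  have "?S \<in> ?F" using S by auto
  then have "\<exists>L\<in>?F. \<forall>K\<in>?F. L \<subseteq> K \<longrightarrow> K = L"
  proof (intro max)
    show "?F \<noteq> {}" using \<open>?S \<in> ?F\<close> by (metis empty_iff)
    show "submodule K R M" if "K \<in> ?F" for K using that by simp
  qed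
  then obtain L where LF: "L \<in> ?F" and Lm: "\<forall>K\<in>?F. L \<subseteq> K \<longrightarrow> K = L" by (rule bexE)
  from LF have L: "submodule L R M" "?S \<subseteq> L" "L \<inter> H \<subseteq> ?S" by simp_all
  have Lmax: "K = L" if "submodule K R M" "?S \<subseteq> K" "K \<inter> H \<subseteq> ?S" "L \<subseteq> K" for K
    using Lm that by simp
  note L' = submoduleD[OF L(1)]
  have "\<exists>k. \<forall>x\<in>carrier M. (t [^] (k::nat)) \<odot>\<^bsub>M\<^esub> x \<in> L" if t: "t \<in> X" for t
  proof -
    have tR: "t [^] k \<in> carrier R" for k :: nat using t X by auto
    have mult: "(t [^] k) \<odot>\<^bsub>M\<^esub> x \<in> carrier M" if "x \<in> carrier M" for x and k :: nat
      using that tR by (intro smult_closed)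
    have add: "(t [^] (k + l)) \<odot>\<^bsub>M\<^esub> x = (t [^] k) \<odot>\<^bsub>M\<^esub> ((t [^] l) \<odot>\<^bsub>M\<^esub> x)"
      if "x \<in> carrier M" for x and k l :: nat
    proof -
      have "t [^] (k + l) = t [^] k \<otimes> t [^] l" using t X by (auto simp: R.nat_pow_mult)
      then show ?thesis using smult_assoc1[OF tR tR that] by simp
    qed
    have hom: "(\<lambda>x. (t [^] k) \<odot>\<^bsub>M\<^esub> x) \<in> mod_hom R M M" for k :: nat
      by (rule mod_hom_smult[OF M _ tR]) (auto simp: mod_hom_def)
    \<comment> \<open>The colon submodules \<open>L : t^k\<close> grow with \<open>k\<close>. A
      maximal one among them is unchanged by raising \<open>k\<close>, in particular by
      \<open>N\<close>.\<close>
    define C where "C k = {x \<in> carrier M. (t [^] (k::nat)) \<odot>\<^bsub>M\<^esub> x \<in> L}" for k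
    have "\<exists>K\<in>range C. \<forall>K'\<in>range C. K \<subseteq> K' \<longrightarrow> K' = K"
    proof (rule max)
      show "submodule K R M" if "K \<in> range C" for K
        using that preimage_submodule[OF M M hom L(1)] unfolding C_def by auto
    qed simp
    then obtain k where k: "\<And>k'. C k \<subseteq> C k' \<Longrightarrow> C k' = C k" by auto
    have "C k \<subseteq> C (N + k)"
      unfolding C_def using add L'(5)[OF tR] by auto
    then have stab: "C (N + k) = C k" by (rule k)
    \<comment> \<open>The candidate \<open>L + t^k M\<close>. Once it is known to meet
      \<open>H\<close> only inside \<open>?S\<close>, maximality makes it equal to \<open>L\<close>,
      which puts \<open>t^k M\<close> into \<open>L\<close>.\<close>
    let ?K = "{y \<in> carrier M. \<exists>l\<in>L. \<exists>x\<in>carrier M. y = l \<oplus>\<^bsub>M\<^esub> (t [^] k) \<odot>\<^bsub>M\<^esub> x}"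
    have LK: "L \<subseteq> ?K"
    proof
      fix l assume l: "l \<in> L"
      then have "l = l \<oplus>\<^bsub>M\<^esub> (t [^] k) \<odot>\<^bsub>M\<^esub> \<zero>\<^bsub>M\<^esub>" using L'(1)[of l] tR by simp
      then show "l \<in> ?K" using l L'(1)[of l] M.zero_closed by blast
    qed
    have K: "submodule ?K R M"
    proof (rule submoduleI')
      show "\<zero>\<^bsub>M\<^esub> \<in> ?K" using LK L'(2) by blast
      fix y z assume "y \<in> ?K" "z \<in> ?K"
      then obtain l x l' x' where "y = l \<oplus>\<^bsub>M\<^esub> (t [^] k) \<odot>\<^bsub>M\<^esub> x" "z = l' \<oplus>\<^bsub>M\<^esub> (t [^] k) \<odot>\<^bsub>M\<^esub> x'"
        and c: "l \<in> L" "l' \<in> L" "x \<in> carrier M" "x' \<in> carrier M" by blast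
      then have e: "y \<oplus>\<^bsub>M\<^esub> z = (l \<oplus>\<^bsub>M\<^esub> l') \<oplus>\<^bsub>M\<^esub> (t [^] k) \<odot>\<^bsub>M\<^esub> (x \<oplus>\<^bsub>M\<^esub> x')"
        using c mult[of x k] mult[of x' k] L'(1)[OF c(1)] L'(1)[OF c(2)]
        by (simp add: smult_r_distr[OF tR] M.add.m_ac)
      have "l \<oplus>\<^bsub>M\<^esub> l' \<in> L" "x \<oplus>\<^bsub>M\<^esub> x' \<in> carrier M" using c L'(3) by auto
      moreover have "y \<oplus>\<^bsub>M\<^esub> z \<in> carrier M"
        using \<open>y \<in> ?K\<close> \<open>z \<in> ?K\<close> by auto
      ultimately show "y \<oplus>\<^bsub>M\<^esub> z \<in> ?K" using e by blast
    next
      fix a y assume a: "a \<in> carrier R" and y: "y \<in> ?K"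
      then obtain l x where e: "y = l \<oplus>\<^bsub>M\<^esub> (t [^] k) \<odot>\<^bsub>M\<^esub> x"
        and c: "l \<in> L" "x \<in> carrier M" by blast
      have "a \<odot>\<^bsub>M\<^esub> ((t [^] k) \<odot>\<^bsub>M\<^esub> x) = (t [^] k) \<odot>\<^bsub>M\<^esub> (a \<odot>\<^bsub>M\<^esub> x)"
        using a c tR[of k] smult_assoc1[of a "t [^] k" x] smult_assoc1[of "t [^] k" a x] R.m_comm[of a "t [^] k"]
        by simp
      then have "a \<odot>\<^bsub>M\<^esub> y = a \<odot>\<^bsub>M\<^esub> l \<oplus>\<^bsub>M\<^esub> (t [^] k) \<odot>\<^bsub>M\<^esub> (a \<odot>\<^bsub>M\<^esub> x)"
        using e smult_r_distr[OF a L'(1)[OF c(1)] mult[OF c(2)]] by simp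
      moreover have "a \<odot>\<^bsub>M\<^esub> l \<in> L" "a \<odot>\<^bsub>M\<^esub> x \<in> carrier M" "a \<odot>\<^bsub>M\<^esub> y \<in> carrier M"
        using a c y L'(5) by auto
      ultimately show "a \<odot>\<^bsub>M\<^esub> y \<in> ?K" by blast
    qed auto
    have "?K \<inter> H \<subseteq> ?S"
    proof
      fix y assume "y \<in> ?K \<inter> H"
      then obtain l x where y: "y \<in> H" "y \<in> carrier M" and e: "y = l \<oplus>\<^bsub>M\<^esub> (t [^] k) \<odot>\<^bsub>M\<^esub> x"
        and c: "l \<in> L" "x \<in> carrier M" by blast
      have lc: "l \<in> carrier M" by (rule L'(1)[OF c(1)])
      \<comment> \<open>As \<open>?S\<close> lies in \<open>L\<close>, so does \<open>t^N y\<close>;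
        subtracting \<open>t^N l\<close> leaves \<open>t^(N + k) x\<close> in \<open>L\<close>.
        Stability lowers the exponent to \<open>k\<close>, and then \<open>y\<close> itself is in
        \<open>L\<close>.\<close>
      have "(t [^] N) \<odot>\<^bsub>M\<^esub> y \<in> L"
        using power_span_memI[OF t y(1)] L(2) by blast
      then have "(t [^] N) \<odot>\<^bsub>M\<^esub> y \<ominus>\<^bsub>M\<^esub> (t [^] N) \<odot>\<^bsub>M\<^esub> l \<in> L"
        by (rule L'(4)[OF _ L'(5)[OF tR c(1)]])
      also have "(t [^] N) \<odot>\<^bsub>M\<^esub> y \<ominus>\<^bsub>M\<^esub> (t [^] N) \<odot>\<^bsub>M\<^esub> l = (t [^] (N + k)) \<odot>\<^bsub>M\<^esub> x"
        unfolding e add[OF c(2)] smult_r_distr[OF tR lc mult[OF c(2)]]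
        using mult[OF lc, of N] mult[OF mult[OF c(2), of k], of N]
        by (simp add: M.minus_eq M.a_ac M.r_neg M.r_neg1 M.r_neg2)
      finally have "x \<in> C (N + k)" using c by (simp add: C_def)
      then have "x \<in> C k" by (simp add: stab)
      then have "y \<in> L" unfolding e using L'(3)[OF c(1)] by (simp add: C_def)
      then show "y \<in> ?S" using L(3) y by blast
    qed
    then have KL: "?K = L" by (intro Lmax K LK subset_trans[OF L(2) LK])
    have "(t [^] k) \<odot>\<^bsub>M\<^esub> x \<in> L" if x: "x \<in> carrier M" for x
    proof -
      have "(t [^] k) \<odot>\<^bsub>M\<^esub> x = \<zero>\<^bsub>M\<^esub> \<oplus>\<^bsub>M\<^esub> (t [^] k) \<odot>\<^bsub>M\<^esub> x" using mult[OF x] by simp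
      then have "(t [^] k) \<odot>\<^bsub>M\<^esub> x \<in> ?K" using L'(2) x mult[OF x] by blast
      then show ?thesis by (simp only: KL)
    qed
    then show ?thesis by blast
  qed
  then obtain k where k: "\<And>t x. t \<in> X \<Longrightarrow> x \<in> carrier M \<Longrightarrow> (t [^] (k t :: nat)) \<odot>\<^bsub>M\<^esub> x \<in> L" by metis
  define m where "m = Max (k ` X)"
  have "(t [^] m) \<odot>\<^bsub>M\<^esub> x \<in> L" if t: "t \<in> X" and x: "x \<in> carrier M" for t x
  proof -
    have "k t \<le> m" using t X(1) by (simp add: m_def)
    moreover have tR: "t \<in> carrier R" using t X by auto
    ultimately have "t [^] m = t [^] (m - k t) \<otimes> t [^] k t" by (simp add: R.nat_pow_mult)
    then have "(t [^] m) \<odot>\<^bsub>M\<^esub> x = (t [^] (m - k t)) \<odot>\<^bsub>M\<^esub> ((t [^] k t) \<odot>\<^bsub>M\<^esub> x)"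
      using x tR by (simp add: smult_assoc1)
    then show ?thesis using L'(5)[OF _ k[OF t x], of "t [^] (m - k t)"] tR by simp
  qed
  then have "power_span R M X m (carrier M) \<subseteq> L" by (intro power_span_least[OF L(1)])
  then show ?thesis using L(3) by blast
qed

lemma (in noetherian_cring) FM_artin_rees:
  assumes "finite X" "X \<subseteq> carrier R" "submodule H R (FM R n)"
  shows "\<exists>k. power_span R (FM R n) X k (carrier (FM R n)) \<inter> H \<subseteq> power_span R (FM R n) X N H"
  by (rule artin_rees[OF FM_module FM_submodule_maximal assms])

section \<open>Resolutions, comparison maps and homotopies\<close>

text \<open>The comparison theorem, with \<open>dP j\<close> leaving degree \<open>Suc j\<close>.
  The condition on \<open>\<phi>\<close> is stated by images instead of augmentations, so that the
  lemma serves in both directions between \<open>G\<close> and the resolution of length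
  \<open>m\<close>.\<close>

lemma chain_lift:
  fixes P :: "nat \<Rightarrow> ('a, 'b) module" and X :: "nat \<Rightarrow> ('a, 'c) module"
  assumes P: "\<And>j. projective_module R (P j)"
    and dP: "\<And>j. dP j \<in> mod_hom R (P (Suc j)) (P j)"
    and dP0: "\<And>j x. x \<in> carrier (P (Suc (Suc j))) \<Longrightarrow> dP j (dP (Suc j) x) = \<zero>\<^bsub>P j\<^esub>"
    and X: "\<And>j. module R (X j)"
    and dX: "\<And>j. dX j \<in> mod_hom R (X (Suc j)) (X j)"
    and exact: "\<And>j x. x \<in> carrier (X (Suc j)) \<Longrightarrow> dX j x = \<zero>\<^bsub>X j\<^esub> \<Longrightarrow>
      x \<in> dX (Suc j) ` carrier (X (Suc (Suc j)))"
    and \<phi>: "\<phi> \<in> mod_hom R (P 0) (X 0)"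
      "\<And>x. x \<in> carrier (P (Suc 0)) \<Longrightarrow> \<phi> (dP 0 x) \<in> dX 0 ` carrier (X (Suc 0))"
  obtains f where "f 0 = \<phi>" "\<And>j. f j \<in> mod_hom R (P j) (X j)"
    "\<And>j x. x \<in> carrier (P (Suc j)) \<Longrightarrow> dX j (f (Suc j) x) = f j (dP j x)"
proof -
  \<comment> \<open>The invariant carries the solvability of the next lifting problem:
    \<open>f\<close> after \<open>dP n\<close> lands in the image of \<open>dX n\<close>.\<close>
  define A where "A n f \<longleftrightarrow> f \<in> mod_hom R (P n) (X n) \<and>
    (\<forall>x\<in>carrier (P (Suc n)). f (dP n x) \<in> dX n ` carrier (X (Suc n))) \<and> (n = 0 \<longrightarrow> f = \<phi>)" for n f
  define B where "B n f f' \<longleftrightarrow> (\<forall>x\<in>carrier (P (Suc n)). dX n (f' x) = f (dP n x))" for n and f f' :: "'b \<Rightarrow> 'c"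
  have Pm: "module R (P j)" for j using P by (simp add: projective_module_def)
  have "\<exists>f. \<forall>n. A n (f n) \<and> B n (f n) (f (Suc n))"
  proof (rule dependent_nat_choice)
    show "\<exists>f. A 0 f" using \<phi> by (auto simp: A_def)
    fix f n assume f: "A n f"
    then have fh: "f \<in> mod_hom R (P n) (X n)" by (simp add: A_def)
    have "\<exists>f'\<in>mod_hom R (P (Suc n)) (X (Suc n)). \<forall>x\<in>carrier (P (Suc n)). dX n (f' x) = f (dP n x)"
      by (rule projective_module_lift_into[OF P X X dX mod_hom_comp[OF dP fh]])
        (use f in \<open>simp add: A_def\<close>)
    then obtain f' where f': "f' \<in> mod_hom R (P (Suc n)) (X (Suc n))"
      "\<And>x. x \<in> carrier (P (Suc n)) \<Longrightarrow> dX n (f' x) = f (dP n x)" by metis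
    have "f' (dP (Suc n) x) \<in> dX (Suc n) ` carrier (X (Suc (Suc n)))"
      if x: "x \<in> carrier (P (Suc (Suc n)))" for x
    proof (rule exact)
      show "f' (dP (Suc n) x) \<in> carrier (X (Suc n))"
        by (intro mod_homD(1)[OF f'(1)] mod_homD(1)[OF dP] x)
      show "dX n (f' (dP (Suc n) x)) = \<zero>\<^bsub>X n\<^esub>"
        using f'(2)[OF mod_homD(1)[OF dP x]] dP0[OF x] mod_hom_zero[OF Pm X fh] by simp
    qed
    then show "\<exists>f'. A (Suc n) f' \<and> B n f f'" using f' by (auto simp: A_def B_def)
  qed
  then obtain f where "\<And>n. A n (f n)" "\<And>n. B n (f n) (f (Suc n))" by metis
  then show thesis by (intro that[of f]) (simp_all add: A_def B_def)
qed

text \<open>A chain endomorphism that induces zero on the cokernel of \<open>D 0\<close> is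
  null-homotopic. The last conclusion is the homotopy identity on boundaries, where one of its terms
  vanishes; it is the invariant that allows the next step, and in degree \<open>m\<close> it gives
  the splitting.\<close>

lemma chain_homotopy:
  fixes G :: "nat \<Rightarrow> ('a, 'b) module"
  assumes G: "\<And>j. projective_module R (G j)"
    and D: "\<And>j. D j \<in> mod_hom R (G (Suc j)) (G j)"
    and D0: "\<And>j x. x \<in> carrier (G (Suc (Suc j))) \<Longrightarrow> D j (D (Suc j) x) = \<zero>\<^bsub>G j\<^esub>"
    and exact: "\<And>j x. x \<in> carrier (G (Suc j)) \<Longrightarrow> D j x = \<zero>\<^bsub>G j\<^esub> \<Longrightarrow>
      x \<in> D (Suc j) ` carrier (G (Suc (Suc j)))"
    and c: "\<And>j. c j \<in> mod_hom R (G j) (G j)"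
      "\<And>j x. x \<in> carrier (G (Suc j)) \<Longrightarrow> D j (c (Suc j) x) = c j (D j x)"
    and c0: "\<And>x. x \<in> carrier (G 0) \<Longrightarrow> c 0 x \<in> D 0 ` carrier (G (Suc 0))"
  obtains h where "\<And>j. h j \<in> mod_hom R (G j) (G (Suc j))"
    "\<And>x. x \<in> carrier (G 0) \<Longrightarrow> D 0 (h 0 x) = c 0 x"
    "\<And>j x. x \<in> carrier (G (Suc j)) \<Longrightarrow> D (Suc j) (h (Suc j) x) = c (Suc j) x \<ominus>\<^bsub>G (Suc j)\<^esub> h j (D j x)"
    "\<And>j x. x \<in> carrier (G (Suc j)) \<Longrightarrow> D j (h j (D j x)) = c j (D j x)"
proof -
  define A where "A n h \<longleftrightarrow> h \<in> mod_hom R (G n) (G (Suc n)) \<and>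
    (\<forall>x\<in>carrier (G (Suc n)). D n (h (D n x)) = c n (D n x)) \<and>
    (n = 0 \<longrightarrow> (\<forall>x\<in>carrier (G 0). D 0 (h x) = c 0 x))" for n h
  define B where "B n h h' \<longleftrightarrow>
    (\<forall>x\<in>carrier (G (Suc n)). D (Suc n) (h' x) = c (Suc n) x \<ominus>\<^bsub>G (Suc n)\<^esub> h (D n x))" for n h h'
  have Gm: "module R (G j)" for j using G by (simp add: projective_module_def)
  have Gg: "abelian_group (G j)" for j using Gm by (rule module.axioms)
  have sub0: "x \<ominus>\<^bsub>G j\<^esub> \<zero>\<^bsub>G j\<^esub> = x" "x \<ominus>\<^bsub>G j\<^esub> x = \<zero>\<^bsub>G j\<^esub>" if "x \<in> carrier (G j)" for x j
  proof -
    interpret abelian_group "G j" by (rule Gg)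
    show "x \<ominus>\<^bsub>G j\<^esub> \<zero>\<^bsub>G j\<^esub> = x" "x \<ominus>\<^bsub>G j\<^esub> x = \<zero>\<^bsub>G j\<^esub>"
      using that by (simp_all add: minus_eq r_neg)
  qed
  have "\<exists>h. \<forall>n. A n (h n) \<and> B n (h n) (h (Suc n))"
  proof (rule dependent_nat_choice)
    obtain h where h: "h \<in> mod_hom R (G 0) (G (Suc 0))" "\<And>x. x \<in> carrier (G 0) \<Longrightarrow> D 0 (h x) = c 0 x"
      using projective_module_lift_into[OF G Gm Gm D c(1) c0] by metis
    moreover have "D 0 x \<in> carrier (G 0)" if "x \<in> carrier (G (Suc 0))" for x
      by (rule mod_homD(1)[OF D that])
    ultimately have "A 0 h" by (simp add: A_def)
    then show "\<exists>h. A 0 h" by blast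
  next
    fix h n assume h: "A n h"
    then have hh: "h \<in> mod_hom R (G n) (G (Suc n))" by (simp add: A_def)
    let ?f = "\<lambda>x. c (Suc n) x \<ominus>\<^bsub>G (Suc n)\<^esub> h (D n x)"
    have f: "?f \<in> mod_hom R (G (Suc n)) (G (Suc n))"
      by (rule mod_hom_diff[OF Gm Gm c(1) mod_hom_comp[OF D hh]])
    have "?f x \<in> D (Suc n) ` carrier (G (Suc (Suc n)))" if x: "x \<in> carrier (G (Suc n))" for x
    proof (rule exact[OF mod_homD(1)[OF f x]])
      have Dx: "D n x \<in> carrier (G n)" by (rule mod_homD(1)[OF D x])
      have "D n (?f x) = D n (c (Suc n) x) \<ominus>\<^bsub>G n\<^esub> D n (h (D n x))"
        by (rule mod_hom_minus[OF Gm Gm D mod_homD(1)[OF c(1) x] mod_homD(1)[OF hh Dx]])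
      also have "\<dots> = c n (D n x) \<ominus>\<^bsub>G n\<^esub> c n (D n x)" using c(2)[OF x] h x by (simp add: A_def)
      also have "\<dots> = \<zero>\<^bsub>G n\<^esub>" by (rule sub0(2)[OF mod_homD(1)[OF c(1) Dx]])
      finally show "D n (?f x) = \<zero>\<^bsub>G n\<^esub>" .
    qed
    from projective_module_lift_into[OF G Gm Gm D f this]
    obtain h' where h': "h' \<in> mod_hom R (G (Suc n)) (G (Suc (Suc n)))"
      "\<And>x. x \<in> carrier (G (Suc n)) \<Longrightarrow> D (Suc n) (h' x) = ?f x" by metis
    have "D (Suc n) (h' (D (Suc n) x)) = c (Suc n) (D (Suc n) x)"
      if x: "x \<in> carrier (G (Suc (Suc n)))" for x
    proof -
      have Dx: "D (Suc n) x \<in> carrier (G (Suc n))" by (rule mod_homD(1)[OF D x])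
      show ?thesis
        using h'(2)[OF Dx] D0[OF x] mod_hom_zero[OF Gm Gm hh] sub0(1)[OF mod_homD(1)[OF c(1) Dx]] by simp
    qed
    then have "A (Suc n) h' \<and> B n h h'" using h' by (simp add: A_def B_def)
    then show "\<exists>h'. A (Suc n) h' \<and> B n h h'" by blast
  qed
  then obtain h where h: "\<And>n. A n (h n)" "\<And>n. B n (h n) (h (Suc n))" by metis
  show thesis
    by (rule that[of h]) (use h in \<open>simp_all add: A_def B_def\<close>)
qed

section \<open>Covers by free modules and free resolutions\<close>

lemma (in cring) FM_cover_mspan:
  assumes M: "module R M" and A: "finite A" "A \<subseteq> carrier M"
  obtains k f where "f \<in> mod_hom R (FM R k) M" "f ` carrier (FM R k) = mspan R M A"
proof -
  obtain e where e: "bij_betw e {..<card A} A"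
    using ex_bij_betw_nat_finite[OF A(1)] by (auto simp: atLeast0LessThan)
  have eA: "e b \<in> A" if "b < card A" for b using bij_betw_apply[OF e] that by simp
  have eM: "e b \<in> carrier M" if "b < card A" for b
    using eA[OF that] A(2) by blast
  let ?f = "lin_ext R M e"
  have f: "?f \<in> mod_hom R (FM R (card A)) M"
    by (rule lin_ext_hom[OF M]) (use eM in auto)
  have fu: "?f (unit_vec R b) = e b" if "b < card A" for b
    by (rule lin_ext_unit_vec[OF M, of _ "{..<card A}"]) (use eM that in auto)
  have "?f ` carrier (FM R (card A)) = mspan R M A"
  proof
    show "?f ` carrier (FM R (card A)) \<subseteq> mspan R M A"
    proof
      fix y assume "y \<in> ?f ` carrier (FM R (card A))"
      then obtain v where v: "v \<in> carrier (FM R (card A))" "y = ?f v" by auto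
      show "y \<in> mspan R M A" unfolding v(2)
        by (rule FM_subset_submodule[OF M f mspan_submodule[OF M A(2)] _ v(1)])
          (simp add: fu subsetD[OF mspan_incl eA])
    qed
    show "mspan R M A \<subseteq> ?f ` carrier (FM R (card A))"
    proof (rule mspan_least)
      show "submodule (?f ` carrier (FM R (card A))) R M"
        by (rule image_submodule[OF FM_module M f module.carrier_is_submodule[OF FM_module]])
      show "A \<subseteq> ?f ` carrier (FM R (card A))"
      proof
        fix a assume "a \<in> A"
        then obtain b where b: "b < card A" "a = e b" using bij_betw_imp_surj_on[OF e] by blast
        show "a \<in> ?f ` carrier (FM R (card A))"
          by (rule image_eqI[of _ _ "unit_vec R b"]) (use b fu in \<open>auto intro: unit_vec_carrier\<close>)
      qed
    qed
  qed
  then show thesis by (rule that[OF f])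
qed

lemma (in cring) fin_gen_cover:
  assumes "fin_gen_module R M"
  obtains k f where "f \<in> mod_hom R (FM R k) M" "f ` carrier (FM R k) = carrier M"
proof -
  obtain A where M: "module R M" and A: "finite A" "A \<subseteq> carrier M"
    and g: "\<forall>N. submodule N R M \<and> A \<subseteq> N \<longrightarrow> N = carrier M"
    using assms by (auto simp: fin_gen_module_def)
  have "mspan R M A = carrier M" using g mspan_submodule[OF M A(2)] mspan_incl by metis
  then show thesis using FM_cover_mspan[OF M A] that by metis
qed

lemma (in noetherian_cring) FM_cover:
  assumes H: "submodule H R (FM R n)"
  shows "\<exists>k. \<exists>f\<in>mod_hom R (FM R k) (FM R n). f ` carrier (FM R k) = H"
proof -
  obtain A where A: "finite A" "A \<subseteq> H" "\<And>K. submodule K R (FM R n) \<Longrightarrow> A \<subseteq> K \<Longrightarrow> H \<subseteq> K"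
    using FM_submodule_fin_gen[OF H] by metis
  have AM: "A \<subseteq> carrier (FM R n)" using A(2) submoduleD(1)[OF H] by blast
  have "mspan R (FM R n) A = H"
    by (intro equalityI mspan_least[OF H A(2)] A(3)[OF mspan_submodule[OF FM_module AM] mspan_incl])
  then show ?thesis using FM_cover_mspan[OF FM_module A(1) AM] by metis
qed

lemma (in noetherian_cring) free_resolution:
  assumes H: "submodule H R (FM R g)"
  obtains r D where "r 0 = g" "\<And>j. D j \<in> mod_hom R (FM R (r (Suc j))) (FM R (r j))"
    "D 0 ` carrier (FM R (r (Suc 0))) = H"
    "\<And>j. D (Suc j) ` carrier (FM R (r (Suc (Suc j)))) = {x \<in> carrier (FM R (r (Suc j))). D j x = \<zero>\<^bsub>FM R (r j)\<^esub>}"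
proof -
  \<comment> \<open>A triple holds the rank of the target, the rank of the source and the map.
    Consecutive triples share a rank, since each map covers the kernel of the one before.\<close>
  define A where "A n t \<longleftrightarrow> (case t of (a, b, f) \<Rightarrow> f \<in> mod_hom R (FM R b) (FM R a) \<and>
    (n = 0 \<longrightarrow> a = g \<and> f ` carrier (FM R b) = H))" for n :: nat and t
  define B where "B t t' \<longleftrightarrow> (case t of (a, b, f) \<Rightarrow> case t' of (a', b', f') \<Rightarrow> a' = b \<and>
    f' ` carrier (FM R b') = {x \<in> carrier (FM R b). f x = \<zero>\<^bsub>FM R a\<^esub>})"
    for t :: "nat \<times> nat \<times> ((nat \<Rightarrow> 'a) \<Rightarrow> nat \<Rightarrow> 'a)" and t' :: "nat \<times> nat \<times> ((nat \<Rightarrow> 'a) \<Rightarrow> nat \<Rightarrow> 'a)"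
  have "\<exists>t. \<forall>n. A n (t n) \<and> B (t n) (t (Suc n))"
  proof (rule dependent_nat_choice)
    obtain k f where "f \<in> mod_hom R (FM R k) (FM R g)" "f ` carrier (FM R k) = H"
      using FM_cover[OF H] by metis
    then have "A 0 (g, k, f)" by (simp add: A_def)
    then show "\<exists>t. A 0 t" by blast
  next
    fix t n assume t: "A n t"
    obtain a b f where tt: "t = (a, b, f)" by (cases t)
    have f: "f \<in> mod_hom R (FM R b) (FM R a)" using t by (simp add: A_def tt)
    have ker: "{x \<in> carrier (FM R b). f x \<in> {\<zero>\<^bsub>FM R a\<^esub>}} = {x \<in> carrier (FM R b). f x = \<zero>\<^bsub>FM R a\<^esub>}" by simp
    from FM_cover[OF preimage_submodule[OF FM_module FM_module f zero_submodule[OF FM_module]], unfolded ker]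
    show "\<exists>t'. A (Suc n) t' \<and> B t t'"
    proof (elim exE bexE)
      fix k f' assume "f' \<in> mod_hom R (FM R k) (FM R b)"
        "f' ` carrier (FM R k) = {x \<in> carrier (FM R b). f x = \<zero>\<^bsub>FM R a\<^esub>}"
      then have "A (Suc n) (b, k, f') \<and> B t (b, k, f')" by (simp add: A_def B_def tt)
      then show ?thesis by blast
    qed
  qed
  then obtain t where t: "\<And>n. A n (t n)" "\<And>n. B (t n) (t (Suc n))" by metis
  let ?r = "\<lambda>n. fst (t n)" and ?D = "\<lambda>n. snd (snd (t n))"
  have b: "fst (snd (t n)) = ?r (Suc n)" for n
    using t(2)[of n] by (simp add: B_def case_prod_unfold)
  show thesis
  proof (rule that[of ?r ?D])
    show "?r 0 = g" using t(1)[of 0] by (simp add: A_def case_prod_unfold)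
    show "?D j \<in> mod_hom R (FM R (?r (Suc j))) (FM R (?r j))" for j
      using t(1)[of j] by (simp add: A_def case_prod_unfold b)
    show "?D 0 ` carrier (FM R (?r (Suc 0))) = H"
      using t(1)[of 0] by (simp add: A_def case_prod_unfold b)
    show "?D (Suc j) ` carrier (FM R (?r (Suc (Suc j)))) = {x \<in> carrier (FM R (?r (Suc j))). ?D j x = \<zero>\<^bsub>FM R (?r j)\<^esub>}" for j
      using t(2)[of j] by (simp add: B_def case_prod_unfold b)
  qed
qed

section \<open>Quotient modules\<close>

lemma quotient_proj:
  assumes M: "module R M" and N: "submodule N R M"
  shows "(\<lambda>x. N +>\<^bsub>M\<^esub> x) \<in> mod_hom R M (quotient_module R M N)"
    and "(\<lambda>x. N +>\<^bsub>M\<^esub> x) ` carrier M = carrier (quotient_module R M N)"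
    and "x \<in> carrier M \<Longrightarrow> N +>\<^bsub>M\<^esub> x = \<zero>\<^bsub>quotient_module R M N\<^esub> \<longleftrightarrow> x \<in> N"
    and "x \<in> carrier M \<Longrightarrow> y \<in> carrier M \<Longrightarrow> N +>\<^bsub>M\<^esub> x = N +>\<^bsub>M\<^esub> y \<Longrightarrow> x \<ominus>\<^bsub>M\<^esub> y \<in> N"
proof -
  interpret module R M by fact
  interpret N: submodule N R M by fact
  interpret NS: abelian_subgroup N M
    by (rule abelian_subgroupI3[OF additive_subgroupI[OF N.subgroup_axioms] M.abelian_group_axioms])
  show hom: "(\<lambda>x. N +>\<^bsub>M\<^esub> x) \<in> mod_hom R M (quotient_module R M N)"
  proof (rule mod_homI)
    show "N +>\<^bsub>M\<^esub> x \<in> carrier (quotient_module R M N)" if "x \<in> carrier M" for x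
      using that by (auto simp: quotient_module_def A_RCOSETS_def')
    show "N +>\<^bsub>M\<^esub> (x \<oplus>\<^bsub>M\<^esub> y) = (N +>\<^bsub>M\<^esub> x) \<oplus>\<^bsub>quotient_module R M N\<^esub> (N +>\<^bsub>M\<^esub> y)"
      if "x \<in> carrier M" "y \<in> carrier M" for x y
      using that by (simp add: quotient_module_def NS.a_rcos_sum)
  qed (simp add: quotient_smult[OF assms])
  show "(\<lambda>x. N +>\<^bsub>M\<^esub> x) ` carrier M = carrier (quotient_module R M N)"
    by (auto simp: quotient_module_def A_RCOSETS_def')
  show zero: "N +>\<^bsub>M\<^esub> x = \<zero>\<^bsub>quotient_module R M N\<^esub> \<longleftrightarrow> x \<in> N" if "x \<in> carrier M" for x
    using that NS.a_rcos_self[OF that] NS.a_rcos_const by (auto simp: quotient_module_def)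
  have Q: "module R (quotient_module R M N)" by (rule quotient_module_module[OF assms])
  interpret Q: module R "quotient_module R M N" by (rule Q)
  assume x: "x \<in> carrier M" and y: "y \<in> carrier M" and e: "N +>\<^bsub>M\<^esub> x = N +>\<^bsub>M\<^esub> y"
  have "N +>\<^bsub>M\<^esub> (x \<ominus>\<^bsub>M\<^esub> y) = (N +>\<^bsub>M\<^esub> x) \<ominus>\<^bsub>quotient_module R M N\<^esub> (N +>\<^bsub>M\<^esub> y)"
    by (rule mod_hom_minus[OF M Q hom x y])
  also have "\<dots> = \<zero>\<^bsub>quotient_module R M N\<^esub>"
    unfolding e using mod_homD(1)[OF hom y] by (simp add: Q.M.minus_eq Q.M.r_neg)
  finally show "x \<ominus>\<^bsub>M\<^esub> y \<in> N" using zero[of "x \<ominus>\<^bsub>M\<^esub> y"] x y by simp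
qed

section \<open>Frobenius\<close>

lemma (in cring) binomial_ring:
  assumes x: "x \<in> carrier R" and y: "y \<in> carrier R"
  shows "(x \<oplus> y) [^] n = (\<Oplus>k\<in>{..n}. [(n choose k)] \<cdot> (x [^] k \<otimes> y [^] (n - k)))"
proof (induction n)
  case 0
  then show ?case using x y by simp
next
  case (Suc n)
  define t where "t c i j = [(c::nat)] \<cdot> (x [^] (i::nat) \<otimes> y [^] (j::nat))" for c i j
  have tc: "t c i j \<in> carrier R" for c i j using x y by (simp add: t_def)
  have "x [^] i \<otimes> y [^] j \<otimes> x = x [^] Suc i \<otimes> y [^] j" for i j :: nat
    using x y by (simp add: m_ac)
  then have tx: "t c i j \<otimes> x = t c (Suc i) j" for c i j
    using x y by (simp add: t_def add_pow_ldistr del: nat_pow_Suc)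
  have "x [^] i \<otimes> y [^] j \<otimes> y = x [^] i \<otimes> y [^] Suc j" for i j :: nat
    using x y by (simp add: m_ac)
  then have ty: "t c i j \<otimes> y = t c i (Suc j)" for c i j
    using x y by (simp add: t_def add_pow_ldistr del: nat_pow_Suc)
  have tz: "t 0 i j = \<zero>" for i j by (simp add: t_def)
  have ta: "t c i j \<oplus> t c' i j = t (c + c') i j" for c c' i j
    using x y by (simp add: t_def add.nat_pow_mult)
  have IH: "(x \<oplus> y) [^] n = (\<Oplus>k\<in>{..n}. t (n choose k) k (n - k))"
    using Suc.IH by (simp add: t_def)
  have "(x \<oplus> y) [^] Suc n = (x \<oplus> y) [^] n \<otimes> x \<oplus> (x \<oplus> y) [^] n \<otimes> y"
    using x y by (simp add: r_distr)
  also have "(x \<oplus> y) [^] n \<otimes> x = (\<Oplus>k\<in>{..n}. t (n choose k) (Suc k) (n - k))"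
    unfolding IH using x tc by (subst finsum_ldistr) (auto simp: tx)
  also have "(x \<oplus> y) [^] n \<otimes> y = (\<Oplus>k\<in>{..n}. t (n choose k) k (Suc n - k))"
    unfolding IH using y tc
    by (subst finsum_ldistr) (auto simp: ty Suc_diff_le intro!: finsum_cong')
  \<comment> \<open>The added summand has coefficient \<open>n choose Suc n\<close>, which is 0.
    Splitting off the summand at 0 afterwards aligns both sums for Pascal's rule.\<close>
  also have "(\<Oplus>k\<in>{..n}. t (n choose k) k (Suc n - k)) = (\<Oplus>k\<in>{..Suc n}. t (n choose k) k (Suc n - k))"
    using tc by (subst finsum_Suc) (auto simp: tz binomial_eq_0)
  also have "\<dots> = (\<Oplus>k\<in>{..n}. t (n choose Suc k) (Suc k) (n - k)) \<oplus> t 1 0 (Suc n)"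
    using tc by (subst finsum_Suc2) auto
  also have "(\<Oplus>k\<in>{..n}. t (n choose k) (Suc k) (n - k)) \<oplus>
      ((\<Oplus>k\<in>{..n}. t (n choose Suc k) (Suc k) (n - k)) \<oplus> t 1 0 (Suc n))
      = (\<Oplus>k\<in>{..n}. t (n choose k) (Suc k) (n - k) \<oplus> t (n choose Suc k) (Suc k) (n - k)) \<oplus> t 1 0 (Suc n)"
    using tc by (subst finsum_addf) (auto simp: a_assoc)
  also have "\<dots> = (\<Oplus>k\<in>{..Suc n}. t (Suc n choose k) k (Suc n - k))"
    using tc by (subst finsum_Suc2) (auto simp: ta)
  finally show ?case by (simp only: t_def)
qed

text \<open>This makes \<open>x \<mapsto> x^q\<close> a ring endomorphism, multiplicativity being
  automatic in a commutative ring. Apart from \<open>1 < p\<close>, it is all that the later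
  arguments retain of the characteristic.\<close>

definition additive_power :: "('a, 'm) ring_scheme \<Rightarrow> nat \<Rightarrow> bool" where
  "additive_power R q \<longleftrightarrow> 0 < q \<and>
     (\<forall>x\<in>carrier R. \<forall>y\<in>carrier R. (x \<oplus>\<^bsub>R\<^esub> y) [^]\<^bsub>R\<^esub> q = x [^]\<^bsub>R\<^esub> q \<oplus>\<^bsub>R\<^esub> y [^]\<^bsub>R\<^esub> q)"

text \<open>The binomial coefficients strictly between the two ends are divisible by
  \<open>p\<close>, hence zero in \<open>R\<close>.\<close>

lemma (in cring) additive_power_char:
  assumes p: "Factorial_Ring.prime p" and c: "ring_char R = p"
  shows "additive_power R p"
  unfolding additive_power_def
proof (intro conjI ballI)
  show p0: "0 < p" using prime_gt_0_nat[OF p] .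
  fix x y assume x: "x \<in> carrier R" and y: "y \<in> carrier R"
  let ?t = "\<lambda>k. [(p choose k)] \<cdot> (x [^] k \<otimes> y [^] (p - k))"
  have tc: "?t k \<in> carrier R" for k using x y by simp
  have "?t k = \<zero>" if "k \<noteq> 0" "k < p" for k
  proof -
    have "p dvd (p choose k)" by (rule dvd_choose_prime) (use that p in auto)
    then have "[(p choose k)] \<cdot> \<one> = \<zero>" using ring_char_dvd[OF ring_axioms] c by simp
    then have "([(p choose k)] \<cdot> \<one>) \<otimes> (x [^] k \<otimes> y [^] (p - k)) = \<zero>" using x y by simp
    then show ?thesis using x y by (simp add: add_pow_ldistr)
  qed
  then have "(\<Oplus>k\<in>{..p}. ?t k) = (\<Oplus>k\<in>{0, p}. ?t k)"
    using tc by (intro add.finprod_mono_neutral_cong_right) auto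
  also have "\<dots> = y [^] p \<oplus> x [^] p"
    using p0 x y tc by (subst finsum_insert) auto
  finally show "(x \<oplus> y) [^] p = x [^] p \<oplus> y [^] p"
    using x y by (simp add: binomial_ring[OF x y] a_comm)
qed

lemma (in cring) additive_power_mult:
  assumes "additive_power R q" "additive_power R q'"
  shows "additive_power R (q * q')"
proof -
  have "(x \<oplus> y) [^] (q * q') = x [^] (q * q') \<oplus> y [^] (q * q')"
    if x: "x \<in> carrier R" and y: "y \<in> carrier R" for x y
    using assms x y by (simp add: additive_power_def nat_pow_pow[symmetric])
  then show ?thesis using assms by (simp add: additive_power_def)
qed

lemma (in cring) additive_power_power:
  assumes "additive_power R q"
  shows "additive_power R (q ^ e)"
proof (induction e)
  case 0 then show ?case by (simp add: additive_power_def)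
qed (simp add: additive_power_mult[OF assms])

definition frob_vec :: "('a, 'm) ring_scheme \<Rightarrow> nat \<Rightarrow> (nat \<Rightarrow> 'a) \<Rightarrow> nat \<Rightarrow> 'a" where
  "frob_vec R q v = (\<lambda>i. v i [^]\<^bsub>R\<^esub> q)"

text \<open>The base change of a matrix along the \<open>q\<close>-th power map; \<open>n\<close> is the number of rows.\<close>

definition frob_map ::
    "('a, 'm) ring_scheme \<Rightarrow> nat \<Rightarrow> nat \<Rightarrow> ((nat \<Rightarrow> 'a) \<Rightarrow> nat \<Rightarrow> 'a) \<Rightarrow> (nat \<Rightarrow> 'a) \<Rightarrow> nat \<Rightarrow> 'a" where
  "frob_map R q n f = lin_ext R (FM R n) (\<lambda>b. frob_vec R q (f (unit_vec R b)))"

section \<open>Frobenius pullback of vectors and matrices\<close>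

context cring
begin

lemma frob_vec_closed:
  assumes "0 < q" "v \<in> carrier (FM R n)"
  shows "frob_vec R q v \<in> carrier (FM R n)"
  using assms by (auto simp: FM_carrier_iff frob_vec_def nat_pow_zero)

lemma frob_vec_add:
  assumes "additive_power R q" "v \<in> carrier (FM R n)" "w \<in> carrier (FM R n)"
  shows "frob_vec R q (v \<oplus>\<^bsub>FM R n\<^esub> w) = frob_vec R q v \<oplus>\<^bsub>FM R n\<^esub> frob_vec R q w"
  using assms by (auto simp: FM_carrier_iff frob_vec_def additive_power_def)

lemma frob_vec_smult:
  assumes "a \<in> carrier R" "v \<in> carrier (FM R n)"
  shows "frob_vec R q (a \<odot>\<^bsub>FM R n\<^esub> v) = (a [^] q) \<odot>\<^bsub>FM R n\<^esub> frob_vec R q v"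
  using assms by (auto simp: FM_carrier_iff frob_vec_def nat_pow_distrib)

lemma frob_vec_unit: "0 < q \<Longrightarrow> frob_vec R q (unit_vec R b) = unit_vec R b"
  by (auto simp: frob_vec_def unit_vec_def nat_pow_zero)

lemma frob_vec_zero: "0 < q \<Longrightarrow> frob_vec R q \<zero>\<^bsub>FM R n\<^esub> = \<zero>\<^bsub>FM R n\<^esub>"
  by (auto simp: frob_vec_def nat_pow_zero)

text \<open>The map \<open>frob_vec\<close> is only semilinear, so \<open>preimage_submodule\<close>
  does not cover it; the twisted scalars \<open>a^q\<close> are harmless because \<open>K\<close>
  absorbs every scalar. Divisibility of Frobenius images can thus be checked on generators.\<close>

lemma frob_vec_preimage_submodule:
  assumes q: "additive_power R q" and K: "submodule K R (FM R n)"
  shows "submodule {v \<in> carrier (FM R n). frob_vec R q v \<in> K} R (FM R n)"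
proof -
  interpret F: module R "FM R n" by (rule FM_module)
  have q0: "0 < q" using q by (simp add: additive_power_def)
  note K = submoduleD[OF K]
  show ?thesis
  proof (rule F.submoduleI')
    show "\<zero>\<^bsub>FM R n\<^esub> \<in> {v \<in> carrier (FM R n). frob_vec R q v \<in> K}"
      using K(2) F.M.zero_closed frob_vec_zero[OF q0, of n] by simp
  next
    fix v w assume "v \<in> {v \<in> carrier (FM R n). frob_vec R q v \<in> K}" "w \<in> {v \<in> carrier (FM R n). frob_vec R q v \<in> K}"
    then show "v \<oplus>\<^bsub>FM R n\<^esub> w \<in> {v \<in> carrier (FM R n). frob_vec R q v \<in> K}"
      using K(3)[of "frob_vec R q v" "frob_vec R q w"] frob_vec_add[OF q, of v n w] F.M.a_closed[of v w]
      by (simp del: free_module_simps)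
  next
    fix a v assume "a \<in> carrier R" "v \<in> {v \<in> carrier (FM R n). frob_vec R q v \<in> K}"
    then show "a \<odot>\<^bsub>FM R n\<^esub> v \<in> {v \<in> carrier (FM R n). frob_vec R q v \<in> K}"
      using K(5)[of "a [^] q" "frob_vec R q v"] frob_vec_smult[of a v n q] F.smult_closed[of a v]
      by (simp del: free_module_simps)
  qed auto
qed

lemma frob_map_hom:
  assumes q: "0 < q" and f: "f \<in> mod_hom R (FM R k) (FM R n)"
  shows "frob_map R q n f \<in> mod_hom R (FM R k) (FM R n)"
  unfolding frob_map_def
  by (rule lin_ext_hom[OF FM_module])
    (auto intro!: frob_vec_closed[OF q] mod_homD(1)[OF f] unit_vec_carrier)

lemma frob_map_unit:
  assumes q: "0 < q" and f: "f \<in> mod_hom R (FM R k) (FM R n)" and b: "b < k"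
  shows "frob_map R q n f (unit_vec R b) = frob_vec R q (f (unit_vec R b))"
  unfolding frob_map_def
  by (rule lin_ext_unit_vec[OF FM_module, of _ "{..<k}"])
    (use b in \<open>auto intro!: frob_vec_closed[OF q] mod_homD(1)[OF f] unit_vec_carrier\<close>)

lemma frob_map_eqI:
  assumes q: "0 < q" and f: "f \<in> mod_hom R (FM R k) (FM R n)" and g: "g \<in> mod_hom R (FM R k) (FM R n)"
    and eq: "\<And>b. b < k \<Longrightarrow> g (unit_vec R b) = frob_vec R q (f (unit_vec R b))"
    and v: "v \<in> carrier (FM R k)"
  shows "frob_map R q n f v = g v"
  by (rule FM_hom_eqI[OF FM_module frob_map_hom[OF q f] g _ v]) (simp add: frob_map_unit[OF q f] eq)

text \<open>Both sides are additive in \<open>v\<close> and scale by \<open>a^q\<close> when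
  \<open>v\<close> is scaled by \<open>a\<close>, so they agree on a submodule, and it contains the
  basis. Functoriality of \<open>frob_map\<close> follows from this naturality.\<close>

lemma frob_map_vec:
  assumes q: "additive_power R q" and f: "f \<in> mod_hom R (FM R k) (FM R n)" and v: "v \<in> carrier (FM R k)"
  shows "frob_map R q n f (frob_vec R q v) = frob_vec R q (f v)"
proof -
  have q0: "0 < q" using q by (simp add: additive_power_def)
  note h = frob_map_hom[OF q0 f]
  interpret F: module R "FM R k" by (rule FM_module)
  let ?S = "{v \<in> carrier (FM R k). frob_map R q n f (frob_vec R q v) = frob_vec R q (f v)}"
  have "?S = carrier (FM R k)"
  proof (rule FM_unit_vec_generate)
    show "submodule ?S R (FM R k)"
    proof (rule F.submoduleI')
      have "frob_map R q n f (frob_vec R q \<zero>\<^bsub>FM R k\<^esub>) = frob_vec R q (f \<zero>\<^bsub>FM R k\<^esub>)"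
        unfolding frob_vec_zero[OF q0] mod_hom_zero[OF FM_module FM_module h] mod_hom_zero[OF FM_module FM_module f] ..
      then show "\<zero>\<^bsub>FM R k\<^esub> \<in> ?S" using F.M.zero_closed by blast
    next
      fix v w assume "v \<in> ?S" "w \<in> ?S"
      then have v: "v \<in> carrier (FM R k)" "frob_map R q n f (frob_vec R q v) = frob_vec R q (f v)"
        and w: "w \<in> carrier (FM R k)" "frob_map R q n f (frob_vec R q w) = frob_vec R q (f w)" by auto
      have "frob_map R q n f (frob_vec R q (v \<oplus>\<^bsub>FM R k\<^esub> w)) = frob_vec R q (f (v \<oplus>\<^bsub>FM R k\<^esub> w))"
        unfolding frob_vec_add[OF q v(1) w(1)] mod_homD(2)[OF f v(1) w(1)]
          mod_homD(2)[OF h frob_vec_closed[OF q0 v(1)] frob_vec_closed[OF q0 w(1)]] v(2) w(2)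
          frob_vec_add[OF q mod_homD(1)[OF f v(1)] mod_homD(1)[OF f w(1)]] ..
      then show "v \<oplus>\<^bsub>FM R k\<^esub> w \<in> ?S" using F.M.a_closed[OF v(1) w(1)] by blast
    next
      fix a v assume a: "a \<in> carrier R" and "v \<in> ?S"
      then have v: "v \<in> carrier (FM R k)" "frob_map R q n f (frob_vec R q v) = frob_vec R q (f v)" by auto
      have "frob_map R q n f (frob_vec R q (a \<odot>\<^bsub>FM R k\<^esub> v)) = frob_vec R q (f (a \<odot>\<^bsub>FM R k\<^esub> v))"
        unfolding frob_vec_smult[OF a v(1)] mod_homD(3)[OF f a v(1)]
          mod_homD(3)[OF h nat_pow_closed[OF a] frob_vec_closed[OF q0 v(1)]] v(2)
          frob_vec_smult[OF a mod_homD(1)[OF f v(1)]] ..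
      then show "a \<odot>\<^bsub>FM R k\<^esub> v \<in> ?S" using F.smult_closed[OF a v(1)] by blast
    qed auto
    show "unit_vec R b \<in> ?S" if "b < k" for b
      using that by (simp add: frob_vec_unit[OF q0] frob_map_unit[OF q0 f] unit_vec_carrier)
  qed
  then show ?thesis using v by blast
qed

lemma frob_map_comp:
  assumes q: "additive_power R q" and f: "f \<in> mod_hom R (FM R n) (FM R m)"
    and g: "g \<in> mod_hom R (FM R k) (FM R n)" and v: "v \<in> carrier (FM R k)"
  shows "frob_map R q m (\<lambda>x. f (g x)) v = frob_map R q m f (frob_map R q n g v)"
proof -
  have q0: "0 < q" using q by (simp add: additive_power_def)
  show ?thesis
  proof (rule frob_map_eqI[OF q0 mod_hom_comp[OF g f] mod_hom_comp[OF frob_map_hom[OF q0 g] frob_map_hom[OF q0 f]] _ v])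
    fix b assume b: "b < k"
    then have "g (unit_vec R b) \<in> carrier (FM R n)" by (auto intro!: mod_homD(1)[OF g] unit_vec_carrier)
    then show "frob_map R q m f (frob_map R q n g (unit_vec R b)) = frob_vec R q (f (g (unit_vec R b)))"
      by (simp add: frob_map_unit[OF q0 g b] frob_map_vec[OF q f])
  qed
qed

lemma frob_map_cong:
  assumes "\<And>b. b < k \<Longrightarrow> f (unit_vec R b) = g (unit_vec R b)" and q: "0 < q"
    and f: "f \<in> mod_hom R (FM R k) (FM R n)" and g: "g \<in> mod_hom R (FM R k) (FM R n)"
    and v: "v \<in> carrier (FM R k)"
  shows "frob_map R q n f v = frob_map R q n g v"
  by (rule frob_map_eqI[OF q f frob_map_hom[OF q g] _ v]) (simp add: frob_map_unit[OF q g] assms(1))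

lemma frob_map_add:
  assumes q: "additive_power R q" and f: "f \<in> mod_hom R (FM R k) (FM R n)"
    and g: "g \<in> mod_hom R (FM R k) (FM R n)" and v: "v \<in> carrier (FM R k)"
  shows "frob_map R q n (\<lambda>x. f x \<oplus>\<^bsub>FM R n\<^esub> g x) v = frob_map R q n f v \<oplus>\<^bsub>FM R n\<^esub> frob_map R q n g v"
proof -
  have q0: "0 < q" using q by (simp add: additive_power_def)
  show ?thesis
  proof (rule frob_map_eqI[OF q0 mod_hom_add[OF FM_module f g] mod_hom_add[OF FM_module frob_map_hom[OF q0 f] frob_map_hom[OF q0 g]] _ v])
    fix b assume b: "b < k"
    then have u: "unit_vec R b \<in> carrier (FM R k)" by (auto intro: unit_vec_carrier)
    show "frob_map R q n f (unit_vec R b) \<oplus>\<^bsub>FM R n\<^esub> frob_map R q n g (unit_vec R b)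
        = frob_vec R q (f (unit_vec R b) \<oplus>\<^bsub>FM R n\<^esub> g (unit_vec R b))"
      unfolding frob_map_unit[OF q0 f b] frob_map_unit[OF q0 g b]
        frob_vec_add[OF q mod_homD(1)[OF f u] mod_homD(1)[OF g u]] ..
  qed
qed

lemma frob_map_smult:
  assumes q: "0 < q" and a: "a \<in> carrier R" and v: "v \<in> carrier (FM R n)"
  shows "frob_map R q n (\<lambda>x. a \<odot>\<^bsub>FM R n\<^esub> x) v = (a [^] q) \<odot>\<^bsub>FM R n\<^esub> v"
proof -
  have id: "(\<lambda>x. x) \<in> mod_hom R (FM R n) (FM R n)" by (simp add: mod_hom_def)
  show ?thesis
  proof (rule frob_map_eqI[OF q mod_hom_smult[OF FM_module id a] mod_hom_smult[OF FM_module id nat_pow_closed[OF a]] _ v])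
    fix b assume b: "b < n"
    then have u: "unit_vec R b \<in> carrier (FM R n)" by (auto intro: unit_vec_carrier)
    show "(a [^] q) \<odot>\<^bsub>FM R n\<^esub> unit_vec R b = frob_vec R q (a \<odot>\<^bsub>FM R n\<^esub> unit_vec R b)"
      unfolding frob_vec_smult[OF a u] frob_vec_unit[OF q] ..
  qed
qed

lemma frob_map_frob_map:
  assumes q: "0 < q" and q': "0 < q'" and f: "f \<in> mod_hom R (FM R k) (FM R n)" and v: "v \<in> carrier (FM R k)"
  shows "frob_map R q' n (frob_map R q n f) v = frob_map R (q * q') n f v"
proof (rule frob_map_eqI[OF q' frob_map_hom[OF q f] frob_map_hom[OF _ f] _ v])
  show qq: "0 < q * q'" using q q' by simp
  fix b assume b: "b < k"
  then have "f (unit_vec R b) \<in> carrier (FM R n)" by (auto intro!: mod_homD(1)[OF f] unit_vec_carrier)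
  then show "frob_map R (q * q') n f (unit_vec R b) = frob_vec R q' (frob_map R q n f (unit_vec R b))"
    by (simp add: frob_map_unit[OF q f b] frob_map_unit[OF qq f b] frob_vec_def nat_pow_pow FM_carrier_iff)
qed

text \<open>A generator \<open>t^N x\<close> goes to \<open>t^(N * q)\<close> times the Frobenius
  image of \<open>x\<close>, and \<open>frob_vec_preimage_submodule\<close> extends this to the
  span.\<close>

lemma frob_vec_power_span:
  assumes q: "additive_power R q" and X: "X \<subseteq> carrier R"
    and v: "v \<in> power_span R (FM R n) X N (carrier (FM R n))"
  shows "frob_vec R q v \<in> power_span R (FM R n) X (N * q) (carrier (FM R n))"
proof -
  have q0: "0 < q" using q by (simp add: additive_power_def)
  let ?K = "power_span R (FM R n) X (N * q) (carrier (FM R n))"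
  have K: "submodule ?K R (FM R n)" by (rule power_span_submodule[OF FM_module X order_refl])
  have "power_span R (FM R n) X N (carrier (FM R n)) \<subseteq> {v \<in> carrier (FM R n). frob_vec R q v \<in> ?K}"
  proof (rule power_span_least[OF frob_vec_preimage_submodule[OF q K]])
    fix t x assume t: "t \<in> X" and x: "x \<in> carrier (FM R n)"
    then have tN: "t [^] N \<in> carrier R" and tR: "t \<in> carrier R" using X by auto
    have "frob_vec R q ((t [^] N) \<odot>\<^bsub>FM R n\<^esub> x) = (t [^] (N * q)) \<odot>\<^bsub>FM R n\<^esub> frob_vec R q x"
      unfolding frob_vec_smult[OF tN x] nat_pow_pow[OF tR] ..
    then have "frob_vec R q ((t [^] N) \<odot>\<^bsub>FM R n\<^esub> x) \<in> ?K"
      using power_span_memI[OF t frob_vec_closed[OF q0 x]] by metis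
    then show "(t [^] N) \<odot>\<^bsub>FM R n\<^esub> x \<in> {v \<in> carrier (FM R n). frob_vec R q v \<in> ?K}"
      using module.smult_closed[OF FM_module tN x] by blast
  qed
  then show ?thesis using v by blast
qed

end

section \<open>Finite projective dimension\<close>

text \<open>An infimum in \<open>enat\<close> is attained unless the set is empty; then it is
  infinite, which the bound by \<open>k\<close> excludes.\<close>

lemma projective_dimension_less_obtain:
  fixes M :: "('a, 'b) module" and R :: "('a, 'm) ring_scheme"
  assumes "projective_dimension R M < enat k"
  obtains m and F :: "('a, nat \<times> 'a \<times> 'b \<Rightarrow> 'a) cplx" and \<epsilon>
    where "projective_dimension R M = enat m" "m < k" "projective_resolution R M m F \<epsilon>"
proof -
  let ?A = "{enat n | n. \<exists>(F :: ('a, nat \<times> 'a \<times> 'b \<Rightarrow> 'a) cplx) \<epsilon>. projective_resolution R M n F \<epsilon>}"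
  have pd: "projective_dimension R M = Inf ?A" by (simp add: projective_dimension_def)
  have "?A \<noteq> {}"
  proof
    assume "?A = {}"
    then have "projective_dimension R M = Inf {}" using pd by (simp only:)
    then show False using assms by (simp add: Inf_enat_def)
  qed
  then have "Inf ?A \<in> ?A" by (metis (no_types, lifting) Inf_enat_def LeastI_ex ex_in_conv)
  then show thesis using that assms pd by auto
qed

text \<open>The comparison maps between \<open>G\<close> and \<open>g\<close> copies of a resolution of length \<open>m\<close>, one for each
  coordinate, compose to an endomorphism of \<open>G\<close> that is homotopic to the identity and vanishes above
  degree \<open>m\<close>.\<close>

lemma (in noetherian_cring) resolution_split:
  fixes F :: "('a, 'c) cplx"
  assumes I: "ideal I R"
    and res: "projective_resolution R (quotient_module R (regular_module R) I) m F \<epsilon>"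
    and r0: "r 0 = g" and D: "\<And>j. D j \<in> mod_hom R (FM R (r (Suc j))) (FM R (r j))"
    and im0: "D 0 ` carrier (FM R (r (Suc 0))) = {v \<in> carrier (FM R g). \<forall>i. v i \<in> I}"
    and im: "\<And>j. D (Suc j) ` carrier (FM R (r (Suc (Suc j)))) =
      {x \<in> carrier (FM R (r (Suc j))). D j x = \<zero>\<^bsub>FM R (r j)\<^esub>}"
  obtains h where "h \<in> mod_hom R (FM R (r m)) (FM R (r (Suc m)))"
    "\<And>x. x \<in> carrier (FM R (r (Suc m))) \<Longrightarrow> D m (h (D m x)) = D m x"
proof -
  interpret I: ideal I R by (rule I)
  let ?Reg = "regular_module R" and ?Q = "quotient_module R (regular_module R) I"
  note Reg = regular_module_module
  have Isub: "submodule I R ?Reg" using I by (simp add: submodule_regular_iff)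
  note proj = quotient_proj[OF Reg Isub]
  have Q: "module R ?Q" by (rule quotient_module_module[OF Reg Isub])
  let ?\<pi> = "\<lambda>x. I +>\<^bsub>?Reg\<^esub> x"
  let ?G = "\<lambda>j. FM R (r j)"
  note Gm = FM_module
  have Greg: "projective_module R (?G j)" for j by (rule FM_projective)
  have DD: "D j (D (Suc j) x) = \<zero>\<^bsub>?G j\<^esub>" if "x \<in> carrier (?G (Suc (Suc j)))" for j x
    using im[of j] imageI[OF that, of "D (Suc j)"] by simp
  have Dex: "x \<in> D (Suc j) ` carrier (?G (Suc (Suc j)))"
    if "x \<in> carrier (?G (Suc j))" "D j x = \<zero>\<^bsub>?G j\<^esub>" for j x
    using im[of j] that by simp
  \<comment> \<open>The finite resolution is reindexed by naturals, so that \<open>dX j\<close>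
    leaves degree \<open>Suc j\<close> as \<open>D j\<close> does.\<close>
  define X where "X j = obj F (int j)" for j
  define dX where "dX j = bdry F (int (Suc j))" for j
  have int1: "int (Suc j) - 1 = int j" for j by simp
  have int2: "int (Suc j) + 1 = int (Suc (Suc j))" for j by simp
  have cF: "chain_complex R F" and conc: "concentrated m F" and pF: "projective_module R (obj F i)"
    and \<epsilon>: "\<epsilon> \<in> mod_hom R (obj F 0) ?Q" "\<epsilon> ` carrier (obj F 0) = carrier ?Q"
    and ker\<epsilon>: "a_kernel (obj F 0) ?Q \<epsilon> = boundaries F 0"
    and exF: "i > 0 \<Longrightarrow> cycles F i = boundaries F i" for i
    using res by (simp_all add: projective_resolution_def)
  have Xp: "projective_module R (X j)" for j by (simp add: X_def pF)
  have Xm: "module R (X j)" for j using Xp by (simp add: projective_module_def)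
  have bF: "bdry F n \<in> mod_hom R (obj F n) (obj F (n - 1))"
    "x \<in> carrier (obj F n) \<Longrightarrow> bdry F (n - 1) (bdry F n x) = \<zero>\<^bsub>obj F (n - 1 - 1)\<^esub>" for n x
    using cF by (simp_all add: chain_complex_def)
  have dX: "dX j \<in> mod_hom R (X (Suc j)) (X j)" for j
    using bF(1)[of "int (Suc j)"] unfolding int1 X_def dX_def .
  have dX0: "dX j (dX (Suc j) x) = \<zero>\<^bsub>X j\<^esub>" if "x \<in> carrier (X (Suc (Suc j)))" for j x
    using bF(2)[of x "int (Suc (Suc j))"] that unfolding int1 X_def dX_def by simp
  have Xex: "x \<in> dX (Suc j) ` carrier (X (Suc (Suc j)))"
    if "x \<in> carrier (X (Suc j))" "dX j x = \<zero>\<^bsub>X j\<^esub>" for j x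
  proof -
    have "x \<in> cycles F (int (Suc j))"
      unfolding cycles_def a_kernel_def' int1 using that unfolding X_def dX_def by simp
    also have "\<dots> = boundaries F (int (Suc j))" by (rule exF) simp
    finally show ?thesis unfolding boundaries_def int2 X_def dX_def .
  qed
  have \<epsilon>h: "\<epsilon> \<in> mod_hom R (X 0) ?Q" using \<epsilon>(1) by (simp add: X_def)
  have \<epsilon>s: "\<epsilon> ` carrier (X 0) = carrier ?Q" using \<epsilon>(2) by (simp add: X_def)
  have \<epsilon>k: "x \<in> dX 0 ` carrier (X (Suc 0)) \<longleftrightarrow> \<epsilon> x = \<zero>\<^bsub>?Q\<^esub>" if "x \<in> carrier (X 0)" for x
  proof -
    have "x \<in> a_kernel (obj F 0) ?Q \<epsilon> \<longleftrightarrow> \<epsilon> x = \<zero>\<^bsub>?Q\<^esub>"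
      using that by (simp add: X_def a_kernel_def')
    then show ?thesis unfolding ker\<epsilon> boundaries_def X_def dX_def by simp
  qed
  have Xtop: "carrier (X (Suc m)) = {\<zero>\<^bsub>X (Suc m)\<^esub>}"
    using conc by (simp add: X_def concentrated_def)
  \<comment> \<open>Projectivity of \<open>X 0\<close> lifts the augmentation from
    \<open>R/I\<close> to \<open>R\<close>. From \<open>\<tau>\<close> comes the degree 0 part of
    the comparison back to \<open>G\<close>.\<close>
  obtain \<tau> where \<tau>: "\<tau> \<in> mod_hom R (X 0) ?Reg" "\<And>y. y \<in> carrier (X 0) \<Longrightarrow> ?\<pi> (\<tau> y) = \<epsilon> y"
    using projective_module_lift[OF Xp Reg Q proj(1,2) \<epsilon>h] by metis

  \<comment> \<open>For a coordinate \<open>a\<close>, the endomorphism of \<open>G\<close> that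
    goes to \<open>X\<close> and back. In degree 0 it is the projection to that coordinate modulo
    \<open>I\<close>, and it vanishes in degree \<open>Suc m\<close>, where \<open>X\<close> is
    zero.\<close>
  have coord: "\<exists>c. (\<forall>j. c j \<in> mod_hom R (?G j) (?G j)) \<and>
      (\<forall>j. \<forall>x\<in>carrier (?G (Suc j)). D j (c (Suc j) x) = c j (D j x)) \<and>
      (\<forall>x\<in>carrier (?G (Suc m)). c (Suc m) x = \<zero>\<^bsub>?G (Suc m)\<^esub>) \<and>
      (\<forall>v\<in>carrier (?G 0). \<forall>i. c 0 v i \<ominus> (if i = a then v i else \<zero>) \<in> I)" if a: "a < g" for a
  proof -
    have pa: "(\<lambda>v. ?\<pi> (v a)) \<in> mod_hom R (?G 0) ?Q"
      by (rule mod_hom_comp[OF coordinate_hom proj(1)])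
    obtain \<alpha>0 where \<alpha>0: "\<alpha>0 \<in> mod_hom R (?G 0) (X 0)"
      "\<And>v. v \<in> carrier (?G 0) \<Longrightarrow> \<epsilon> (\<alpha>0 v) = ?\<pi> (v a)"
      using projective_module_lift[OF Greg Xm Q \<epsilon>h \<epsilon>s pa] by metis
    have "\<alpha>0 (D 0 x) \<in> dX 0 ` carrier (X (Suc 0))" if x: "x \<in> carrier (?G (Suc 0))" for x
    proof -
      have Dx: "D 0 x \<in> carrier (?G 0)" by (rule mod_homD(1)[OF D x])
      have "D 0 x a \<in> I" using im0 imageI[OF x, of "D 0"] by simp
      moreover have "D 0 x a \<in> carrier ?Reg" using Dx by (simp add: FM_carrier_iff)
      ultimately have "\<epsilon> (\<alpha>0 (D 0 x)) = \<zero>\<^bsub>?Q\<^esub>" using \<alpha>0(2)[OF Dx] proj(3) by simp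
      then show ?thesis using \<epsilon>k[OF mod_homD(1)[OF \<alpha>0(1) Dx]] by simp
    qed
    from chain_lift[where P = ?G and dP = D and X = X and dX = dX and \<phi> = \<alpha>0, OF Greg D DD Xm dX Xex \<alpha>0(1) this]
    obtain \<alpha> where \<alpha>: "\<alpha> 0 = \<alpha>0" "\<And>j. \<alpha> j \<in> mod_hom R (?G j) (X j)"
      "\<And>j x. x \<in> carrier (?G (Suc j)) \<Longrightarrow> dX j (\<alpha> (Suc j) x) = \<alpha> j (D j x)" by blast
    define \<beta>0 where "\<beta>0 y = (\<lambda>i. if i = a then \<tau> y else \<zero>)" for y
    have \<tau>c: "\<tau> y \<in> carrier R" if "y \<in> carrier (X 0)" for y using mod_homD(1)[OF \<tau>(1) that] by simp
    have \<beta>0: "\<beta>0 \<in> mod_hom R (X 0) (?G 0)"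
    proof (rule mod_homI)
      show "\<beta>0 y \<in> carrier (?G 0)" if "y \<in> carrier (X 0)" for y
        using \<tau>c[OF that] a r0 by (auto simp: \<beta>0_def FM_carrier_iff)
    qed (auto simp: \<beta>0_def mod_homD(2,3)[OF \<tau>(1)])
    have "\<beta>0 (dX 0 y) \<in> D 0 ` carrier (?G (Suc 0))" if y: "y \<in> carrier (X (Suc 0))" for y
    proof -
      have dy: "dX 0 y \<in> carrier (X 0)" by (rule mod_homD(1)[OF dX y])
      have "\<epsilon> (dX 0 y) = \<zero>\<^bsub>?Q\<^esub>" using \<epsilon>k[OF dy] y by blast
      then have "\<tau> (dX 0 y) \<in> I" using \<tau>(2)[OF dy] proj(3)[of "\<tau> (dX 0 y)"] \<tau>c[OF dy] by simp
      then have "\<forall>i. \<beta>0 (dX 0 y) i \<in> I" by (simp add: \<beta>0_def)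
      then show ?thesis unfolding im0 using mod_homD(1)[OF \<beta>0 dy] r0 by simp
    qed
    from chain_lift[where P = X and dP = dX and X = ?G and dX = D and \<phi> = \<beta>0, OF Xp dX dX0 Gm D Dex \<beta>0 this]
    obtain \<beta> where \<beta>: "\<beta> 0 = \<beta>0" "\<And>j. \<beta> j \<in> mod_hom R (X j) (?G j)"
      "\<And>j x. x \<in> carrier (X (Suc j)) \<Longrightarrow> D j (\<beta> (Suc j) x) = \<beta> j (dX j x)" by blast
    let ?c = "\<lambda>j x. \<beta> j (\<alpha> j x)"
    have "?c j \<in> mod_hom R (?G j) (?G j)" for j by (rule mod_hom_comp[OF \<alpha>(2) \<beta>(2)])
    moreover have "D j (?c (Suc j) x) = ?c j (D j x)" if "x \<in> carrier (?G (Suc j))" for j x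
      using \<beta>(3)[OF mod_homD(1)[OF \<alpha>(2) that]] \<alpha>(3)[OF that] by simp
    moreover have "?c (Suc m) x = \<zero>\<^bsub>?G (Suc m)\<^esub>" if "x \<in> carrier (?G (Suc m))" for x
      using mod_homD(1)[OF \<alpha>(2) that] Xtop mod_hom_zero[OF Xm Gm \<beta>(2)] by simp
    moreover have "?c 0 v i \<ominus> (if i = a then v i else \<zero>) \<in> I" if v: "v \<in> carrier (?G 0)" for v i
    proof (cases "i = a")
      case True
      have \<alpha>v: "\<alpha>0 v \<in> carrier (X 0)" by (rule mod_homD(1)[OF \<alpha>0(1) v])
      have va: "v a \<in> carrier R" using v by (simp add: FM_carrier_iff)
      have "?\<pi> (\<tau> (\<alpha>0 v)) = ?\<pi> (v a)" using \<tau>(2)[OF \<alpha>v] \<alpha>0(2)[OF v] by simp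
      then have "\<tau> (\<alpha>0 v) \<ominus>\<^bsub>?Reg\<^esub> v a \<in> I"
        using proj(4) \<tau>c[OF \<alpha>v] va by simp
      moreover have "\<tau> (\<alpha>0 v) \<ominus>\<^bsub>?Reg\<^esub> v a = \<tau> (\<alpha>0 v) \<ominus> v a"
        unfolding a_minus_def a_inv_def by (simp add: regular_module_def m_inv_def)
      ultimately show ?thesis using True by (simp add: \<alpha>(1) \<beta>(1) \<beta>0_def)
    qed (simp add: \<alpha>(1) \<beta>(1) \<beta>0_def minus_eq I.zero_closed)
    ultimately show ?thesis by (intro exI[of _ ?c] conjI allI ballI)
  qed

  \<comment> \<open>Adding up the endomorphisms of the first \<open>k\<close> coordinates; for
    \<open>k = g\<close> the sum is congruent to the identity modulo \<open>I\<close> in degree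
    0.\<close>
  have "\<exists>c. (\<forall>j. c j \<in> mod_hom R (?G j) (?G j)) \<and>
      (\<forall>j. \<forall>x\<in>carrier (?G (Suc j)). D j (c (Suc j) x) = c j (D j x)) \<and>
      (\<forall>x\<in>carrier (?G (Suc m)). c (Suc m) x = \<zero>\<^bsub>?G (Suc m)\<^esub>) \<and>
      (\<forall>v\<in>carrier (?G 0). \<forall>i. c 0 v i \<ominus> (if i < k then v i else \<zero>) \<in> I)" if "k \<le> g" for k
    using that
  proof (induction k)
    case 0
    let ?z = "\<lambda>j x. \<zero>\<^bsub>?G j\<^esub>"
    have "?z j \<in> mod_hom R (?G j) (?G j)" for j
      by (rule mod_homI) (auto simp: FM_carrier_iff)
    moreover have "D j (?z (Suc j) x) = ?z j (D j x)" for j x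
      by (rule mod_hom_zero[OF Gm Gm D])
    moreover have "?z 0 v i \<ominus> (if i < 0 then v i else \<zero>) \<in> I" for v i
      by (simp add: minus_eq I.zero_closed)
    ultimately show ?case by (intro exI[of _ ?z] conjI allI ballI) simp_all
  next
    case (Suc k)
    then obtain c where c: "\<And>j. c j \<in> mod_hom R (?G j) (?G j)"
      "\<And>j x. x \<in> carrier (?G (Suc j)) \<Longrightarrow> D j (c (Suc j) x) = c j (D j x)"
      "\<And>x. x \<in> carrier (?G (Suc m)) \<Longrightarrow> c (Suc m) x = \<zero>\<^bsub>?G (Suc m)\<^esub>"
      "\<And>v i. v \<in> carrier (?G 0) \<Longrightarrow> c 0 v i \<ominus> (if i < k then v i else \<zero>) \<in> I"
      by (metis Suc_leD)
    obtain e where e: "\<And>j. e j \<in> mod_hom R (?G j) (?G j)"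
      "\<And>j x. x \<in> carrier (?G (Suc j)) \<Longrightarrow> D j (e (Suc j) x) = e j (D j x)"
      "\<And>x. x \<in> carrier (?G (Suc m)) \<Longrightarrow> e (Suc m) x = \<zero>\<^bsub>?G (Suc m)\<^esub>"
      "\<And>v i. v \<in> carrier (?G 0) \<Longrightarrow> e 0 v i \<ominus> (if i = k then v i else \<zero>) \<in> I"
      using coord[of k] Suc.prems by (metis Suc_le_lessD)
    let ?c = "\<lambda>j x. c j x \<oplus>\<^bsub>?G j\<^esub> e j x"
    have "?c j \<in> mod_hom R (?G j) (?G j)" for j by (rule mod_hom_add[OF Gm c(1) e(1)])
    moreover have "D j (?c (Suc j) x) = ?c j (D j x)" if x: "x \<in> carrier (?G (Suc j))" for j x
      using mod_homD(2)[OF D mod_homD(1)[OF c(1) x] mod_homD(1)[OF e(1) x]] c(2)[OF x] e(2)[OF x] by simp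
    moreover have "?c (Suc m) x = \<zero>\<^bsub>?G (Suc m)\<^esub>" if x: "x \<in> carrier (?G (Suc m))" for x
      using c(3)[OF x] e(3)[OF x] by simp
    moreover have "?c 0 v i \<ominus> (if i < Suc k then v i else \<zero>) \<in> I" if v: "v \<in> carrier (?G 0)" for v i
    proof -
      have cl: "c 0 v i \<in> carrier R" "e 0 v i \<in> carrier R" "v i \<in> carrier R"
        using mod_homD(1)[OF c(1) v] mod_homD(1)[OF e(1) v] v by (simp_all add: FM_carrier_iff)
      have "(c 0 v i \<ominus> (if i < k then v i else \<zero>)) \<oplus> (e 0 v i \<ominus> (if i = k then v i else \<zero>)) \<in> I"
        by (rule I.a_closed[OF c(4)[OF v] e(4)[OF v]])
      also have "(c 0 v i \<ominus> (if i < k then v i else \<zero>)) \<oplus> (e 0 v i \<ominus> (if i = k then v i else \<zero>))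
          = ?c 0 v i \<ominus> (if i < Suc k then v i else \<zero>)"
        using cl by (cases "i < k"; cases "i = k") (simp_all add: minus_eq a_ac)
      finally show ?thesis .
    qed
    ultimately show ?case by (intro exI[of _ ?c] conjI allI ballI)
  qed
  from this[OF order_refl] obtain c where c: "\<And>j. c j \<in> mod_hom R (?G j) (?G j)"
    "\<And>j x. x \<in> carrier (?G (Suc j)) \<Longrightarrow> D j (c (Suc j) x) = c j (D j x)"
    "\<And>x. x \<in> carrier (?G (Suc m)) \<Longrightarrow> c (Suc m) x = \<zero>\<^bsub>?G (Suc m)\<^esub>"
    "\<And>v i. v \<in> carrier (?G 0) \<Longrightarrow> c 0 v i \<ominus> (if i < g then v i else \<zero>) \<in> I"
    by metis
  \<comment> \<open>In degree 0, \<open>1 - c\<close> has all coordinates in \<open>I\<close>, so it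
    lands in the image of \<open>D 0\<close> and \<open>chain_homotopy\<close> applies.\<close>
  let ?b = "\<lambda>j x. x \<ominus>\<^bsub>?G j\<^esub> c j x"
  have b: "?b j \<in> mod_hom R (?G j) (?G j)" for j
    by (rule mod_hom_diff[OF Gm Gm _ c(1)]) (simp add: mod_hom_def)
  have bD: "D j (?b (Suc j) x) = ?b j (D j x)" if x: "x \<in> carrier (?G (Suc j))" for j x
    using mod_hom_minus[OF Gm Gm D x mod_homD(1)[OF c(1) x]] c(2)[OF x] by simp
  have b0: "?b 0 v \<in> D 0 ` carrier (?G (Suc 0))" if v: "v \<in> carrier (?G 0)" for v
  proof -
    have cv: "c 0 v \<in> carrier (?G 0)" by (rule mod_homD(1)[OF c(1) v])
    have "?b 0 v i \<in> I" for i
    proof -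
      have cl: "v i \<in> carrier R" "c 0 v i \<in> carrier R" using v cv by (simp_all add: FM_carrier_iff)
      have "v i = (if i < g then v i else \<zero>)" using v r0 by (simp add: FM_carrier_iff)
      then have "c 0 v i \<ominus> v i \<in> I" using c(4)[OF v, of i] by simp
      then have "\<ominus> (c 0 v i \<ominus> v i) \<in> I" by (rule I.a_inv_closed)
      also have "\<ominus> (c 0 v i \<ominus> v i) = v i \<ominus> c 0 v i" using cl by (simp add: minus_eq minus_add a_comm)
      finally show ?thesis by (simp add: free_module_diff[OF v cv])
    qed
    then show ?thesis unfolding im0 using mod_homD(1)[OF b v] r0 by simp
  qed
  show thesis
  proof (rule chain_homotopy[where G = ?G and D = D and c = ?b, OF Greg D DD Dex b bD b0])
    fix h assume h: "\<And>j. h j \<in> mod_hom R (?G j) (?G (Suc j))"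
      "\<And>j x. x \<in> carrier (?G (Suc j)) \<Longrightarrow> D j (h j (D j x)) = ?b j (D j x)"
    \<comment> \<open>On the image of \<open>D m\<close> the homotopy gives
      \<open>D h D = (1 - c) D\<close>, and \<open>c D = D c\<close> is zero here because
      \<open>c\<close> vanishes in degree \<open>Suc m\<close>.\<close>
    have "D m (h m (D m x)) = D m x" if x: "x \<in> carrier (?G (Suc m))" for x
    proof -
      interpret Gm: module R "?G m" by (rule Gm)
      have "c m (D m x) = \<zero>\<^bsub>?G m\<^esub>"
        using c(2)[OF x] c(3)[OF x] mod_hom_zero[OF Gm Gm D] by metis
      then show ?thesis
        using h(2)[OF x] mod_homD(1)[OF D x] by (simp add: Gm.M.minus_eq del: free_module_simps)
    qed
    then show thesis by (rule that[OF h(1)])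
  qed
qed

section \<open>Modules supported on a closed set\<close>

text \<open>Krull's argument: an ideal that is maximal among those containing \<open>J\<close> and
  no power of \<open>t\<close> is prime.\<close>

lemma (in noetherian_cring) primeideal_avoiding_powers:
  assumes J: "ideal J R" and t: "t \<in> carrier R" and tJ: "\<And>n::nat. t [^] n \<notin> J"
  shows "\<exists>P. primeideal P R \<and> J \<subseteq> P \<and> t \<notin> P"
proof -
  let ?S = "{K. ideal K R \<and> J \<subseteq> K \<and> (\<forall>n::nat. t [^] n \<notin> K)}"
  have "\<exists>P\<in>?S. \<forall>K\<in>?S. P \<subseteq> K \<longrightarrow> K = P"
  proof (rule subset_Zorn_nonempty)
    show "?S \<noteq> {}" using J tJ by blast
    fix C assume C: "C \<noteq> {}" "subset.chain ?S C"
    then have "subset.chain {I. ideal I R} C" by (auto simp: subset_chain_def)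
    then have "\<Union>C \<in> C" by (rule ideal_chain_is_trivial[OF C(1)])
    then show "\<Union>C \<in> ?S" using C(2) unfolding subset_chain_def by blast
  qed
  then obtain P where PS: "P \<in> ?S" and max: "\<forall>K\<in>?S. P \<subseteq> K \<longrightarrow> K = P" by (rule bexE)
  then have P: "ideal P R" "J \<subseteq> P" "\<And>n::nat. t [^] n \<notin> P" by simp_all
  interpret P: ideal P R by (rule P(1))
  \<comment> \<open>The colon ideal \<open>P : a\<close> contains \<open>b\<close> and is thus
    strictly larger than \<open>P\<close>, so it contains a power of \<open>t\<close>. Given a
    product in \<open>P\<close> of two elements outside \<open>P\<close>, this replaces first one
    factor and then the other by a power of \<open>t\<close>.\<close>
  have colon: "\<exists>n::nat. t [^] n \<otimes> a \<in> P"
    if a: "a \<in> carrier R" and b: "b \<in> carrier R" "b \<notin> P" "b \<otimes> a \<in> P" for a b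
  proof (rule ccontr)
    assume *: "\<not> ?thesis"
    let ?K = "{x \<in> carrier (regular_module R). x \<otimes> a \<in> P}"
    have hom: "(\<lambda>x. x \<otimes> a) \<in> mod_hom R (regular_module R) (regular_module R)"
      by (rule mod_homI) (use a in \<open>auto simp: l_distr m_assoc\<close>)
    have "ideal ?K R"
      unfolding submodule_regular_iff[symmetric]
      by (rule preimage_submodule[OF regular_module_module regular_module_module hom])
        (simp add: submodule_regular_iff P(1))
    moreover have PK: "P \<subseteq> ?K" using a P.I_r_closed P.a_subset by auto
    ultimately have "?K \<in> ?S" using P(2) * by auto
    then have "?K = P" using max PK by blast
    then show False using b by auto
  qed
  have "primeideal P R"
  proof (rule primeidealI[OF P(1) is_cring])
    show "carrier R \<noteq> P" using P(3)[of 0] by auto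
    fix a b assume a: "a \<in> carrier R" and b: "b \<in> carrier R" and ab: "a \<otimes> b \<in> P"
    show "a \<in> P \<or> b \<in> P"
    proof (rule ccontr)
      assume n: "\<not> (a \<in> P \<or> b \<in> P)"
      then obtain n :: nat where "t [^] n \<otimes> b \<in> P" using colon[OF b a] ab by blast
      then have "b \<otimes> t [^] n \<in> P" using b t by (simp add: m_comm)
      then obtain k :: nat where "t [^] k \<otimes> t [^] n \<in> P" using colon[of "t [^] n" b] b t n by auto
      then show False using P(3)[of "k + n"] t by (simp add: nat_pow_mult)
    qed
  qed
  moreover have "t \<notin> P" using P(3)[of 1] t by simp
  ultimately show ?thesis using P(2) by blast
qed

text \<open>If no power of \<open>t\<close> kills \<open>x\<close>, some prime over the annihilator
  of \<open>x\<close> avoids \<open>t\<close>; it is in the support but not in V(I). Finite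
  generation makes the exponent uniform.\<close>

lemma (in noetherian_cring) in_L_annihilated:
  fixes M :: "('a, 'c) module"
  assumes X: "finite X" "X \<subseteq> carrier R" and M: "in_L R (zariski_closed R (Idl X)) M"
  shows "\<exists>N::nat. \<forall>t\<in>X. \<forall>x\<in>carrier M. (t [^] N) \<odot>\<^bsub>M\<^esub> x = \<zero>\<^bsub>M\<^esub>"
proof -
  obtain A where Mm: "module R M" and A: "finite A" "A \<subseteq> carrier M"
    and g: "\<forall>N. submodule N R M \<and> A \<subseteq> N \<longrightarrow> N = carrier M"
    and supp: "support R M \<subseteq> zariski_closed R (Idl X)"
    using M by (auto simp: in_L_def fin_gen_module_def)
  interpret M: module R M by (rule Mm)
  have "\<exists>N::nat. (t [^] N) \<odot>\<^bsub>M\<^esub> x = \<zero>\<^bsub>M\<^esub>" if t: "t \<in> X" and x: "x \<in> carrier M" for t x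
  proof (rule ccontr)
    assume *: "\<not> ?thesis"
    let ?J = "{a \<in> carrier (regular_module R). a \<odot>\<^bsub>M\<^esub> x \<in> {\<zero>\<^bsub>M\<^esub>}}"
    have hom: "(\<lambda>a. a \<odot>\<^bsub>M\<^esub> x) \<in> mod_hom R (regular_module R) M"
      by (rule mod_homI) (use x in \<open>auto simp: M.smult_l_distr M.smult_assoc1\<close>)
    have J: "ideal ?J R"
      unfolding submodule_regular_iff[symmetric]
      by (rule preimage_submodule[OF regular_module_module Mm hom zero_submodule[OF Mm]])
    have "t \<in> carrier R" using t X by blast
    moreover have "t [^] n \<notin> ?J" for n :: nat using * by simp
    ultimately obtain P where P: "primeideal P R" "?J \<subseteq> P" "t \<notin> P"
      using primeideal_avoiding_powers[OF J] by blast
    have "s \<odot>\<^bsub>M\<^esub> x \<noteq> \<zero>\<^bsub>M\<^esub>" if "s \<in> carrier R - P" for s using that P(2) by auto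
    then have "P \<in> support R M" using support_iff[OF Mm] P(1) x by blast
    then have "Idl X \<subseteq> P" using supp by (auto simp: zariski_closed_def)
    then show False using genideal_self[OF X(2)] t P(3) by blast
  qed
  then have "\<forall>t\<in>X. \<forall>x\<in>A. \<exists>N::nat. (t [^] N) \<odot>\<^bsub>M\<^esub> x = \<zero>\<^bsub>M\<^esub>" using A(2) by blast
  then obtain f :: "'a \<Rightarrow> 'c \<Rightarrow> nat" where f: "\<And>t x. t \<in> X \<Longrightarrow> x \<in> A \<Longrightarrow> (t [^] f t x) \<odot>\<^bsub>M\<^esub> x = \<zero>\<^bsub>M\<^esub>"
    by metis
  define N where "N = Max ((\<lambda>(t, x). f t x) ` (X \<times> A))"
  have "carrier M \<subseteq> {x \<in> carrier M. (t [^] N) \<odot>\<^bsub>M\<^esub> x \<in> {\<zero>\<^bsub>M\<^esub>}}" if t: "t \<in> X" for t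
  proof -
    have tR: "t \<in> carrier R" using t X by blast
    let ?K = "{x \<in> carrier M. (t [^] N) \<odot>\<^bsub>M\<^esub> x \<in> {\<zero>\<^bsub>M\<^esub>}}"
    have "(\<lambda>x. (t [^] N) \<odot>\<^bsub>M\<^esub> x) \<in> mod_hom R M M"
      by (rule mod_hom_smult[OF Mm]) (auto simp: mod_hom_def tR)
    then have K: "submodule ?K R M" by (rule preimage_submodule[OF Mm Mm _ zero_submodule[OF Mm]])
    have "A \<subseteq> ?K"
    proof
      fix x assume x: "x \<in> A"
      then have xM: "x \<in> carrier M" using A(2) by blast
      have "f t x \<le> N"
        unfolding N_def by (rule Max_ge) (use A(1) X(1) x t in auto)
      then have "t [^] N = t [^] (N - f t x) \<otimes> t [^] f t x" using tR by (simp add: nat_pow_mult)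
      then have "(t [^] N) \<odot>\<^bsub>M\<^esub> x = \<zero>\<^bsub>M\<^esub>" using f[OF t x] tR xM by (simp add: M.smult_assoc1)
      then show "x \<in> ?K" using xM by simp
    qed
    then show ?thesis using g K by blast
  qed
  then show ?thesis by blast
qed

text \<open>A prime in the support contains every \<open>t\<close> in \<open>X\<close>: otherwise
  \<open>t^N\<close> lies outside it and kills the element that witnesses membership in the
  support.\<close>

lemma (in cring) in_L_annihilatedI:
  assumes M: "fin_gen_module R M" and X: "X \<subseteq> carrier R"
    and ann: "\<And>t x. t \<in> X \<Longrightarrow> x \<in> carrier M \<Longrightarrow> (t [^] (N::nat)) \<odot>\<^bsub>M\<^esub> x = \<zero>\<^bsub>M\<^esub>"
  shows "in_L R (zariski_closed R (Idl X)) M"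
  unfolding in_L_def
proof (intro conjI M subsetI)
  have Mm: "module R M" using M by (simp add: fin_gen_module_def)
  fix P assume "P \<in> support R M"
  then obtain x where P: "primeideal P R" and x: "x \<in> carrier M"
    and xs: "\<And>s. s \<in> carrier R - P \<Longrightarrow> s \<odot>\<^bsub>M\<^esub> x \<noteq> \<zero>\<^bsub>M\<^esub>"
    using support_iff[OF Mm] by blast
  interpret P: primeideal P R by (rule P)
  have "t \<in> P" if t: "t \<in> X" for t
  proof (rule ccontr)
    assume tP: "t \<notin> P"
    have tR: "t \<in> carrier R" using t X by blast
    have "t [^] n \<notin> P" for n :: nat
    proof (induction n)
      case 0
      then show ?case using P.I_notcarr P.one_imp_carrier by auto
    next
      case (Suc n)
      then show ?case using P.I_prime[of "t [^] n" t] tP tR by auto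
    qed
    then show False using xs[of "t [^] N"] ann[OF t x] tR by simp
  qed
  then have "Idl X \<subseteq> P" by (intro genideal_minimal) (auto intro: P.is_ideal)
  then show "P \<in> zariski_closed R (Idl X)" using P by (simp add: zariski_closed_def)
qed

section \<open>Homology in terms of cycles and boundaries\<close>

lemma homology_facts:
  assumes C: "chain_complex R C"
  shows "cycles C n = {x \<in> carrier (obj C n). bdry C n x = \<zero>\<^bsub>obj C (n - 1)\<^esub>}"
    and "submodule (cycles C n) R (obj C n)"
    and "module R ((obj C n)\<lparr>carrier := cycles C n\<rparr>)"
    and "submodule (boundaries C n) R ((obj C n)\<lparr>carrier := cycles C n\<rparr>)"
proof -
  have M: "module R (obj C n)" and d: "bdry C n \<in> mod_hom R (obj C n) (obj C (n - 1))"
    and dd: "x \<in> carrier (obj C n) \<Longrightarrow> bdry C (n - 1) (bdry C n x) = \<zero>\<^bsub>obj C (n - 1 - 1)\<^esub>" for n x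
    using C by (simp_all add: chain_complex_def)
  show cyc: "cycles C n = {x \<in> carrier (obj C n). bdry C n x = \<zero>\<^bsub>obj C (n - 1)\<^esub>}" for n
    unfolding cycles_def a_kernel_def' by simp
  show Z: "submodule (cycles C n) R (obj C n)"
    using preimage_submodule[OF M M d zero_submodule[OF M]] by (simp add: cyc)
  show ZM: "module R ((obj C n)\<lparr>carrier := cycles C n\<rparr>)" by (rule submodule_module[OF M Z])
  have n1: "n + 1 - 1 = n" by simp
  have d1: "bdry C (n + 1) \<in> mod_hom R (obj C (n + 1)) (obj C n)" using d[of "n + 1"] unfolding n1 .
  have "bdry C (n + 1) \<in> mod_hom R (obj C (n + 1)) ((obj C n)\<lparr>carrier := cycles C n\<rparr>)"
  proof (rule mod_homI)
    fix x assume x: "x \<in> carrier (obj C (n + 1))"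
    then show "bdry C (n + 1) x \<in> carrier ((obj C n)\<lparr>carrier := cycles C n\<rparr>)"
      using dd[of x "n + 1"] mod_homD(1)[OF d1 x] unfolding n1 by (simp add: cyc)
  qed (use mod_homD(2,3)[OF d1] in simp_all)
  then show "submodule (boundaries C n) R ((obj C n)\<lparr>carrier := cycles C n\<rparr>)"
    unfolding boundaries_def
    by (rule image_submodule[OF M ZM _ module.carrier_is_submodule[OF M]])
qed

text \<open>Moves annihilation of homology to elements of the complex, so that cosets stay out of
  the obstruction arguments.\<close>

lemma homology_smult_zero_iff:
  assumes C: "chain_complex R C" and a: "a \<in> carrier R"
  shows "(\<forall>z\<in>carrier (homology R C n). a \<odot>\<^bsub>homology R C n\<^esub> z = \<zero>\<^bsub>homology R C n\<^esub>) \<longleftrightarrow>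
    (\<forall>x\<in>cycles C n. a \<odot>\<^bsub>obj C n\<^esub> x \<in> boundaries C n)"
proof -
  note h = homology_facts[OF C, of n]
  let ?Z = "(obj C n)\<lparr>carrier := cycles C n\<rparr>" and ?H = "homology R C n"
  note proj = quotient_proj[OF h(3,4)]
  let ?\<pi> = "\<lambda>x. boundaries C n +>\<^bsub>?Z\<^esub> x"
  have car: "carrier ?H = ?\<pi> ` cycles C n" using proj(2) by (simp add: homology_def)
  have "a \<odot>\<^bsub>?H\<^esub> ?\<pi> x = \<zero>\<^bsub>?H\<^esub> \<longleftrightarrow> a \<odot>\<^bsub>obj C n\<^esub> x \<in> boundaries C n" if x: "x \<in> cycles C n" for x
  proof -
    have xZ: "x \<in> carrier ?Z" using x by simp
    have aZ: "a \<odot>\<^bsub>?Z\<^esub> x \<in> carrier ?Z" by (rule module.smult_closed[OF h(3) a xZ])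
    have "a \<odot>\<^bsub>?H\<^esub> ?\<pi> x = ?\<pi> (a \<odot>\<^bsub>?Z\<^esub> x)"
      unfolding homology_def by (rule quotient_smult[OF h(3,4) a xZ])
    then show ?thesis using proj(3)[OF aZ] by (simp add: homology_def)
  qed
  then show ?thesis unfolding car by simp
qed

section \<open>Frobenius powers of a free resolution\<close>

text \<open>For a basis vector, the scalars that carry it into the span form an ideal containing
  \<open>X\<close>, hence \<open>Idl X\<close>. This settles each coordinate without expanding
  elements of \<open>Idl X\<close>.\<close>

lemma (in cring) FM_ideal_power_span:
  assumes X: "X \<subseteq> carrier R" and v: "v \<in> carrier (FM R n)" "\<And>i. v i \<in> Idl X"
  shows "v \<in> power_span R (FM R n) X 1 (carrier (FM R n))"
proof -
  let ?K = "power_span R (FM R n) X 1 (carrier (FM R n))"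
  have K: "submodule ?K R (FM R n)" by (rule power_span_submodule[OF FM_module X order_refl])
  interpret F: module R "FM R n" by (rule FM_module)
  show ?thesis
  proof (rule FM_mem_submodule[OF K v(1)])
    fix b assume "b < n"
    then have u: "unit_vec R b \<in> carrier (FM R n)" by (auto intro: unit_vec_carrier)
    let ?J = "{a \<in> carrier (regular_module R). a \<odot>\<^bsub>FM R n\<^esub> unit_vec R b \<in> ?K}"
    have hom: "(\<lambda>a. a \<odot>\<^bsub>FM R n\<^esub> unit_vec R b) \<in> mod_hom R (regular_module R) (FM R n)"
      by (rule mod_homI)
        (use u in \<open>auto simp: F.smult_l_distr F.smult_assoc1 simp del: free_module_simps\<close>)
    have J: "ideal ?J R"
      unfolding submodule_regular_iff[symmetric]
      by (rule preimage_submodule[OF regular_module_module FM_module hom K])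
    have "t \<in> ?J" if "t \<in> X" for t
      using power_span_memI[OF that u, where R = R and N = 1 and M = "FM R n"] that X by (auto simp del: free_module_simps)
    then have "Idl X \<subseteq> ?J" by (intro genideal_minimal[OF J] subsetI)
    then show "v b \<odot>\<^bsub>FM R n\<^esub> unit_vec R b \<in> ?K" using v(2)[of b] by blast
  qed
qed

section \<open>The tower of Frobenius powers and its transition maps\<close>

locale frobenius_resolution = noetherian_cring R for R (structure) +
  fixes X :: "'a set" and p g :: nat and r :: "nat \<Rightarrow> nat" and D :: "nat \<Rightarrow> (nat \<Rightarrow> 'a) \<Rightarrow> nat \<Rightarrow> 'a"
  assumes X: "finite X" "X \<subseteq> carrier R"
    and p: "additive_power R p" "1 < p"
    and r0: "r 0 = g"
    and D: "\<And>j. D j \<in> mod_hom R (FM R (r (Suc j))) (FM R (r j))"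
    and im0: "D 0 ` carrier (FM R (r (Suc 0))) = {v \<in> carrier (FM R g). \<forall>i. v i \<in> Idl X}"
    and im: "\<And>j. D (Suc j) ` carrier (FM R (r (Suc (Suc j)))) =
      {x \<in> carrier (FM R (r (Suc j))). D j x = \<zero>\<^bsub>FM R (r j)\<^esub>}"
begin

abbreviation G :: "nat \<Rightarrow> ('a, nat \<Rightarrow> 'a) module" where
  "G j \<equiv> FM R (r j)"

text \<open>The differential of the Frobenius power with \<open>q = p^e\<close>. The modules are
  again the \<open>G j\<close>; only the matrices depend on \<open>e\<close>.\<close>

definition Dq :: "nat \<Rightarrow> nat \<Rightarrow> (nat \<Rightarrow> 'a) \<Rightarrow> nat \<Rightarrow> 'a" where
  "Dq e j = frob_map R (p ^ e) (r j) (D j)"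

lemma pe: "additive_power R (p ^ e)" "0 < p ^ e"
  using additive_power_power[OF p(1)] p(2) by simp_all

lemma Dq_hom: "Dq e j \<in> mod_hom R (G (Suc j)) (G j)"
  unfolding Dq_def by (rule frob_map_hom[OF pe(2) D])

lemma DD: "x \<in> carrier (G (Suc (Suc j))) \<Longrightarrow> D j (D (Suc j) x) = \<zero>\<^bsub>G j\<^esub>"
  using im[of j] imageI[of x "carrier (G (Suc (Suc j)))" "D (Suc j)"] by simp

lemma exact: "x \<in> carrier (G (Suc j)) \<Longrightarrow> D j x = \<zero>\<^bsub>G j\<^esub> \<Longrightarrow> x \<in> D (Suc j) ` carrier (G (Suc (Suc j)))"
  using im[of j] by simp

lemma zero_hom: "(\<lambda>x. \<zero>\<^bsub>FM R n\<^esub>) \<in> mod_hom R (FM R k) (FM R n)"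
  by (rule mod_homI) (auto simp: FM_carrier_iff)

lemma Dq_Dq:
  assumes "x \<in> carrier (G (Suc (Suc j)))"
  shows "Dq e j (Dq e (Suc j) x) = \<zero>\<^bsub>G j\<^esub>"
proof -
  have "Dq e j (Dq e (Suc j) x) = frob_map R (p ^ e) (r j) (\<lambda>x. D j (D (Suc j) x)) x"
    unfolding Dq_def by (rule frob_map_comp[OF pe(1) D D assms, symmetric])
  also have "\<dots> = \<zero>\<^bsub>G j\<^esub>"
  proof (rule frob_map_eqI[OF pe(2) mod_hom_comp[OF D D] zero_hom _ assms])
    fix b assume "b < r (Suc (Suc j))"
    then have "unit_vec R b \<in> carrier (G (Suc (Suc j)))" by (auto intro: unit_vec_carrier)
    then show "\<zero>\<^bsub>G j\<^esub> = frob_vec R (p ^ e) (D j (D (Suc j) (unit_vec R b)))"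
      unfolding DD frob_vec_zero[OF pe(2)] by (simp only: DD frob_vec_zero[OF pe(2)])
  qed
  finally show ?thesis .
qed

text \<open>By the Artin-Rees inclusion \<open>k\<close>, the map \<open>f\<close> lands in the
  image under \<open>D i\<close> of the divisible submodule of \<open>G (Suc i)\<close>. Lifting
  through \<open>D i\<close> restricted to that submodule makes \<open>h\<close> divisible by
  construction.\<close>

lemma comparison_step:
  assumes f: "f \<in> mod_hom R (G (Suc i)) (G i)"
    and fH: "\<And>v. v \<in> carrier (G (Suc i)) \<Longrightarrow> f v \<in> D i ` carrier (G (Suc i))"
    and fk: "\<And>v. v \<in> carrier (G (Suc i)) \<Longrightarrow> f v \<in> power_span R (G i) X k (carrier (G i))"
    and k: "power_span R (G i) X k (carrier (G i)) \<inter> D i ` carrier (G (Suc i))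
      \<subseteq> power_span R (G i) X N (D i ` carrier (G (Suc i)))"
  obtains h where "h \<in> mod_hom R (G (Suc i)) (G (Suc i))"
    "\<And>v. v \<in> carrier (G (Suc i)) \<Longrightarrow> h v \<in> power_span R (G (Suc i)) X N (carrier (G (Suc i)))"
    "\<And>v. v \<in> carrier (G (Suc i)) \<Longrightarrow> D i (h v) = f v"
proof -
  let ?S = "power_span R (G (Suc i)) X N (carrier (G (Suc i)))"
  have S: "submodule ?S R (G (Suc i))" by (rule power_span_submodule[OF FM_module X(2) order_refl])
  let ?M = "(G (Suc i))\<lparr>carrier := ?S\<rparr>"
  have M: "module R ?M" by (rule submodule_module[OF FM_module S])
  have DM: "D i \<in> mod_hom R ?M (G i)"
    by (rule mod_homI) (use mod_homD[OF D] submoduleD(1)[OF S] in \<open>simp_all del: free_module_simps\<close>)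
  have "f v \<in> D i ` carrier ?M" if v: "v \<in> carrier (G (Suc i))" for v
  proof -
    have "f v \<in> power_span R (G i) X N (D i ` carrier (G (Suc i)))" using fH[OF v] fk[OF v] k by blast
    also have "\<dots> = D i ` ?S"
      by (rule power_span_image[OF FM_module FM_module D X(2) order_refl, symmetric])
    finally show ?thesis by simp
  qed
  from projective_module_lift_into[OF FM_projective M FM_module DM f this]
  obtain h where h: "h \<in> mod_hom R (G (Suc i)) ?M" "\<forall>v\<in>carrier (G (Suc i)). D i (h v) = f v" by (rule bexE)
  show thesis
  proof (rule that)
    show hS: "h v \<in> ?S" if "v \<in> carrier (G (Suc i))" for v using mod_homD(1)[OF h(1) that] by simp
    show "h \<in> mod_hom R (G (Suc i)) (G (Suc i))"
      by (rule mod_homI) (use mod_homD(2,3)[OF h(1)] submoduleD(1)[OF S hS] in \<open>simp_all\<close>)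
    show "D i (h v) = f v" if "v \<in> carrier (G (Suc i))" for v using h(2) that by blast
  qed
qed

text \<open>The two final clauses feed the next step: the composite leaving degree
  \<open>Suc i\<close> is divisible and consists of boundaries. Degree 0 is exempt from divisibility
  because the map is the identity there.\<close>

definition comparison_upto :: "nat \<Rightarrow> nat \<Rightarrow> nat \<Rightarrow> (nat \<Rightarrow> (nat \<Rightarrow> 'a) \<Rightarrow> nat \<Rightarrow> 'a) \<Rightarrow> bool" where
  "comparison_upto N i e \<phi> \<longleftrightarrow> (\<forall>v. \<phi> 0 v = v) \<and> (\<forall>j\<le>i. \<phi> j \<in> mod_hom R (G j) (G j)) \<and>
     (\<forall>j<i. \<forall>v\<in>carrier (G (Suc j)). D j (\<phi> (Suc j) v) = \<phi> j (Dq e j v)) \<and>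
     (\<forall>j\<le>i. 0 < j \<longrightarrow> (\<forall>v\<in>carrier (G j). \<phi> j v \<in> power_span R (G j) X N (carrier (G j)))) \<and>
     (\<forall>v\<in>carrier (G (Suc i)). \<phi> i (Dq e i v) \<in> power_span R (G i) X N (carrier (G i))) \<and>
     (\<forall>v\<in>carrier (G (Suc i)). \<phi> i (Dq e i v) \<in> D i ` carrier (G (Suc i)))"

text \<open>The transition maps of the tower of Frobenius powers can be made divisible by arbitrarily high
  powers of the generators in positive degrees; this replaces the exactness theorem of Peskine and
  Szpiro.\<close>

lemma comparison: "\<exists>e \<phi>. comparison_upto N i e \<phi>"
proof (induction i arbitrary: N)
  case 0
  let ?I = "{v \<in> carrier (FM R g). \<forall>i. v i \<in> Idl X}"
  interpret I: ideal "Idl X" R by (rule genideal_ideal[OF X(2)])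
  have HI: "submodule (D 0 ` carrier (G (Suc 0))) R (G 0)"
    by (rule image_submodule[OF FM_module FM_module D module.carrier_is_submodule[OF FM_module]])
  have PS: "submodule (power_span R (G 0) X n (carrier (G 0))) R (G 0)" for n
    by (rule power_span_submodule[OF FM_module X(2) order_refl])
  have u: "Dq N 0 (unit_vec R b) = frob_vec R (p ^ N) (D 0 (unit_vec R b))"
    "D 0 (unit_vec R b) \<in> ?I" if b: "b < r (Suc 0)" for b
  proof -
    show "Dq N 0 (unit_vec R b) = frob_vec R (p ^ N) (D 0 (unit_vec R b))"
      unfolding Dq_def by (rule frob_map_unit[OF pe(2) D b])
    show "D 0 (unit_vec R b) \<in> ?I"
      unfolding im0[symmetric] by (rule imageI) (use b in \<open>auto intro: unit_vec_carrier\<close>)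
  qed
  \<comment> \<open>The exponent \<open>e = N\<close> is chosen because \<open>p^N\<close> is at
    least \<open>N\<close>: the entries of \<open>D 0\<close> lie in the ideal, so the columns of
    its Frobenius power lie in the span for the \<open>p^N\<close>-th powers of the
    generators.\<close>
  have "N \<le> 1 * p ^ N" using p(2) power_gt_expt[of p N] by simp
  then have anti: "power_span R (G 0) X (1 * p ^ N) (carrier (G 0)) \<subseteq> power_span R (G 0) X N (carrier (G 0))"
    by (rule power_span_antimono[OF FM_module X(2) module.carrier_is_submodule[OF FM_module]])
  have 1: "Dq N 0 v \<in> power_span R (G 0) X N (carrier (G 0))" if v: "v \<in> carrier (G (Suc 0))" for v
  proof (rule FM_subset_submodule[OF FM_module Dq_hom PS _ v])
    fix b assume b: "b < r (Suc 0)"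
    have "D 0 (unit_vec R b) \<in> power_span R (G 0) X 1 (carrier (G 0))"
      unfolding r0 by (rule FM_ideal_power_span[OF X(2)]) (use u(2)[OF b] in auto)
    then have "frob_vec R (p ^ N) (D 0 (unit_vec R b)) \<in> power_span R (G 0) X (1 * p ^ N) (carrier (G 0))"
      by (rule frob_vec_power_span[OF pe(1) X(2)])
    then show "Dq N 0 (unit_vec R b) \<in> power_span R (G 0) X N (carrier (G 0))"
      unfolding u(1)[OF b] using anti by blast
  qed
  \<comment> \<open>An ideal is closed under positive powers, so raising the entries keeps the
    columns inside the image of \<open>D 0\<close>.\<close>
  have 2: "Dq N 0 v \<in> D 0 ` carrier (G (Suc 0))" if v: "v \<in> carrier (G (Suc 0))" for v
  proof (rule FM_subset_submodule[OF FM_module Dq_hom HI _ v])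
    fix b assume b: "b < r (Suc 0)"
    have pow: "x [^] (p ^ N) \<in> Idl X" if "x \<in> Idl X" for x
    proof -
      obtain n where "p ^ N = Suc n" using pe(2)[of N] gr0_conv_Suc by blast
      then show ?thesis using that I.I_l_closed[of x "x [^] n"] I.a_subset by auto
    qed
    have "frob_vec R (p ^ N) (D 0 (unit_vec R b)) \<in> carrier (FM R g)"
      by (rule frob_vec_closed[OF pe(2)]) (use u(2)[OF b] in simp)
    then show "Dq N 0 (unit_vec R b) \<in> D 0 ` carrier (G (Suc 0))"
      unfolding u(1)[OF b] im0 using u(2)[OF b] pow by (simp add: frob_vec_def)
  qed
  show ?case
    by (rule exI[of _ N], rule exI[of _ "\<lambda>j v. v"]) (use 1 2 in \<open>simp add: comparison_upto_def mod_hom_def\<close>)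
next
  case (Suc i)
  let ?H = "D i ` carrier (G (Suc i))"
  have H: "submodule ?H R (G i)"
    by (rule image_submodule[OF FM_module FM_module D module.carrier_is_submodule[OF FM_module]])
  obtain k where k: "power_span R (G i) X k (carrier (G i)) \<inter> ?H \<subseteq> power_span R (G i) X N ?H"
    using FM_artin_rees[OF X H, of N] by (elim exE)
  \<comment> \<open>The hypothesis is used at \<open>max N k\<close>: \<open>k\<close> for
    Artin-Rees in degree \<open>i\<close>, \<open>N\<close> for the divisibility demanded in lower
    degrees.\<close>
  obtain e \<phi> where c: "comparison_upto (max N k) i e \<phi>"
    using Suc.IH[of "max N k"] by (elim exE)
  have \<phi>: "\<And>v. \<phi> 0 v = v" "\<And>j. j \<le> i \<Longrightarrow> \<phi> j \<in> mod_hom R (G j) (G j)"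
     "\<And>j v. j < i \<Longrightarrow> v \<in> carrier (G (Suc j)) \<Longrightarrow> D j (\<phi> (Suc j) v) = \<phi> j (Dq e j v)"
     "\<And>j v. j \<le> i \<Longrightarrow> 0 < j \<Longrightarrow> v \<in> carrier (G j) \<Longrightarrow> \<phi> j v \<in> power_span R (G j) X (max N k) (carrier (G j))"
     "\<And>v. v \<in> carrier (G (Suc i)) \<Longrightarrow> \<phi> i (Dq e i v) \<in> power_span R (G i) X (max N k) (carrier (G i))"
     "\<And>v. v \<in> carrier (G (Suc i)) \<Longrightarrow> \<phi> i (Dq e i v) \<in> D i ` carrier (G (Suc i))"
    using c by (simp_all add: comparison_upto_def)
  have anti: "power_span R (G j) X (max N k) (carrier (G j)) \<subseteq> power_span R (G j) X n (carrier (G j))"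
    if "n \<le> max N k" for n j
    by (rule power_span_antimono[OF FM_module X(2) module.carrier_is_submodule[OF FM_module] that])
  have f: "(\<lambda>v. \<phi> i (Dq e i v)) \<in> mod_hom R (G (Suc i)) (G i)"
    by (rule mod_hom_comp[OF Dq_hom \<phi>(2)]) simp
  have fk: "\<phi> i (Dq e i v) \<in> power_span R (G i) X k (carrier (G i))" if "v \<in> carrier (G (Suc i))" for v
    using \<phi>(5)[OF that] anti[of k i] by auto
  obtain h where h: "h \<in> mod_hom R (G (Suc i)) (G (Suc i))"
    "\<And>v. v \<in> carrier (G (Suc i)) \<Longrightarrow> h v \<in> power_span R (G (Suc i)) X N (carrier (G (Suc i)))"
    "\<And>v. v \<in> carrier (G (Suc i)) \<Longrightarrow> D i (h v) = \<phi> i (Dq e i v)"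
    by (rule comparison_step[OF f \<phi>(6) fk k]) (assumption | rule that)+
  let ?\<phi> = "\<phi>(Suc i := h)"
  have hD: "h (Dq e (Suc i) v) \<in> D (Suc i) ` carrier (G (Suc (Suc i)))"
    if v: "v \<in> carrier (G (Suc (Suc i)))" for v
  proof (rule exact)
    have Dv: "Dq e (Suc i) v \<in> carrier (G (Suc i))" by (rule mod_homD(1)[OF Dq_hom v])
    show "h (Dq e (Suc i) v) \<in> carrier (G (Suc i))" by (rule mod_homD(1)[OF h(1) Dv])
    show "D i (h (Dq e (Suc i) v)) = \<zero>\<^bsub>G i\<^esub>"
      unfolding h(3)[OF Dv] Dq_Dq[OF v] by (rule mod_hom_zero[OF FM_module FM_module \<phi>(2)]) simp
  qed
  show ?case
  proof (rule exI[of _ e], rule exI[of _ ?\<phi>], unfold comparison_upto_def, intro conjI allI impI ballI)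
    show "?\<phi> 0 v = v" for v using \<phi>(1) by simp
    show "?\<phi> j \<in> mod_hom R (G j) (G j)" if "j \<le> Suc i" for j
      using that \<phi>(2)[of j] h(1) by auto
    show "D j (?\<phi> (Suc j) v) = ?\<phi> j (Dq e j v)" if "j < Suc i" "v \<in> carrier (G (Suc j))" for j v
      using that \<phi>(3)[of j v] h(3)[of v] by (cases "j = i") auto
    show "?\<phi> j v \<in> power_span R (G j) X N (carrier (G j))"
      if "j \<le> Suc i" "0 < j" "v \<in> carrier (G j)" for j v
    proof (cases "j = Suc i")
      case True then show ?thesis using h(2) that by simp
    next
      case False
      then show ?thesis using \<phi>(4)[of j v] anti[of N j] that by auto
    qed
    show "?\<phi> (Suc i) (Dq e (Suc i) v) \<in> power_span R (G (Suc i)) X N (carrier (G (Suc i)))"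
      if "v \<in> carrier (G (Suc (Suc i)))" for v
      using h(2)[OF mod_homD(1)[OF Dq_hom that]] by simp
    show "?\<phi> (Suc i) (Dq e (Suc i) v) \<in> D (Suc i) ` carrier (G (Suc (Suc i)))"
      if "v \<in> carrier (G (Suc (Suc i)))" for v
      using hD[OF that] by simp
  qed
qed

text \<open>The exponent \<open>e\<close> is a parameter because it changes with \<open>i\<close>: a
  further degree is reached from a possibly higher Frobenius power.\<close>

definition extends_upto ::
    "('a, 'c) cplx \<Rightarrow> ((nat \<Rightarrow> 'a) \<Rightarrow> 'c) \<Rightarrow> nat \<Rightarrow> nat \<Rightarrow> (nat \<Rightarrow> (nat \<Rightarrow> 'a) \<Rightarrow> 'c) \<Rightarrow> bool" where
  "extends_upto C \<pi> i e \<psi> \<longleftrightarrow> (\<forall>j\<le>i. \<psi> j \<in> mod_hom R (G j) (obj C (int j))) \<and> (\<forall>v\<in>carrier (G 0). \<psi> 0 v = \<pi> v) \<and>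
     (\<forall>j<i. \<forall>v\<in>carrier (G (Suc j)). bdry C (int (Suc j)) (\<psi> (Suc j) v) = \<psi> j (Dq e j v))"

text \<open>The obstruction to one more degree is a map into the cycles of \<open>C\<close>. Powers
  \<open>t^N\<close> kill the homology there, so precomposition with a map divisible by them sends
  everything to boundaries, and the result lifts.\<close>

lemma extension:
  fixes C :: "('a, 'c) cplx"
  assumes C: "Ch_L R (zariski_closed R (Idl X)) k C"
    and \<pi>: "\<pi> \<in> mod_hom R (G 0) (obj C 0)"
  shows "\<exists>e \<psi>. extends_upto C \<pi> i e \<psi>"
proof (induction i)
  case 0
  show ?case by (rule exI[of _ 0], rule exI[of _ "\<lambda>j. \<pi>"]) (simp add: extends_upto_def \<pi>)
next
  case (Suc i)
  have cC: "chain_complex R C" and conc: "concentrated k C" and hC: "in_L R (zariski_closed R (Idl X)) (homology R C n)" for n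
    using C by (simp_all add: Ch_L_def)
  have M: "module R (obj C n)" and d: "bdry C n \<in> mod_hom R (obj C n) (obj C (n - 1))" for n
    using cC by (simp_all add: chain_complex_def)
  have int1: "int (Suc j) - 1 = int j" "int j + 1 = int (Suc j)" for j by simp_all
  have dS: "bdry C (int (Suc j)) \<in> mod_hom R (obj C (int (Suc j))) (obj C (int j))" for j
    using d[of "int (Suc j)"] unfolding int1 .
  obtain e \<psi> where c: "extends_upto C \<pi> i e \<psi>"
    using Suc.IH by (elim exE)
  have \<psi>: "\<And>j. j \<le> i \<Longrightarrow> \<psi> j \<in> mod_hom R (G j) (obj C (int j))"
    "\<And>v. v \<in> carrier (G 0) \<Longrightarrow> \<psi> 0 v = \<pi> v"
    "\<And>j v. j < i \<Longrightarrow> v \<in> carrier (G (Suc j)) \<Longrightarrow> bdry C (int (Suc j)) (\<psi> (Suc j) v) = \<psi> j (Dq e j v)"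
    using c by (simp_all add: extends_upto_def)
  obtain N :: nat where N: "\<forall>t\<in>X. \<forall>z\<in>carrier (homology R C (int i)). (t [^] N) \<odot>\<^bsub>homology R C (int i)\<^esub> z = \<zero>\<^bsub>homology R C (int i)\<^esub>"
    using in_L_annihilated[OF X hC] by blast
  have Nb: "(t [^] N) \<odot>\<^bsub>obj C (int i)\<^esub> x \<in> boundaries C (int i)" if t: "t \<in> X" and x: "x \<in> cycles C (int i)" for t x
  proof -
    have "t [^] N \<in> carrier R" using t X(2) by auto
    from homology_smult_zero_iff[OF cC this, of "int i"] N t x show ?thesis by blast
  qed
  have bsub: "submodule (boundaries C (int i)) R (obj C (int i))"
    unfolding boundaries_def int1
    by (rule image_submodule[OF M M dS module.carrier_is_submodule[OF M]])
  obtain e' \<phi> where c: "comparison_upto N (Suc i) e' \<phi>"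
    using comparison[of N "Suc i"] by (elim exE)
  have \<phi>: "\<And>v. \<phi> 0 v = v" "\<And>j. j \<le> Suc i \<Longrightarrow> \<phi> j \<in> mod_hom R (G j) (G j)"
     "\<And>j v. j < Suc i \<Longrightarrow> v \<in> carrier (G (Suc j)) \<Longrightarrow> D j (\<phi> (Suc j) v) = \<phi> j (Dq e' j v)"
     "\<And>v. v \<in> carrier (G (Suc i)) \<Longrightarrow> \<phi> (Suc i) v \<in> power_span R (G (Suc i)) X N (carrier (G (Suc i)))"
    using c by (simp_all add: comparison_upto_def)
  \<comment> \<open>The comparison \<open>\<phi>\<close> ends at \<open>G\<close>, whereas
    \<open>\<psi>\<close> starts at the Frobenius power of exponent \<open>e\<close>. The pullback
    of \<open>\<phi>\<close> by \<open>p^e\<close> goes between the right complexes, from exponent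
    \<open>e' + e\<close> to exponent \<open>e\<close>.\<close>
  define \<Phi> where "\<Phi> j = frob_map R (p ^ e) (r j) (\<phi> j)" for j
  have \<Phi>h: "\<Phi> j \<in> mod_hom R (G j) (G j)" if "j \<le> Suc i" for j
    unfolding \<Phi>_def by (rule frob_map_hom[OF pe(2) \<phi>(2)[OF that]])
  have \<Phi>0: "\<Phi> 0 v = v" if v: "v \<in> carrier (G 0)" for v
    unfolding \<Phi>_def
    by (rule frob_map_eqI[OF pe(2) \<phi>(2) _ _ v]) (simp_all add: mod_hom_def \<phi>(1) frob_vec_unit[OF pe(2)])
  have \<Phi>D: "Dq e j (\<Phi> (Suc j) v) = \<Phi> j (Dq (e' + e) j v)" if j: "j < Suc i" and v: "v \<in> carrier (G (Suc j))" for j v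
  proof -
    have h: "\<phi> (Suc j) \<in> mod_hom R (G (Suc j)) (G (Suc j))" "\<phi> j \<in> mod_hom R (G j) (G j)" using \<phi>(2) j by auto
    have "Dq e j (\<Phi> (Suc j) v) = frob_map R (p ^ e) (r j) (\<lambda>x. D j (\<phi> (Suc j) x)) v"
      unfolding Dq_def \<Phi>_def by (rule frob_map_comp[OF pe(1) D h(1) v, symmetric])
    also have "\<dots> = frob_map R (p ^ e) (r j) (\<lambda>x. \<phi> j (Dq e' j x)) v"
      by (rule frob_map_cong[OF _ pe(2) mod_hom_comp[OF h(1) D] mod_hom_comp[OF Dq_hom h(2)] v])
        (rule \<phi>(3)[OF j], auto intro: unit_vec_carrier)
    also have "\<dots> = \<Phi> j (frob_map R (p ^ e) (r j) (Dq e' j) v)"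
      unfolding \<Phi>_def by (rule frob_map_comp[OF pe(1) h(2) Dq_hom v])
    also have "frob_map R (p ^ e) (r j) (Dq e' j) v = Dq (e' + e) j v"
      unfolding Dq_def power_add by (rule frob_map_frob_map[OF pe(2) pe(2) D v])
    finally show ?thesis .
  qed
  have \<Phi>N: "\<Phi> (Suc i) v \<in> power_span R (G (Suc i)) X N (carrier (G (Suc i)))" if v: "v \<in> carrier (G (Suc i))" for v
  proof (rule FM_subset_submodule[OF FM_module \<Phi>h[OF order_refl] power_span_submodule[OF FM_module X(2) order_refl] _ v])
    fix b assume b: "b < r (Suc i)"
    then have u: "unit_vec R b \<in> carrier (G (Suc i))" by (auto intro: unit_vec_carrier)
    have "frob_vec R (p ^ e) (\<phi> (Suc i) (unit_vec R b)) \<in> power_span R (G (Suc i)) X (N * p ^ e) (carrier (G (Suc i)))"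
      by (rule frob_vec_power_span[OF pe(1) X(2) \<phi>(4)[OF u]])
    also have "\<dots> \<subseteq> power_span R (G (Suc i)) X N (carrier (G (Suc i)))"
      by (rule power_span_antimono[OF FM_module X(2) module.carrier_is_submodule[OF FM_module]])
        (use mult_le_mono[OF order_refl Suc_leI[OF pe(2)], of N e] in simp)
    finally show "\<Phi> (Suc i) (unit_vec R b) \<in> power_span R (G (Suc i)) X N (carrier (G (Suc i)))"
      unfolding \<Phi>_def frob_map_unit[OF pe(2) \<phi>(2)[OF order_refl] b] .
  qed
  have f0: "(\<lambda>w. \<psi> i (Dq e i w)) \<in> mod_hom R (G (Suc i)) (obj C (int i))"
    by (rule mod_hom_comp[OF Dq_hom \<psi>(1)[OF order_refl]])
  have cyc: "\<psi> i (Dq e i w) \<in> cycles C (int i)" if w: "w \<in> carrier (G (Suc i))" for w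
    unfolding homology_facts(1)[OF cC]
  proof (intro CollectI conjI)
    show c: "\<psi> i (Dq e i w) \<in> carrier (obj C (int i))" by (rule mod_homD(1)[OF f0 w])
    show "bdry C (int i) (\<psi> i (Dq e i w)) = \<zero>\<^bsub>obj C (int i - 1)\<^esub>"
    proof (cases i)
      case 0
      \<comment> \<open>At the bottom, \<open>C\<close> is zero in degree -1, so every element is a
        cycle.\<close>
      have "carrier (obj C (int i - 1)) = {\<zero>\<^bsub>obj C (int i - 1)\<^esub>}"
        using conc 0 by (simp add: concentrated_def)
      then show ?thesis using mod_homD(1)[OF d c] by blast
    next
      case (Suc i')
      then have Dw: "Dq e (Suc i') w \<in> carrier (G (Suc i'))" using mod_homD(1)[OF Dq_hom w] by simp
      have "bdry C (int (Suc i')) (\<psi> (Suc i') (Dq e (Suc i') w)) = \<psi> i' (Dq e i' (Dq e (Suc i') w))"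
        using \<psi>(3)[OF _ Dw] Suc by simp
      also have "\<dots> = \<psi> i' \<zero>\<^bsub>G i'\<^esub>" using Dq_Dq w Suc by simp
      also have "\<dots> = \<zero>\<^bsub>obj C (int i')\<^esub>"
        by (rule mod_hom_zero[OF FM_module M \<psi>(1)]) (use Suc in simp)
      finally show ?thesis unfolding Suc int1 .
    qed
  qed
  \<comment> \<open>A generator \<open>t^N x\<close> goes to \<open>t^N\<close> times a cycle, hence
    to a boundary, and so does the whole span.\<close>
  have "power_span R (G (Suc i)) X N (carrier (G (Suc i))) \<subseteq> {w \<in> carrier (G (Suc i)). \<psi> i (Dq e i w) \<in> boundaries C (int i)}"
  proof (rule power_span_least[OF preimage_submodule[OF FM_module M f0 bsub]])
    fix t x assume t: "t \<in> X" and x: "x \<in> carrier (G (Suc i))"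
    then have tN: "t [^] N \<in> carrier R" using X(2) by auto
    have "\<psi> i (Dq e i ((t [^] N) \<odot>\<^bsub>G (Suc i)\<^esub> x)) = (t [^] N) \<odot>\<^bsub>obj C (int i)\<^esub> \<psi> i (Dq e i x)"
      by (rule mod_homD(3)[OF f0 tN x])
    then have "\<psi> i (Dq e i ((t [^] N) \<odot>\<^bsub>G (Suc i)\<^esub> x)) \<in> boundaries C (int i)"
      using Nb[OF t cyc[OF x]] by (simp only:)
    then show "(t [^] N) \<odot>\<^bsub>G (Suc i)\<^esub> x \<in> {w \<in> carrier (G (Suc i)). \<psi> i (Dq e i w) \<in> boundaries C (int i)}"
      using module.smult_closed[OF FM_module tN x] by blast
  qed
  then have lift: "\<psi> i (Dq e i (\<Phi> (Suc i) v)) \<in> bdry C (int (Suc i)) ` carrier (obj C (int (Suc i)))"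
    if "v \<in> carrier (G (Suc i))" for v
    using \<Phi>N[OF that] unfolding boundaries_def int1 by blast
  obtain h where h: "h \<in> mod_hom R (G (Suc i)) (obj C (int (Suc i)))"
    "\<forall>v\<in>carrier (G (Suc i)). bdry C (int (Suc i)) (h v) = \<psi> i (Dq e i (\<Phi> (Suc i) v))"
    using projective_module_lift_into[OF FM_projective M M dS mod_hom_comp[OF \<Phi>h[OF order_refl] f0] lift]
    by (rule bexE)
  \<comment> \<open>The lower maps are precomposed with \<open>\<Phi>\<close> in order to start at
    the new Frobenius power; \<open>\<Phi> 0\<close> is the identity, so degree 0 still gives
    \<open>\<pi>\<close>.\<close>
  let ?\<psi> = "\<lambda>j. if j = Suc i then h else (\<lambda>v. \<psi> j (\<Phi> j v))"
  show ?case
  proof (rule exI[of _ "e' + e"], rule exI[of _ ?\<psi>], unfold extends_upto_def, intro conjI allI impI ballI)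
    show "?\<psi> j \<in> mod_hom R (G j) (obj C (int j))" if "j \<le> Suc i" for j
      using that h(1) mod_hom_comp[OF \<Phi>h \<psi>(1), of j] by auto
    show "?\<psi> 0 v = \<pi> v" if "v \<in> carrier (G 0)" for v using \<Phi>0[OF that] \<psi>(2)[OF that] by simp
    show "bdry C (int (Suc j)) (?\<psi> (Suc j) v) = ?\<psi> j (Dq (e' + e) j v)"
      if j: "j < Suc i" and v: "v \<in> carrier (G (Suc j))" for j v
    proof (cases "j = i")
      case True
      then show ?thesis using h(2) v \<Phi>D[OF j v] by simp
    next
      case False
      then have ji: "j < i" using j by simp
      have "\<Phi> (Suc j) v \<in> carrier (G (Suc j))" by (rule mod_homD(1)[OF \<Phi>h v]) (use ji in simp)
      then show ?thesis using \<psi>(3)[OF ji] \<Phi>D[OF j v] ji by simp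
    qed
  qed
qed

end

section \<open>Reducers\<close>

text \<open>The fixed points of an idempotent are its image, hence a retract. The complement in the
  top degree of the truncation arises in this way and may fail to be free.\<close>

lemma (in cring) FM_retract:
  assumes E: "E \<in> mod_hom R (FM R n) (FM R n)"
    and EE: "\<And>v. v \<in> carrier (FM R n) \<Longrightarrow> E (E v) = E v"
  defines "C \<equiv> {v \<in> carrier (FM R n). E v = v}"
  shows "projective_module R ((FM R n)\<lparr>carrier := C\<rparr>)" "fin_gen_module R ((FM R n)\<lparr>carrier := C\<rparr>)"
proof -
  let ?C = "(FM R n)\<lparr>carrier := C\<rparr>"
  have "(\<lambda>v. v) \<in> mod_hom R (FM R n) (FM R n)" by (simp add: mod_hom_def)
  then have "submodule C R (FM R n)"
    unfolding C_def by (rule equalizer_submodule[OF FM_module FM_module E])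
  then have M: "module R ?C" by (rule submodule_module[OF FM_module])
  have i: "(\<lambda>v. v) \<in> mod_hom R ?C (FM R n)" by (simp add: mod_hom_def C_def)
  have EC: "E v \<in> C" if "v \<in> carrier (FM R n)" for v
    using mod_homD(1)[OF E that] EE[OF that] by (simp add: C_def)
  have e: "E \<in> mod_hom R (FM R n) ?C"
    by (rule mod_homI) (use EC mod_homD(2,3)[OF E] in \<open>simp_all del: free_module_simps\<close>)
  show "projective_module R ?C"
    by (rule projective_module_retract[OF FM_projective M i e]) (simp add: C_def)
  have "E ` carrier (FM R n) = carrier ?C"
  proof
    show "E ` carrier (FM R n) \<subseteq> carrier ?C" using EC by auto
    show "carrier ?C \<subseteq> E ` carrier (FM R n)"
    proof
      fix v assume "v \<in> carrier ?C"
      then have "v = E v" "v \<in> carrier (FM R n)" by (simp_all add: C_def)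
      then show "v \<in> E ` carrier (FM R n)" by (rule image_eqI)
    qed
  qed
  then show "fin_gen_module R ?C" by (rule fin_gen_image[OF FM_fin_gen M e])
qed

lemma (in noetherian_cring) FM_submodule_fin_gen_module:
  assumes H: "submodule H R (FM R n)"
  shows "fin_gen_module R ((FM R n)\<lparr>carrier := H\<rparr>)"
proof -
  obtain k f where f: "f \<in> mod_hom R (FM R k) (FM R n)" "f ` carrier (FM R k) = H"
    using FM_cover[OF H] by metis
  have "f \<in> mod_hom R (FM R k) ((FM R n)\<lparr>carrier := H\<rparr>)"
    by (rule mod_homI) (use f mod_homD(2,3)[OF f(1)] in auto)
  then show ?thesis
    by (rule fin_gen_image[OF FM_fin_gen submodule_module[OF FM_module H]]) (simp add: f(2))
qed

section \<open>The truncated Frobenius power and its homology\<close>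

locale split_frobenius_resolution = frobenius_resolution +
  fixes m :: nat and h :: "(nat \<Rightarrow> 'a) \<Rightarrow> nat \<Rightarrow> 'a"
  assumes h: "h \<in> mod_hom R (FM R (r m)) (FM R (r (Suc m)))"
    and split: "\<And>x. x \<in> carrier (FM R (r (Suc m))) \<Longrightarrow> D m (h (D m x)) = D m x"
    and m0: "Idl X = {\<zero>} \<or> m \<noteq> 0"
begin

definition hq :: "nat \<Rightarrow> (nat \<Rightarrow> 'a) \<Rightarrow> nat \<Rightarrow> 'a" where
  "hq e = frob_map R (p ^ e) (r (Suc m)) h"

text \<open>The projection onto the \<open>n\<close>-th module of the complex: in degree \<open>m\<close> the complement of the image
  of \<open>Dq e m\<close>, which is isomorphic to its cokernel.\<close>

definition trunc :: "nat \<Rightarrow> int \<Rightarrow> (nat \<Rightarrow> 'a) \<Rightarrow> nat \<Rightarrow> 'a" where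
  "trunc e n v = (if n < 0 \<or> int m < n then (\<lambda>_. \<zero>)
     else if n = int m then v \<ominus>\<^bsub>G m\<^esub> Dq e m (hq e v) else v)"

text \<open>Fixed points of \<open>trunc\<close> as carriers let a submodule of \<open>G m\<close>
  stand in for the cokernel in degree \<open>m\<close>, with elements in the type that
  \<open>has_reducer\<close> prescribes. The index \<open>nat n - 1\<close> occurs because
  \<open>Dq e j\<close> leaves degree \<open>Suc j\<close>.\<close>

definition Q :: "nat \<Rightarrow> ('a, nat \<Rightarrow> 'a) cplx" where
  "Q e = \<lparr>obj = (\<lambda>n. (G (nat n))\<lparr>carrier := {v \<in> carrier (G (nat n)). trunc e n v = v}\<rparr>),
     bdry = (\<lambda>n v. if 1 \<le> n \<and> n \<le> int m then Dq e (nat n - 1) v else (\<lambda>_. \<zero>))\<rparr>"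

lemma hq_hom: "hq e \<in> mod_hom R (G m) (G (Suc m))"
  unfolding hq_def by (rule frob_map_hom[OF pe(2) h])

lemma Dq_hq_Dq:
  assumes x: "x \<in> carrier (G (Suc m))"
  shows "Dq e m (hq e (Dq e m x)) = Dq e m x"
proof -
  have "Dq e m (hq e (Dq e m x)) = frob_map R (p ^ e) (r m) (\<lambda>x. D m (h x)) (Dq e m x)"
    unfolding Dq_def hq_def
    by (rule frob_map_comp[OF pe(1) D h mod_homD(1)[OF frob_map_hom[OF pe(2) D] x], symmetric])
  also have "\<dots> = frob_map R (p ^ e) (r m) (\<lambda>x. D m (h (D m x))) x"
    unfolding Dq_def by (rule frob_map_comp[OF pe(1) mod_hom_comp[OF h D] D x, symmetric])
  also have "\<dots> = Dq e m x"
    unfolding Dq_def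
    by (rule frob_map_cong[OF split pe(2) mod_hom_comp[OF D mod_hom_comp[OF h D]] D x])
      (auto intro: unit_vec_carrier)
  finally show ?thesis .
qed

lemma G_arith:
  assumes "v \<in> carrier (G j)" "w \<in> carrier (G j)"
  shows "v \<ominus>\<^bsub>G j\<^esub> w = v \<longleftrightarrow> w = \<zero>\<^bsub>G j\<^esub>" "v \<ominus>\<^bsub>G j\<^esub> \<zero>\<^bsub>G j\<^esub> = v" "v \<ominus>\<^bsub>G j\<^esub> v = \<zero>\<^bsub>G j\<^esub>"
    "\<zero>\<^bsub>G j\<^esub> = (\<lambda>_. \<zero>)" "w \<oplus>\<^bsub>G j\<^esub> \<zero>\<^bsub>G j\<^esub> = w"
proof -
  interpret F: module R "G j" by (rule FM_module)
  show "v \<ominus>\<^bsub>G j\<^esub> \<zero>\<^bsub>G j\<^esub> = v" "v \<ominus>\<^bsub>G j\<^esub> v = \<zero>\<^bsub>G j\<^esub>" "w \<oplus>\<^bsub>G j\<^esub> \<zero>\<^bsub>G j\<^esub> = w"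
    using assms by (simp_all add: F.M.minus_eq F.M.r_neg del: free_module_simps)
  show "\<zero>\<^bsub>G j\<^esub> = (\<lambda>_. \<zero>)" by simp
  show "v \<ominus>\<^bsub>G j\<^esub> w = v \<longleftrightarrow> w = \<zero>\<^bsub>G j\<^esub>"
  proof
    assume "v \<ominus>\<^bsub>G j\<^esub> w = v"
    then have "v \<oplus>\<^bsub>G j\<^esub> (\<ominus>\<^bsub>G j\<^esub> w) = v \<oplus>\<^bsub>G j\<^esub> \<zero>\<^bsub>G j\<^esub>"
      using assms by (simp add: F.M.minus_eq del: free_module_simps)
    then have "\<ominus>\<^bsub>G j\<^esub> w = \<zero>\<^bsub>G j\<^esub>"
      using assms F.M.add.l_cancel[of v "\<ominus>\<^bsub>G j\<^esub> w" "\<zero>\<^bsub>G j\<^esub>"] by (simp del: free_module_simps)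
    then show "w = \<zero>\<^bsub>G j\<^esub>" using assms F.M.minus_minus[of w] by (simp del: free_module_simps)
  next
    assume "w = \<zero>\<^bsub>G j\<^esub>"
    then show "v \<ominus>\<^bsub>G j\<^esub> w = v" using assms by (simp add: F.M.minus_eq del: free_module_simps)
  qed
qed

lemma trunc_hom: "trunc e n \<in> mod_hom R (G (nat n)) (G (nat n))"
proof -
  have id: "(\<lambda>v. v) \<in> mod_hom R (G j) (G j)" for j by (simp add: mod_hom_def)
  consider "n < 0 \<or> int m < n" | "n = int m" | "0 \<le> n" "n < int m" by linarith
  then show ?thesis
  proof cases
    case 1
    then have "trunc e n = (\<lambda>v. \<zero>\<^bsub>G (nat n)\<^esub>)" by (auto simp: trunc_def)
    then show ?thesis using zero_hom by (simp del: free_module_simps)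
  next
    case 2
    then have "trunc e n = (\<lambda>v. v \<ominus>\<^bsub>G m\<^esub> Dq e m (hq e v))" by (auto simp: trunc_def)
    moreover have "(\<lambda>v. v \<ominus>\<^bsub>G m\<^esub> Dq e m (hq e v)) \<in> mod_hom R (G m) (G m)"
      by (rule mod_hom_diff[OF FM_module FM_module id mod_hom_comp[OF hq_hom Dq_hom]])
    ultimately show ?thesis using 2 by simp
  next
    case 3
    then have "trunc e n = (\<lambda>v. v)" by (auto simp: trunc_def)
    then show ?thesis using id by simp
  qed
qed

text \<open>By \<open>Dq_hq_Dq\<close>, \<open>hq\<close> followed by \<open>Dq\<close> is
  idempotent, and \<open>trunc\<close> in degree \<open>m\<close> is the complementary
  projection.\<close>

lemma Dq_hq_trunc:
  assumes v: "v \<in> carrier (G m)"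
  shows "Dq e m (hq e (trunc e (int m) v)) = \<zero>\<^bsub>G m\<^esub>"
proof -
  have hv: "hq e v \<in> carrier (G (Suc m))" by (rule mod_homD(1)[OF hq_hom v])
  have Dv: "Dq e m (hq e v) \<in> carrier (G m)" by (rule mod_homD(1)[OF Dq_hom hv])
  have "Dq e m (hq e (v \<ominus>\<^bsub>G m\<^esub> Dq e m (hq e v)))
      = Dq e m (hq e v) \<ominus>\<^bsub>G m\<^esub> Dq e m (hq e (Dq e m (hq e v)))"
    by (rule mod_hom_minus[OF FM_module FM_module mod_hom_comp[OF hq_hom Dq_hom] v Dv])
  also have "\<dots> = \<zero>\<^bsub>G m\<^esub>" unfolding Dq_hq_Dq[OF hv] by (rule G_arith(3)[OF Dv Dv])
  finally show ?thesis by (simp add: trunc_def del: free_module_simps)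
qed

lemma trunc_top_iff:
  assumes v: "v \<in> carrier (G m)"
  shows "trunc e (int m) v = v \<longleftrightarrow> Dq e m (hq e v) = \<zero>\<^bsub>G m\<^esub>"
  using G_arith(1)[OF v mod_homD(1)[OF Dq_hom mod_homD(1)[OF hq_hom v]]]
  by (simp add: trunc_def del: free_module_simps)

lemma trunc_trunc:
  assumes v: "v \<in> carrier (G (nat n))"
  shows "trunc e n (trunc e n v) = trunc e n v"
proof (cases "n = int m")
  case True
  then have vm: "v \<in> carrier (G m)" using v by simp
  have "trunc e (int m) v \<in> carrier (G m)" using mod_homD(1)[OF trunc_hom v] True by simp
  then show ?thesis using trunc_top_iff Dq_hq_trunc[OF vm] True by blast
qed (simp add: trunc_def)

text \<open>In degree \<open>m\<close>, \<open>trunc\<close> changes an element by a boundary of the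
  untruncated complex, which the next differential kills; below, it changes nothing.\<close>

lemma Dq_trunc:
  assumes j: "Suc j \<le> m" and v: "v \<in> carrier (G (Suc j))"
  shows "Dq e j (trunc e (int (Suc j)) v) = Dq e j v"
proof (cases "Suc j = m")
  case True
  have vm: "v \<in> carrier (G m)" using v True by simp
  have hv: "hq e v \<in> carrier (G (Suc m))" by (rule mod_homD(1)[OF hq_hom vm])
  have Dv: "Dq e m (hq e v) \<in> carrier (G m)" by (rule mod_homD(1)[OF Dq_hom hv])
  have Djv: "Dq e j v \<in> carrier (G j)" by (rule mod_homD(1)[OF Dq_hom v])
  have "Dq e j (v \<ominus>\<^bsub>G (Suc j)\<^esub> Dq e (Suc j) (hq e v)) = Dq e j v \<ominus>\<^bsub>G j\<^esub> Dq e j (Dq e (Suc j) (hq e v))"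
    by (rule mod_hom_minus[OF FM_module FM_module Dq_hom v]) (use Dv True in simp)
  also have "Dq e j (Dq e (Suc j) (hq e v)) = \<zero>\<^bsub>G j\<^esub>" by (rule Dq_Dq) (use hv True in simp)
  also have "Dq e j v \<ominus>\<^bsub>G j\<^esub> \<zero>\<^bsub>G j\<^esub> = Dq e j v" by (rule G_arith(2)[OF Djv Djv])
  finally show ?thesis using True by (simp add: trunc_def del: free_module_simps)
qed (use j in \<open>simp add: trunc_def\<close>)

lemma Q_carrier: "carrier (obj (Q e) n) = {v \<in> carrier (G (nat n)). trunc e n v = v}"
  by (simp add: Q_def)

text \<open>The index \<open>j\<close> is arbitrary: the operations of \<open>FM\<close> are
  pointwise and do not depend on the rank.\<close>

lemma Q_ops: "\<zero>\<^bsub>obj (Q e) n\<^esub> = \<zero>\<^bsub>G j\<^esub>" "v \<oplus>\<^bsub>obj (Q e) n\<^esub> w = v \<oplus>\<^bsub>G j\<^esub> w" "a \<odot>\<^bsub>obj (Q e) n\<^esub> v = a \<odot>\<^bsub>G j\<^esub> v"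
  by (simp_all add: Q_def)

lemma Q_projective: "projective_module R (obj (Q e) n)" and Q_fin_gen: "fin_gen_module R (obj (Q e) n)"
  using FM_retract[OF trunc_hom[where e = e and n = n] trunc_trunc[where e = e and n = n]]
  by (simp_all add: Q_def)

lemma Q_module: "module R (obj (Q e) n)"
  using Q_projective by (simp add: projective_module_def)

lemma Q_zero: "n < 0 \<or> int m < n \<Longrightarrow> carrier (obj (Q e) n) = {\<zero>\<^bsub>obj (Q e) n\<^esub>}"
  unfolding Q_carrier by (auto simp: trunc_def Q_def FM_carrier_iff)

lemma Q_bdry_hom: "bdry (Q e) n \<in> mod_hom R (obj (Q e) n) (obj (Q e) (n - 1))"
proof (cases "1 \<le> n \<and> n \<le> int m")
  case True
  define j where "j = nat n - 1"
  have n: "n = int (Suc j)" "nat n = Suc j" "nat (n - 1) = j" and jm: "j < m" using True by (auto simp: j_def)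
  have b: "bdry (Q e) n = Dq e j" using True n by (auto simp: Q_def fun_eq_iff)
  show ?thesis unfolding b
  proof (rule mod_homI)
    fix x assume x: "x \<in> carrier (obj (Q e) n)"
    then have xG: "x \<in> carrier (G (Suc j))" by (simp add: Q_carrier n(2))
    then show "Dq e j x \<in> carrier (obj (Q e) (n - 1))"
      using mod_homD(1)[OF Dq_hom xG, of e] jm n by (simp add: Q_carrier trunc_def)
    fix y assume "y \<in> carrier (obj (Q e) n)"
    then have yG: "y \<in> carrier (G (Suc j))" by (simp add: Q_carrier n(2))
    show "Dq e j (x \<oplus>\<^bsub>obj (Q e) n\<^esub> y) = Dq e j x \<oplus>\<^bsub>obj (Q e) (n - 1)\<^esub> Dq e j y"
      using mod_homD(2)[OF Dq_hom xG yG, of e] by (simp only: Q_ops(2)[of e n _ _ "Suc j"] Q_ops(2)[of e "n - 1" _ _ j])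
  next
    fix a x assume a: "a \<in> carrier R" and "x \<in> carrier (obj (Q e) n)"
    then have xG: "x \<in> carrier (G (Suc j))" by (simp add: Q_carrier n(2))
    show "Dq e j (a \<odot>\<^bsub>obj (Q e) n\<^esub> x) = a \<odot>\<^bsub>obj (Q e) (n - 1)\<^esub> Dq e j x"
      using mod_homD(3)[OF Dq_hom a xG, of e] by (simp only: Q_ops(3)[of e n _ _ "Suc j"] Q_ops(3)[of e "n - 1" _ _ j])
  qed
next
  case False
  interpret M: module R "obj (Q e) (n - 1)" by (rule Q_module)
  have "bdry (Q e) n = (\<lambda>x. \<zero>\<^bsub>obj (Q e) (n - 1)\<^esub>)" using False by (auto simp: Q_def)
  then show ?thesis by (auto intro!: mod_homI)
qed

lemma Q_chain_complex: "chain_complex R (Q e)"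
  unfolding chain_complex_def
proof (intro allI conjI Q_module Q_bdry_hom ballI)
  fix n x assume x: "x \<in> carrier (obj (Q e) n)"
  have z: "bdry (Q e) k (\<lambda>_. \<zero>) = (\<lambda>_. \<zero>)" for k
    using mod_hom_zero[OF Q_module Q_module Q_bdry_hom, of e k] by (simp add: Q_ops(1)[of e _ 0])
  have "bdry (Q e) (n - 1) (bdry (Q e) n x) = (\<lambda>_. \<zero>)"
  proof (cases "2 \<le> n \<and> n \<le> int m")
    case True
    define j where "j = nat n - 2"
    have n: "nat n - 1 = Suc j" "nat (n - 1) - 1 = j" "nat n = Suc (Suc j)" using True by (auto simp: j_def)
    have "x \<in> carrier (G (Suc (Suc j)))" using x n by (simp add: Q_carrier)
    from Dq_Dq[OF this, of e] True n show ?thesis by (simp add: Q_def)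
  next
    case False
    then have "bdry (Q e) n x = (\<lambda>_. \<zero>) \<or> bdry (Q e) (n - 1) (bdry (Q e) n x) = (\<lambda>_. \<zero>)"
      by (auto simp: Q_def)
    then show ?thesis using z by metis
  qed
  then show "bdry (Q e) (n - 1) (bdry (Q e) n x) = \<zero>\<^bsub>obj (Q e) (n - 1 - 1)\<^esub>"
    by (simp add: Q_ops(1)[of e _ 0])
qed

text \<open>Multiplication by \<open>t\<close> is null-homotopic on \<open>G\<close>, hence multiplication by its \<open>q\<close>-th power is on
  the \<open>q\<close>-th Frobenius power.\<close>

lemma null_homotopy:
  assumes t: "t \<in> X"
  obtains H where "\<And>j. H j \<in> mod_hom R (G j) (G (Suc j))"
    "\<And>x. x \<in> carrier (G 0) \<Longrightarrow> Dq e 0 (H 0 x) = (t [^] (p ^ e)) \<odot>\<^bsub>G 0\<^esub> x"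
    "\<And>j x. x \<in> carrier (G (Suc j)) \<Longrightarrow>
      Dq e (Suc j) (H (Suc j) x) \<oplus>\<^bsub>G (Suc j)\<^esub> H j (Dq e j x) = (t [^] (p ^ e)) \<odot>\<^bsub>G (Suc j)\<^esub> x"
proof -
  have tR: "t \<in> carrier R" using t X by blast
  interpret I: ideal "Idl X" R by (rule genideal_ideal[OF X(2)])
  have tI: "t \<in> Idl X" using genideal_self[OF X(2)] t by blast
  let ?c = "\<lambda>j x. t \<odot>\<^bsub>G j\<^esub> x"
  have id: "(\<lambda>v. v) \<in> mod_hom R (G j) (G j)" for j by (simp add: mod_hom_def)
  have c: "?c j \<in> mod_hom R (G j) (G j)" for j
    by (rule mod_hom_smult[OF FM_module id tR])
  have cD: "D j (?c (Suc j) x) = ?c j (D j x)" if "x \<in> carrier (G (Suc j))" for j x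
    by (rule mod_homD(3)[OF D tR that])
  have c0: "?c 0 x \<in> D 0 ` carrier (G (Suc 0))" if x: "x \<in> carrier (G 0)" for x
    unfolding im0 using x mod_homD(1)[OF c x] r0 I.I_r_closed[OF tI] by (auto simp: FM_carrier_iff)
  show thesis
  proof (rule chain_homotopy[where G = G and D = D and c = ?c, OF FM_projective D DD exact c cD c0])
    fix H assume H: "\<And>j. H j \<in> mod_hom R (G j) (G (Suc j))"
      "\<And>x. x \<in> carrier (G 0) \<Longrightarrow> D 0 (H 0 x) = ?c 0 x"
      "\<And>j x. x \<in> carrier (G (Suc j)) \<Longrightarrow> D (Suc j) (H (Suc j) x) = ?c (Suc j) x \<ominus>\<^bsub>G (Suc j)\<^esub> H j (D j x)"
    let ?H = "\<lambda>j. frob_map R (p ^ e) (r (Suc j)) (H j)"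
    show thesis
    proof (rule that)
      show "?H j \<in> mod_hom R (G j) (G (Suc j))" for j by (rule frob_map_hom[OF pe(2) H(1)])
      show "Dq e 0 (?H 0 x) = (t [^] (p ^ e)) \<odot>\<^bsub>G 0\<^esub> x" if x: "x \<in> carrier (G 0)" for x
      proof -
        have "Dq e 0 (?H 0 x) = frob_map R (p ^ e) (r 0) (\<lambda>x. D 0 (H 0 x)) x"
          unfolding Dq_def by (rule frob_map_comp[OF pe(1) D H(1) x, symmetric])
        also have "\<dots> = frob_map R (p ^ e) (r 0) (?c 0) x"
          by (rule frob_map_cong[OF H(2) pe(2) mod_hom_comp[OF H(1) D] c x]) (auto intro: unit_vec_carrier)
        also have "\<dots> = (t [^] (p ^ e)) \<odot>\<^bsub>G 0\<^esub> x" by (rule frob_map_smult[OF pe(2) tR x])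
        finally show ?thesis .
      qed
      show "Dq e (Suc j) (?H (Suc j) x) \<oplus>\<^bsub>G (Suc j)\<^esub> ?H j (Dq e j x) = (t [^] (p ^ e)) \<odot>\<^bsub>G (Suc j)\<^esub> x"
        if x: "x \<in> carrier (G (Suc j))" for j x
      proof -
        interpret F: module R "G (Suc j)" by (rule FM_module)
        let ?f = "\<lambda>x. D (Suc j) (H (Suc j) x)" and ?g = "\<lambda>x. H j (D j x)"
        have fh: "?f \<in> mod_hom R (G (Suc j)) (G (Suc j))" by (rule mod_hom_comp[OF H(1) D])
        have gh: "?g \<in> mod_hom R (G (Suc j)) (G (Suc j))" by (rule mod_hom_comp[OF D H(1)])
        have sum: "?f y \<oplus>\<^bsub>G (Suc j)\<^esub> ?g y = ?c (Suc j) y" if y: "y \<in> carrier (G (Suc j))" for y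
          unfolding H(3)[OF y] using mod_homD(1)[OF c y] mod_homD(1)[OF gh y]
          by (simp add: F.M.minus_eq F.M.a_assoc F.M.l_neg del: free_module_simps)
        have "Dq e (Suc j) (?H (Suc j) x) = frob_map R (p ^ e) (r (Suc j)) ?f x"
          unfolding Dq_def by (rule frob_map_comp[OF pe(1) D H(1) x, symmetric])
        moreover have "?H j (Dq e j x) = frob_map R (p ^ e) (r (Suc j)) ?g x"
          unfolding Dq_def by (rule frob_map_comp[OF pe(1) H(1) D x, symmetric])
        moreover have "frob_map R (p ^ e) (r (Suc j)) (\<lambda>x. ?f x \<oplus>\<^bsub>G (Suc j)\<^esub> ?g x) x
            = frob_map R (p ^ e) (r (Suc j)) ?f x \<oplus>\<^bsub>G (Suc j)\<^esub> frob_map R (p ^ e) (r (Suc j)) ?g x"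
          by (rule frob_map_add[OF pe(1) fh gh x])
        moreover have "frob_map R (p ^ e) (r (Suc j)) (\<lambda>x. ?f x \<oplus>\<^bsub>G (Suc j)\<^esub> ?g x) x
            = frob_map R (p ^ e) (r (Suc j)) (?c (Suc j)) x"
          by (rule frob_map_cong[OF sum pe(2) mod_hom_add[OF FM_module fh gh] c x]) (auto intro: unit_vec_carrier)
        moreover have "\<dots> = (t [^] (p ^ e)) \<odot>\<^bsub>G (Suc j)\<^esub> x" by (rule frob_map_smult[OF pe(2) tR x])
        ultimately show ?thesis by (simp only:)
      qed
    qed
  qed
qed

text \<open>By the homotopy, the multiple of \<open>x\<close> is the boundary of \<open>H x\<close>
  in the untruncated complex. Below degree \<open>m\<close>, projecting by \<open>trunc\<close>
  turns this into a boundary of \<open>Q e\<close>; in degree \<open>m\<close> nothing lies above,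
  and the multiple has to vanish.\<close>

lemma Q_cycles_annihilated:
  assumes t: "t \<in> X" and x: "x \<in> cycles (Q e) n"
  shows "(t [^] (p ^ e)) \<odot>\<^bsub>obj (Q e) n\<^esub> x \<in> boundaries (Q e) n"
proof -
  have tR: "t [^] (p ^ e) \<in> carrier R" using t X(2) by auto
  note hf = homology_facts[OF Q_chain_complex, of e n]
  have xQ: "x \<in> carrier (obj (Q e) n)" and dx: "bdry (Q e) n x = \<zero>\<^bsub>obj (Q e) (n - 1)\<^esub>"
    using x unfolding hf(1) by simp_all
  have zb: "\<zero>\<^bsub>obj (Q e) n\<^esub> \<in> boundaries (Q e) n" using submoduleD(2)[OF hf(4)] by simp
  interpret M: module R "obj (Q e) n" by (rule Q_module)
  show ?thesis
  proof (cases "n < 0 \<or> int m < n")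
    case True
    then have "x = \<zero>\<^bsub>obj (Q e) n\<^esub>" using xQ Q_zero by blast
    then show ?thesis using zb tR by simp
  next
    case False
    define i where "i = nat n"
    have n: "n = int i" and im: "i \<le> m" using False by (auto simp: i_def)
    have xG: "x \<in> carrier (G i)" and xt: "trunc e (int i) x = x" using xQ by (simp_all add: Q_carrier n)
    obtain H where H: "\<And>j. H j \<in> mod_hom R (G j) (G (Suc j))"
      "\<And>x. x \<in> carrier (G 0) \<Longrightarrow> Dq e 0 (H 0 x) = (t [^] (p ^ e)) \<odot>\<^bsub>G 0\<^esub> x"
      "\<And>j x. x \<in> carrier (G (Suc j)) \<Longrightarrow>
        Dq e (Suc j) (H (Suc j) x) \<oplus>\<^bsub>G (Suc j)\<^esub> H j (Dq e j x) = (t [^] (p ^ e)) \<odot>\<^bsub>G (Suc j)\<^esub> x"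
      by (rule null_homotopy[OF t, where e = e]) (rule that)
    have Hx: "H i x \<in> carrier (G (Suc i))" by (rule mod_homD(1)[OF H(1) xG])
    have eq: "Dq e i (H i x) = (t [^] (p ^ e)) \<odot>\<^bsub>G i\<^esub> x"
    proof (cases i)
      case 0
      then show ?thesis using H(2) xG by simp
    next
      case (Suc j)
      have xG': "x \<in> carrier (G (Suc j))" using xG Suc by simp
      have "Dq e j x = \<zero>\<^bsub>G j\<^esub>" using dx im by (simp add: Q_def n Suc nat_add_distrib)
      then have "H j (Dq e j x) = \<zero>\<^bsub>G (Suc j)\<^esub>"
        using mod_hom_zero[OF FM_module FM_module H(1)[of j]] by (simp only:)
      then have "Dq e (Suc j) (H (Suc j) x) \<oplus>\<^bsub>G (Suc j)\<^esub> \<zero>\<^bsub>G (Suc j)\<^esub> = (t [^] (p ^ e)) \<odot>\<^bsub>G (Suc j)\<^esub> x"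
        using H(3)[OF xG'] by (simp only:)
      moreover have "Dq e (Suc j) (H (Suc j) x) \<in> carrier (G (Suc j))"
        by (rule mod_homD(1)[OF Dq_hom mod_homD(1)[OF H(1) xG']])
      ultimately show ?thesis using G_arith(5) Suc by metis
    qed
    show ?thesis
    proof (cases "i = m")
      case True
      have xm: "x \<in> carrier (G m)" and Hm: "H i x \<in> carrier (G (Suc m))" using xG Hx True by simp_all
      \<comment> \<open>The multiple of \<open>x\<close> lies in the image of \<open>Dq e m\<close>
        and in its chosen complement: the projection to the image both fixes and kills it.\<close>
      have "Dq e m (hq e x) = \<zero>\<^bsub>G m\<^esub>" using xt trunc_top_iff[OF xm] True by blast
      then have "(t [^] (p ^ e)) \<odot>\<^bsub>G m\<^esub> Dq e m (hq e x) = \<zero>\<^bsub>G m\<^esub>"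
        using module.smult_r_null[OF FM_module tR] by (simp only:)
      moreover have "Dq e m (hq e ((t [^] (p ^ e)) \<odot>\<^bsub>G m\<^esub> x)) = (t [^] (p ^ e)) \<odot>\<^bsub>G m\<^esub> Dq e m (hq e x)"
        by (rule mod_homD(3)[OF mod_hom_comp[OF hq_hom Dq_hom] tR xm])
      moreover have "Dq e m (hq e ((t [^] (p ^ e)) \<odot>\<^bsub>G m\<^esub> x)) = (t [^] (p ^ e)) \<odot>\<^bsub>G m\<^esub> x"
        using Dq_hq_Dq[OF Hm, of e] eq True by simp
      ultimately have "(t [^] (p ^ e)) \<odot>\<^bsub>G m\<^esub> x = \<zero>\<^bsub>G m\<^esub>" by (simp only:)
      then have "(t [^] (p ^ e)) \<odot>\<^bsub>obj (Q e) n\<^esub> x = \<zero>\<^bsub>obj (Q e) n\<^esub>"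
        by (simp only: Q_ops(1)[of e n m] Q_ops(3)[of e n _ _ m])
      then show ?thesis using zb by (simp only:)
    next
      case False
      then have i: "Suc i \<le> m" using im by simp
      let ?y = "trunc e (int (Suc i)) (H i x)"
      have Hx': "H i x \<in> carrier (G (nat (int (Suc i))))" using Hx by (simp add: nat_add_distrib)
      have y: "?y \<in> carrier (obj (Q e) (n + 1))"
        using mod_homD(1)[OF trunc_hom Hx', of e] trunc_trunc[OF Hx', of e]
        by (simp add: Q_carrier n add.commute)
      have "bdry (Q e) (n + 1) ?y = Dq e i ?y" using i by (simp add: Q_def n nat_add_distrib)
      also have "\<dots> = (t [^] (p ^ e)) \<odot>\<^bsub>G i\<^esub> x" using Dq_trunc[OF i Hx, of e] eq by simp
      also have "\<dots> = (t [^] (p ^ e)) \<odot>\<^bsub>obj (Q e) n\<^esub> x" by (simp only: Q_ops(3)[of e n _ _ i])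
      finally show ?thesis unfolding boundaries_def using y by (metis imageI)
    qed
  qed
qed

lemma Q_Ch_L:
  assumes "m \<le> k"
  shows "Ch_L R (zariski_closed R (Idl X)) k (Q e)"
  unfolding Ch_L_def
proof (intro conjI allI Q_chain_complex Q_fin_gen Q_projective)
  show "concentrated k (Q e)" unfolding concentrated_def
  proof (intro allI impI)
    fix n :: int assume "n < 0 \<or> int k < n"
    then show "carrier (obj (Q e) n) = {\<zero>\<^bsub>obj (Q e) n\<^esub>}" using assms by (intro Q_zero) auto
  qed
  fix n
  note hf = homology_facts[OF Q_chain_complex, of e n]
  have eq: "(obj (Q e) n)\<lparr>carrier := cycles (Q e) n\<rparr> = (G (nat n))\<lparr>carrier := cycles (Q e) n\<rparr>"
    by (simp add: Q_def)
  have sub: "submodule (cycles (Q e) n) R (G (nat n))"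
  proof (rule module.module_incl_imp_submodule[OF FM_module])
    show "cycles (Q e) n \<subseteq> carrier (G (nat n))" unfolding hf(1) Q_carrier by auto
    show "module R ((G (nat n))\<lparr>carrier := cycles (Q e) n\<rparr>)" using hf(3) unfolding eq .
  qed
  have fg: "fin_gen_module R ((obj (Q e) n)\<lparr>carrier := cycles (Q e) n\<rparr>)"
    unfolding eq by (rule FM_submodule_fin_gen_module[OF sub])
  have H: "fin_gen_module R (homology R (Q e) n)"
    unfolding homology_def
    by (rule fin_gen_image[OF fg quotient_module_module[OF hf(3,4)] quotient_proj(1,2)[OF hf(3,4)]])
  show "in_L R (zariski_closed R (Idl X)) (homology R (Q e) n)"
  proof (rule in_L_annihilatedI[OF H X(2)])
    fix t z assume t: "t \<in> X" and z: "z \<in> carrier (homology R (Q e) n)"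
    have "t [^] (p ^ e) \<in> carrier R" using t X(2) by auto
    from homology_smult_zero_iff[OF Q_chain_complex this, of e n] Q_cycles_annihilated[OF t] z
    show "(t [^] (p ^ e)) \<odot>\<^bsub>homology R (Q e) n\<^esub> z = \<zero>\<^bsub>homology R (Q e) n\<^esub>" by blast
  qed
qed

text \<open>A reducer maps onto degree 0 of the given complex, so \<open>Q e\<close> has to keep all
  of \<open>G 0\<close>. For \<open>m = 0\<close> this rests on \<open>m0\<close>: the ideal is
  zero, hence so are \<open>D 0\<close> and its Frobenius power, and the projection is the
  identity.\<close>

lemma trunc_0:
  assumes v: "v \<in> carrier (G 0)"
  shows "trunc e 0 v = v"
proof (cases "m = 0")
  case True
  then have I0: "Idl X = {\<zero>}" using m0 by simp
  have "Dq e 0 x = \<zero>\<^bsub>G 0\<^esub>" if x: "x \<in> carrier (G (Suc 0))" for x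
    unfolding Dq_def
  proof (rule frob_map_eqI[OF pe(2) D zero_hom _ x])
    fix b assume "b < r (Suc 0)"
    then have "unit_vec R b \<in> carrier (G (Suc 0))" by (auto intro: unit_vec_carrier)
    then have "D 0 (unit_vec R b) \<in> {v \<in> carrier (FM R g). \<forall>i. v i \<in> Idl X}" using im0 by blast
    then have "D 0 (unit_vec R b) = \<zero>\<^bsub>G 0\<^esub>" by (auto simp: I0)
    then show "\<zero>\<^bsub>G 0\<^esub> = frob_vec R (p ^ e) (D 0 (unit_vec R b))"
      using frob_vec_zero[OF pe(2)] by (simp only:)
  qed
  then have "Dq e m (hq e v) = \<zero>\<^bsub>G m\<^esub>" using mod_homD(1)[OF hq_hom, of v e] v True by simp
  then show ?thesis using trunc_top_iff[of v e] v True by (simp del: free_module_simps)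
qed (simp add: trunc_def)

text \<open>The extension restricts to \<open>Q e\<close> in degrees up to \<open>m\<close>, above
  which \<open>Q e\<close> is zero; \<open>m < k\<close> puts it into degrees at most
  \<open>k - 1\<close>. Surjectivity in degree 0 is that of \<open>\<pi>\<close>, by
  \<open>trunc_0\<close>.\<close>

lemma has_reducer:
  fixes C :: "('a, 'c) cplx"
  assumes C: "Ch_L R (zariski_closed R (Idl X)) k C" and mk: "m < k"
    and \<pi>: "\<pi> \<in> mod_hom R (G 0) (obj C 0)" "\<pi> ` carrier (G 0) = carrier (obj C 0)"
  shows "has_reducer R (zariski_closed R (Idl X)) k C"
proof -
  have cC: "chain_complex R C" and conc: "concentrated k C" using C by (simp_all add: Ch_L_def)
  have M: "module R (obj C n)" and d: "bdry C n \<in> mod_hom R (obj C n) (obj C (n - 1))" for n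
    using cC by (simp_all add: chain_complex_def)
  obtain e \<psi> where c: "extends_upto C \<pi> m e \<psi>"
    using extension[OF C \<pi>(1), where i = m] by (elim exE)
  have \<psi>: "\<And>j. j \<le> m \<Longrightarrow> \<psi> j \<in> mod_hom R (G j) (obj C (int j))"
    "\<And>v. v \<in> carrier (G 0) \<Longrightarrow> \<psi> 0 v = \<pi> v"
    "\<And>j v. j < m \<Longrightarrow> v \<in> carrier (G (Suc j)) \<Longrightarrow> bdry C (int (Suc j)) (\<psi> (Suc j) v) = \<psi> j (Dq e j v)"
    using c by (simp_all add: extends_upto_def)
  define u where "u n = (if 0 \<le> n \<and> n \<le> int m then \<psi> (nat n) else (\<lambda>_. \<zero>\<^bsub>obj C n\<^esub>))" for n
  have u: "u n \<in> mod_hom R (obj (Q e) n) (obj C n)" for n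
  proof (cases "0 \<le> n \<and> n \<le> int m")
    case True
    then have "\<psi> (nat n) \<in> mod_hom R (G (nat n)) (obj C n)" using \<psi>(1)[of "nat n"] by auto
    note h = mod_homD[OF this]
    have "u n = \<psi> (nat n)" using True by (simp add: u_def)
    then show ?thesis
      by (intro mod_homI) (simp_all only: Q_ops(2,3)[of _ _ _ _ "nat n"] h Q_carrier mem_Collect_eq)
  next
    case False
    interpret N: module R "obj C n" by (rule M)
    have "u n = (\<lambda>_. \<zero>\<^bsub>obj C n\<^esub>)" using False by (auto simp: u_def)
    then show ?thesis by (auto intro!: mod_homI)
  qed
  have "bdry C n (u n x) = u (n - 1) (bdry (Q e) n x)" if x: "x \<in> carrier (obj (Q e) n)" for n x
  proof (cases "1 \<le> n \<and> n \<le> int m")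
    case True
    define j where "j = nat n - 1"
    have n: "n = int (Suc j)" "nat n = Suc j" "n - 1 = int j" and jm: "j < m" using True by (auto simp: j_def)
    have "x \<in> carrier (G (Suc j))" using x by (simp add: Q_carrier n(2))
    from \<psi>(3)[OF jm this] show ?thesis
      using True jm unfolding u_def by (simp add: Q_def n nat_add_distrib)
  next
    case False
    have "bdry (Q e) n x = \<zero>\<^bsub>obj (Q e) (n - 1)\<^esub>" using False by (auto simp: Q_def)
    then have R: "u (n - 1) (bdry (Q e) n x) = \<zero>\<^bsub>obj C (n - 1)\<^esub>"
      using mod_hom_zero[OF Q_module M u] by simp
    have "bdry C n (u n x) = \<zero>\<^bsub>obj C (n - 1)\<^esub>"
    \<comment> \<open>Degree 0 stands apart: \<open>u 0\<close> is nonzero in general, but the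
      boundary of \<open>C\<close> out of degree 0 has zero target.\<close>
    proof (cases "n = 0")
      case True
      then have "carrier (obj C (n - 1)) = {\<zero>\<^bsub>obj C (n - 1)\<^esub>}" using conc by (simp add: concentrated_def)
      then show ?thesis using mod_homD(1)[OF d mod_homD(1)[OF u x]] by blast
    next
      case n0: False
      then have "u n x = \<zero>\<^bsub>obj C n\<^esub>" using False by (auto simp: u_def)
      then show ?thesis using mod_hom_zero[OF M M d] by simp
    qed
    then show ?thesis using R by simp
  qed
  then have cm: "chain_map R (Q e) C u" unfolding chain_map_def using u by blast
  have "carrier (obj (Q e) 0) = carrier (G 0)" unfolding Q_carrier using trunc_0 by auto
  then have "u 0 ` carrier (obj (Q e) 0) = carrier (obj C 0)"
    using \<pi>(2) \<psi>(2) by (simp add: u_def)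
  moreover have "Ch_L R (zariski_closed R (Idl X)) (k - 1) (Q e)" by (rule Q_Ch_L) (use mk in simp)
  ultimately show ?thesis using cm unfolding has_reducer_def reducer_def by blast
qed

end

text \<open>The bound by \<open>k\<close> forces a finite \<open>m\<close>, and \<open>pd0\<close>
  turns into the condition \<open>m0\<close> that protects degree 0 from truncation.\<close>

theorem (in noetherian_cring) has_reducer_if_pd_less:
  fixes C :: "('a, 'c) cplx"
  assumes p: "Factorial_Ring.prime p" "ring_char R = p"
    and X: "finite X" "X \<subseteq> carrier R"
    and pd0: "Idl X = {\<zero>} \<or> projective_dimension R (quotient_module R (regular_module R) (Idl X)) \<noteq> 0"
    and k: "projective_dimension R (quotient_module R (regular_module R) (Idl X)) < enat k"
    and C: "Ch_L R (zariski_closed R (Idl X)) k C"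
  shows "has_reducer R (zariski_closed R (Idl X)) k C"
proof -
  obtain m and F :: "('a, nat \<times> 'a \<times> 'a set \<Rightarrow> 'a) cplx" and \<epsilon>
    where pdm: "projective_dimension R (quotient_module R (regular_module R) (Idl X)) = enat m" and mk: "m < k"
      and res: "projective_resolution R (quotient_module R (regular_module R) (Idl X)) m F \<epsilon>"
    using projective_dimension_less_obtain[OF k] by metis
  have m0: "Idl X = {\<zero>} \<or> m \<noteq> 0" using pd0 pdm by (auto simp: zero_enat_def)
  have fg: "fin_gen_module R (obj C 0)" using C by (simp add: Ch_L_def)
  obtain g \<pi> where \<pi>: "\<pi> \<in> mod_hom R (FM R g) (obj C 0)" "\<pi> ` carrier (FM R g) = carrier (obj C 0)"
    using fin_gen_cover[OF fg] by metis
  have I: "ideal (Idl X) R" by (rule genideal_ideal[OF X(2)])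
  interpret I: ideal "Idl X" R by (rule I)
  interpret Fg: module R "FM R g" by (rule FM_module)
  have H: "submodule {v \<in> carrier (FM R g). \<forall>i. v i \<in> Idl X} R (FM R g)"
    by (rule Fg.submoduleI') (auto simp: FM_carrier_iff I.I_l_closed)
  obtain r D where r0: "r 0 = g" and D: "\<And>j. D j \<in> mod_hom R (FM R (r (Suc j))) (FM R (r j))"
    and im0: "D 0 ` carrier (FM R (r (Suc 0))) = {v \<in> carrier (FM R g). \<forall>i. v i \<in> Idl X}"
    and im: "\<And>j. D (Suc j) ` carrier (FM R (r (Suc (Suc j)))) = {x \<in> carrier (FM R (r (Suc j))). D j x = \<zero>\<^bsub>FM R (r j)\<^esub>}"
    by (rule free_resolution[OF H]) (rule that)
  obtain h where h: "h \<in> mod_hom R (FM R (r m)) (FM R (r (Suc m)))"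
    "\<And>x. x \<in> carrier (FM R (r (Suc m))) \<Longrightarrow> D m (h (D m x)) = D m x"
    by (rule resolution_split[OF I res r0 D im0 im]) (rule that)
  have p1: "1 < p" by (rule prime_gt_1_nat[OF p(1)])
  interpret split_frobenius_resolution R X p g r D m h
    by unfold_locales (fact X additive_power_char[OF p] p1 r0 D im0 im h m0)+
  show ?thesis by (rule has_reducer[OF C mk]) (use \<pi> r0 in simp_all)
qed

theorem lemma3p14:
  fixes R :: "('a, 'm) ring_scheme" and p d :: nat and s :: "nat \<Rightarrow> 'a" and I :: "'a set"
  assumes "cring R" and "noetherian_ring R"
    and "Factorial_Ring.prime p" and "ring_char R = p"
    and "\<And>i. i \<in> {1..d} \<Longrightarrow> s i \<in> carrier R"
    and "I = Idl\<^bsub>R\<^esub> (s ` {1..d})"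
    and "I = {\<zero>\<^bsub>R\<^esub>} \<or> projective_dimension R (quotient_module R (regular_module R) I) \<noteq> 0"
  shows "(\<forall>k. \<forall>P :: ('a, 'b) cplx.
            enat k > projective_dimension R (quotient_module R (regular_module R) I) \<longrightarrow>
            Ch_L R (zariski_closed R I) k P \<longrightarrow> has_reducer R (zariski_closed R I) k P)
       \<and> reduction_bound R (zariski_closed R I)
            \<le> projective_dimension R (quotient_module R (regular_module R) I)"
proof -
  interpret noetherian_cring R
    by (intro noetherian_cring.intro assms(1,2))
  let ?pd = "projective_dimension R (quotient_module R (regular_module R) I)"
  have X: "finite (s ` {1..d})" "s ` {1..d} \<subseteq> carrier R" using assms(5) by auto
  \<comment> \<open>This fact stays polymorphic in the type of the complex: it serves the first
    claim at \<open>'b\<close> and the bound at \<open>nat \<Rightarrow> 'a\<close>.\<close>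
  note red = has_reducer_if_pd_less[OF assms(3,4) X, folded assms(6), OF assms(7)]
  have "reduction_bound R (zariski_closed R I) \<le> ?pd"
  \<comment> \<open>For finite dimension \<open>m\<close>, the number \<open>m\<close> itself
    belongs to the set whose infimum is \<open>reduction_bound\<close>; for infinite dimension the
    bound is trivial.\<close>
  proof (cases ?pd)
    case (enat m)
    have "\<forall>k>m. \<forall>P :: ('a, nat \<Rightarrow> 'a) cplx. Ch_L R (zariski_closed R I) k P \<longrightarrow> has_reducer R (zariski_closed R I) k P"
      by (intro allI impI red) (simp_all add: enat)
    then show ?thesis unfolding reduction_bound_def enat by (intro Inf_lower) blast
  qed simp
  then show ?thesis using red by blast
qed

end
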